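(* The substitution of surjective maps defines a transformation of functors $\Gamma:\mathbb{P}\circ\mathbb{P}\to\mathbb{P}$ which is associative and unital. So $(\mathbb{P},\Gamma,\iota)$ is a monad on arity-graded modules.
   Context: $\mathbb{K}$ is a commutative ring; $\underline{n}=\{1,\dots,n\}$, and $\underline{0}$ is the empty set. An arity-graded module is a family $M=\{M_n\}_{n\ge 1}$ of $\mathbb{K}$-modules (a positively graded $\mathbb{K}$-module, the degree being called arity); these are the objects of the category of positively graded $\mathbb{K}$-modules. For $1\le k\le n$, $\mathrm{Sur}(\underline{n},\underline{k})$ is the set of surjective maps $t:\underline{n}\to\underline{k}$, and $\mathrm{Surj}_n=\bigcup_{k}\mathrm{Sur}(\underline{n},\underline{k})$ (disjoint union). By convention $\mathrm{Surj}_0=\{\mathbf{1}\}$, where $\mathbf{1}:\underline{0}\to\underline{0}$ is considered as a surjective map with no vertex. The elements $v$ of the target $\underline{k}$ are the vertices of $t$; the arity of $v$ is $|v|=\#t^{-1}(v)+1$. The unique element of $\mathrm{Sur}(\underline{n},\underline{1})$ is called a corolla and denoted $c_{n+1}$. Substitution: for $t\in\mathrm{Sur}(\underline{n},\underline{k})$ and $t_j\in\mathrm{Sur}(\underline{i_j},\underline{m_j})$ with $i_j=\#t^{-1}(j)$, $j=1,\dots,k$, put $m=\sum_j m_j$. The substitution of $\{t_j\}$ in $t$ is the surjective map $(t;t_1,\dots,t_k)\in\mathrm{Sur}(\underline{n},\underline{m})$ given by $(t;t_1,\dots,t_k)(a)=m_1+\cdots+m_{j-1}+t_j(b)$ whenever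 $t(a)=j$ and $a$ is the $b$-th element of $t^{-1}(j)$. For any arity-graded module $M$ and any $t\in\mathrm{Sur}(\underline{n},\underline{k})$ put $M_t=\bigotimes_{v\in\underline{k}}M_{|v|}$. The functor $\mathbb{P}$ from arity-graded modules to arity-graded modules is defined by $\mathbb{P}(M)_{n+1}=\bigoplus_{t\in\mathrm{Surj}_n}M_t$ for $n\ge1$, and $\mathbb{P}(M)_1=\mathbb{K}\,\mathrm{id}$. So $\mathbb{P}(M)_{n+1}$ is spanned by the surjective maps with $n$ inputs whose vertices are decorated by elements of $M$ (a vertex $v$ by an element of $M_{|v|}$). The natural map $\iota(M):M\to\mathbb{P}(M)$ associates to $\mu\in M_n$ the corolla $c_n$ of arity $n$ decorated by $\mu$. The map $\Gamma(M):\mathbb{P}(\mathbb{P}(M))\to\mathbb{P}(M)$ is given by substitution: a surjective map $t$ whose vertices $j=1,\dots,k$ are decorated by surjective maps $t_j$, themselves decorated by elements of $M$, is sent to the surjective map $(t;t_1,\dots,t_k)$ with the induced decoration by elements of $M$.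
   Formalization: As no corolla c_1 exists, ι(M) in arity 1 is read as μ ↦ ε(μ) id for a linear form ε on M_1 (on P(M)_1 = K id, the coefficient of id); naturality of ι in arity 1 is claimed only for morphisms preserving these forms, so the monad is on pairs (M, ε). *)

theory Defs
  imports "HOL-Algebra.AbelCoset" "HOL-Algebra.Module"
begin

section \<open>Modules: homomorphisms, quotients, free modules, tensor products, direct sums\<close>

definition linear_maps ::
    "('r, 'k) ring_scheme \<Rightarrow> ('r, 'a, 'x) module_scheme \<Rightarrow> ('r, 'b, 'y) module_scheme \<Rightarrow> ('a \<Rightarrow> 'b) set"
  where "linear_maps K A B =
    {h \<in> carrier A \<rightarrow> carrier B.
       (\<forall>x\<in>carrier A. \<forall>y\<in>carrier A. h (x \<oplus>\<^bsub>A\<^esub> y) = h x \<oplus>\<^bsub>B\<^esub> h y) \<and>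
       (\<forall>r\<in>carrier K. \<forall>x\<in>carrier A. h (r \<odot>\<^bsub>A\<^esub> x) = r \<odot>\<^bsub>B\<^esub> h x)}"

text \<open>
  The record type of modules extends that of rings; the fields \<open>mult\<close> and \<open>one\<close> play no
  role in the locale \<^locale>\<open>module\<close> and are left \<open>undefined\<close> throughout.
\<close>

definition free_module :: "('r, 'k) ring_scheme \<Rightarrow> 'x set \<Rightarrow> ('r, 'x \<Rightarrow> 'r) module"
  where "free_module K Y =
    \<lparr>carrier = {f. (\<forall>x. f x \<in> carrier K) \<and> finite {x. f x \<noteq> \<zero>\<^bsub>K\<^esub>} \<and> {x. f x \<noteq> \<zero>\<^bsub>K\<^esub>} \<subseteq> Y},
     mult = undefined, one = undefined,
     zero = (\<lambda>_. \<zero>\<^bsub>K\<^esub>),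
     add = (\<lambda>f g x. f x \<oplus>\<^bsub>K\<^esub> g x),
     smult = (\<lambda>r f x. r \<otimes>\<^bsub>K\<^esub> f x)\<rparr>"

definition free_gen :: "('r, 'k) ring_scheme \<Rightarrow> 'x \<Rightarrow> 'x \<Rightarrow> 'r"
  where "free_gen K x = (\<lambda>y. if y = x then \<one>\<^bsub>K\<^esub> else \<zero>\<^bsub>K\<^esub>)"

definition quot_module :: "('r, 'a, 'x) module_scheme \<Rightarrow> 'a set \<Rightarrow> ('r, 'a set) module"
  where "quot_module A S =
    \<lparr>carrier = a_rcosets\<^bsub>A\<^esub> S,
     mult = undefined, one = undefined,
     zero = S,
     add = set_add A,
     smult = (\<lambda>r C. \<Union>c\<in>C. S +>\<^bsub>A\<^esub> (r \<odot>\<^bsub>A\<^esub> c))\<rparr>"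

text \<open>
  The tensor product over \<open>K\<close> of a family of modules \<open>A i\<close>, \<open>i \<in> I\<close>: the free module on the
  product of the carriers modulo the relations of multilinearity. For \<open>I = {}\<close> it is the free
  module on the empty family of elements, hence isomorphic to \<open>K\<close>.
\<close>

definition tensor_rels ::
    "('r, 'k) ring_scheme \<Rightarrow> 'i set \<Rightarrow> ('i \<Rightarrow> ('r, 'a, 'x) module_scheme) \<Rightarrow> (('i \<Rightarrow> 'a) \<Rightarrow> 'r) set"
  where "tensor_rels K I A =
    (let Y = (\<Pi>\<^sub>E i\<in>I. carrier (A i)); F = free_module K Y in
      {free_gen K (x(i := a \<oplus>\<^bsub>A i\<^esub> b)) \<ominus>\<^bsub>F\<^esub> (free_gen K (x(i := a)) \<oplus>\<^bsub>F\<^esub> free_gen K (x(i := b)))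
        | x i a b. x \<in> Y \<and> i \<in> I \<and> a \<in> carrier (A i) \<and> b \<in> carrier (A i)} \<union>
      {free_gen K (x(i := r \<odot>\<^bsub>A i\<^esub> a)) \<ominus>\<^bsub>F\<^esub> (r \<odot>\<^bsub>F\<^esub> free_gen K (x(i := a)))
        | x i a r. x \<in> Y \<and> i \<in> I \<and> a \<in> carrier (A i) \<and> r \<in> carrier K})"

definition tensor_ker ::
    "('r, 'k) ring_scheme \<Rightarrow> 'i set \<Rightarrow> ('i \<Rightarrow> ('r, 'a, 'x) module_scheme) \<Rightarrow> (('i \<Rightarrow> 'a) \<Rightarrow> 'r) set"
  where "tensor_ker K I A =
    \<Inter>{S. submodule S K (free_module K (\<Pi>\<^sub>E i\<in>I. carrier (A i))) \<and> tensor_rels K I A \<subseteq> S}"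

definition tensor ::
    "('r, 'k) ring_scheme \<Rightarrow> 'i set \<Rightarrow> ('i \<Rightarrow> ('r, 'a, 'x) module_scheme) \<Rightarrow>
     ('r, (('i \<Rightarrow> 'a) \<Rightarrow> 'r) set) module"
  where "tensor K I A =
    quot_module (free_module K (\<Pi>\<^sub>E i\<in>I. carrier (A i))) (tensor_ker K I A)"

definition pure_tensor ::
    "('r, 'k) ring_scheme \<Rightarrow> 'i set \<Rightarrow> ('i \<Rightarrow> ('r, 'a, 'x) module_scheme) \<Rightarrow> ('i \<Rightarrow> 'a) \<Rightarrow>
     (('i \<Rightarrow> 'a) \<Rightarrow> 'r) set"
  where "pure_tensor K I A x =
    tensor_ker K I A +>\<^bsub>free_module K (\<Pi>\<^sub>E i\<in>I. carrier (A i))\<^esub> free_gen K x"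

text \<open>Only used for finite index sets \<open>I\<close>, where the direct sum is the product.\<close>

definition finite_direct_sum ::
    "'i set \<Rightarrow> ('i \<Rightarrow> ('r, 'a, 'x) module_scheme) \<Rightarrow> ('r, 'i \<Rightarrow> 'a) module"
  where "finite_direct_sum I A =
    \<lparr>carrier = (\<Pi>\<^sub>E i\<in>I. carrier (A i)),
     mult = undefined, one = undefined,
     zero = (\<lambda>i\<in>I. \<zero>\<^bsub>A i\<^esub>),
     add = (\<lambda>x y. \<lambda>i\<in>I. x i \<oplus>\<^bsub>A i\<^esub> y i),
     smult = (\<lambda>r x. \<lambda>i\<in>I. r \<odot>\<^bsub>A i\<^esub> x i)\<rparr>"


section \<open>Arity-graded modules\<close>

text \<open>A family of modules \<open>M n\<close> with \<open>n \<ge> 1\<close>; the value \<open>M 0\<close> is irrelevant.\<close>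

definition graded_module :: "('r, 'k) ring_scheme \<Rightarrow> (nat \<Rightarrow> ('r, 'm) module) \<Rightarrow> bool"
  where "graded_module K M \<longleftrightarrow> (\<forall>n\<ge>1. module K (M n))"

definition graded_hom ::
    "('r, 'k) ring_scheme \<Rightarrow> (nat \<Rightarrow> ('r, 'm) module) \<Rightarrow> (nat \<Rightarrow> ('r, 'n) module) \<Rightarrow>
     (nat \<Rightarrow> 'm \<Rightarrow> 'n) \<Rightarrow> bool"
  where "graded_hom K M N f \<longleftrightarrow> (\<forall>n\<ge>1. f n \<in> linear_maps K (M n) (N n))"

definition graded_eq ::
    "(nat \<Rightarrow> ('r, 'm) module) \<Rightarrow> (nat \<Rightarrow> 'm \<Rightarrow> 'n) \<Rightarrow> (nat \<Rightarrow> 'm \<Rightarrow> 'n) \<Rightarrow> bool"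
  where "graded_eq M f g \<longleftrightarrow> (\<forall>n\<ge>1. \<forall>x\<in>carrier (M n). f n x = g n x)"

definition graded_comp ::
    "(nat \<Rightarrow> 'm \<Rightarrow> 'n) \<Rightarrow> (nat \<Rightarrow> 'l \<Rightarrow> 'm) \<Rightarrow> nat \<Rightarrow> 'l \<Rightarrow> 'n"  (infixl \<open>\<circ>\<^sub>g\<close> 55)
  where "g \<circ>\<^sub>g f = (\<lambda>n. g n \<circ> f n)"

definition graded_id :: "nat \<Rightarrow> 'm \<Rightarrow> 'm"
  where "graded_id = (\<lambda>n x. x)"


section \<open>Surjective maps and substitution\<close>

text \<open>
  Maps between the sets \<open>{1..n}\<close> and \<open>{1..k}\<close> are extensional functions on \<^typ>\<open>nat\<close>. The
  number \<open>k\<close> is determined by a surjective map \<open>t\<close>, the set of vertices of \<open>t\<close> being its image,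
  so that the union over \<open>k\<close> is disjoint. \<open>Surj 0\<close> consists of the empty map only.
\<close>

definition Sur :: "nat \<Rightarrow> nat \<Rightarrow> (nat \<Rightarrow> nat) set"
  where "Sur n k = {t \<in> {1..n} \<rightarrow>\<^sub>E {1..k}. t ` {1..n} = {1..k}}"

definition Surj :: "nat \<Rightarrow> (nat \<Rightarrow> nat) set"
  where "Surj n = (\<Union>k. Sur n k)"

definition verts :: "nat \<Rightarrow> (nat \<Rightarrow> nat) \<Rightarrow> nat set"
  where "verts n t = t ` {1..n}"

definition inputs :: "nat \<Rightarrow> (nat \<Rightarrow> nat) \<Rightarrow> nat \<Rightarrow> nat"
  where "inputs n t v = card {a \<in> {1..n}. t a = v}"

definition arity :: "nat \<Rightarrow> (nat \<Rightarrow> nat) \<Rightarrow> nat \<Rightarrow> nat"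
  where "arity n t v = inputs n t v + 1"

text \<open>\<open>corolla n\<close> is the element \<open>c\<^sub>n\<^sub>+\<^sub>1\<close> of \<open>Sur n 1\<close>.\<close>

definition corolla :: "nat \<Rightarrow> nat \<Rightarrow> nat"
  where "corolla n = (\<lambda>a\<in>{1..n}. 1)"

text \<open>The number \<open>m\<^sub>j\<close> of vertices of \<open>s j\<close>, for \<open>s j \<in> Surj (inputs n t j)\<close>.\<close>

definition nverts :: "nat \<Rightarrow> (nat \<Rightarrow> nat) \<Rightarrow> (nat \<Rightarrow> nat \<Rightarrow> nat) \<Rightarrow> nat \<Rightarrow> nat"
  where "nverts n t s j = card (verts (inputs n t j) (s j))"

text \<open>In the next definition \<open>a\<close> is the \<open>b\<close>-th element of \<open>{c. t c = t a}\<close> for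
  \<open>b = card {c \<in> {1..a}. t c = t a}\<close>.\<close>

definition subst :: "nat \<Rightarrow> (nat \<Rightarrow> nat) \<Rightarrow> (nat \<Rightarrow> nat \<Rightarrow> nat) \<Rightarrow> nat \<Rightarrow> nat"
  where "subst n t s =
    (\<lambda>a\<in>{1..n}. (\<Sum>j\<in>{1..<t a}. nverts n t s j) + s (t a) (card {c \<in> {1..a}. t c = t a}))"

text \<open>
  The vertex \<open>i\<close> of \<open>s j\<close> becomes the vertex \<open>m\<^sub>1 + \<dots> + m\<^sub>j\<^sub>-\<^sub>1 + i\<close> of \<open>subst n t s\<close>. Conversely,
  given a vertex \<open>p\<close> of the latter, \<open>j\<close> is the least number with \<open>p \<le> m\<^sub>1 + \<dots> + m\<^sub>j\<close>.
\<close>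

definition subst_deco ::
    "nat \<Rightarrow> (nat \<Rightarrow> nat) \<Rightarrow> (nat \<Rightarrow> nat \<Rightarrow> nat) \<Rightarrow> (nat \<Rightarrow> nat \<Rightarrow> 'm) \<Rightarrow> nat \<Rightarrow> 'm"
  where "subst_deco n t s x =
    (\<lambda>p\<in>verts n (subst n t s).
       let j = (LEAST j. p \<le> (\<Sum>i\<in>{1..j}. nverts n t s i))
       in x j (p - (\<Sum>i\<in>{1..<j}. nverts n t s i)))"


section \<open>The functor \<open>\<bbbP>\<close> and the transformations \<open>\<Gamma>\<close> and \<open>\<iota>\<close>\<close>

definition deco_module ::
    "('r, 'k) ring_scheme \<Rightarrow> (nat \<Rightarrow> ('r, 'm) module) \<Rightarrow> nat \<Rightarrow> (nat \<Rightarrow> nat) \<Rightarrow>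
     ('r, ((nat \<Rightarrow> 'm) \<Rightarrow> 'r) set) module"
  where "deco_module K M n t = tensor K (verts n t) (\<lambda>v. M (arity n t v))"

text \<open>
  \<open>Pobj K M (n + 1)\<close> is the direct sum over \<open>Surj n\<close>, also for \<open>n = 0\<close>: there the only summand
  is the empty tensor product, which is the free module of rank one on \<open>unit_id K M\<close> below.
\<close>

type_synonym ('r, 'm) perm = "(nat \<Rightarrow> nat) \<Rightarrow> ((nat \<Rightarrow> 'm) \<Rightarrow> 'r) set"

definition Pobj ::
    "('r, 'k) ring_scheme \<Rightarrow> (nat \<Rightarrow> ('r, 'm) module) \<Rightarrow> nat \<Rightarrow> ('r, ('r, 'm) perm) module"
  where "Pobj K M a = finite_direct_sum (Surj (a - 1)) (deco_module K M (a - 1))"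

definition decorations ::
    "(nat \<Rightarrow> ('r, 'm) module) \<Rightarrow> nat \<Rightarrow> (nat \<Rightarrow> nat) \<Rightarrow> (nat \<Rightarrow> 'm) set"
  where "decorations M n t = (\<Pi>\<^sub>E v\<in>verts n t. carrier (M (arity n t v)))"

text \<open>The surjective map \<open>t\<close> whose vertices \<open>v\<close> are decorated by \<open>x v\<close>, as an element of
  \<open>Pobj K M (n + 1)\<close>.\<close>

definition deco ::
    "('r, 'k) ring_scheme \<Rightarrow> (nat \<Rightarrow> ('r, 'm) module) \<Rightarrow> nat \<Rightarrow> (nat \<Rightarrow> nat) \<Rightarrow> (nat \<Rightarrow> 'm) \<Rightarrow>
     ('r, 'm) perm"
  where "deco K M n t x =
    (\<lambda>u\<in>Surj n. if u = t then pure_tensor K (verts n t) (\<lambda>v. M (arity n t v)) x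
                else \<zero>\<^bsub>deco_module K M n u\<^esub>)"

definition unit_id :: "('r, 'k) ring_scheme \<Rightarrow> (nat \<Rightarrow> ('r, 'm) module) \<Rightarrow> ('r, 'm) perm"
  where "unit_id K M = deco K M 0 (\<lambda>_. undefined) (\<lambda>_. undefined)"

text \<open>
  The maps \<open>\<bbbP>(f)\<close> and \<open>\<Gamma>(M)\<close> are given on decorated surjective maps. Existence and uniqueness of
  the linear maps with these values are part of the theorem.
\<close>

definition is_Pmap ::
    "('r, 'k) ring_scheme \<Rightarrow> (nat \<Rightarrow> ('r, 'm) module) \<Rightarrow> (nat \<Rightarrow> ('r, 'n) module) \<Rightarrow>
     (nat \<Rightarrow> 'm \<Rightarrow> 'n) \<Rightarrow> nat \<Rightarrow> (('r, 'm) perm \<Rightarrow> ('r, 'n) perm) \<Rightarrow> bool"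
  where "is_Pmap K M N f n h \<longleftrightarrow>
    h \<in> linear_maps K (Pobj K M (n + 1)) (Pobj K N (n + 1)) \<and>
    h \<in> extensional (carrier (Pobj K M (n + 1))) \<and>
    (\<forall>t\<in>Surj n. \<forall>x\<in>decorations M n t.
       h (deco K M n t x) = deco K N n t (\<lambda>v\<in>verts n t. f (arity n t v) (x v)))"

definition Pmap ::
    "('r, 'k) ring_scheme \<Rightarrow> (nat \<Rightarrow> ('r, 'm) module) \<Rightarrow> (nat \<Rightarrow> ('r, 'n) module) \<Rightarrow>
     (nat \<Rightarrow> 'm \<Rightarrow> 'n) \<Rightarrow> nat \<Rightarrow> ('r, 'm) perm \<Rightarrow> ('r, 'n) perm"
  where "Pmap K M N f a = (THE h. is_Pmap K M N f (a - 1) h)"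

definition is_Gamma ::
    "('r, 'k) ring_scheme \<Rightarrow> (nat \<Rightarrow> ('r, 'm) module) \<Rightarrow> nat \<Rightarrow>
     (('r, ('r, 'm) perm) perm \<Rightarrow> ('r, 'm) perm) \<Rightarrow> bool"
  where "is_Gamma K M n h \<longleftrightarrow>
    h \<in> linear_maps K (Pobj K (Pobj K M) (n + 1)) (Pobj K M (n + 1)) \<and>
    h \<in> extensional (carrier (Pobj K (Pobj K M) (n + 1))) \<and>
    (\<forall>t\<in>Surj n. \<forall>s\<in>(\<Pi>\<^sub>E j\<in>verts n t. Surj (inputs n t j)).
     \<forall>x\<in>(\<Pi>\<^sub>E j\<in>verts n t. decorations M (inputs n t j) (s j)).
       h (deco K (Pobj K M) n t (\<lambda>j\<in>verts n t. deco K M (inputs n t j) (s j) (x j)))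
       = deco K M n (subst n t s) (subst_deco n t s x))"

definition Gamma ::
    "('r, 'k) ring_scheme \<Rightarrow> (nat \<Rightarrow> ('r, 'm) module) \<Rightarrow> nat \<Rightarrow>
     ('r, ('r, 'm) perm) perm \<Rightarrow> ('r, 'm) perm"
  where "Gamma K M a = (THE h. is_Gamma K M (a - 1) h)"

text \<open>
  There is no corolla of arity 1, so the component of \<open>\<iota>(M)\<close> in arity 1 has to be read as a linear
  map from \<open>M 1\<close> to \<open>K id\<close>, that is, as \<open>\<mu> \<mapsto> \<epsilon>(\<mu>) id\<close> for a linear form \<open>\<epsilon>\<close> on \<open>M 1\<close>. No choice
  of \<open>\<epsilon>\<close> is natural with respect to all morphisms except \<open>\<epsilon> = 0\<close>, whereas unitality of \<open>\<Gamma>\<close> in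
  arity 1 forces \<open>\<epsilon>(id) = 1\<close> on \<open>\<bbbP>(M)\<^sub>1 = K id\<close>. So \<open>\<epsilon>\<close> is an arbitrary parameter for \<open>M\<close>, the
  identification \<open>id_coeff\<close> of \<open>K id\<close> with \<open>K\<close> is used for \<open>\<bbbP>(M)\<close>, and in arity 1 the
  transformation \<open>\<iota>\<close> is natural for the morphisms compatible with the linear forms. Nothing
  else depends on \<open>\<epsilon>\<close>.
\<close>

definition linear_form :: "('r, 'k) ring_scheme \<Rightarrow> ('r, 'm) module \<Rightarrow> ('m \<Rightarrow> 'r) \<Rightarrow> bool"
  where "linear_form K A \<epsilon> \<longleftrightarrow>
    \<epsilon> \<in> carrier A \<rightarrow> carrier K \<and>
    (\<forall>x\<in>carrier A. \<forall>y\<in>carrier A. \<epsilon> (x \<oplus>\<^bsub>A\<^esub> y) = \<epsilon> x \<oplus>\<^bsub>K\<^esub> \<epsilon> y) \<and>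
    (\<forall>r\<in>carrier K. \<forall>x\<in>carrier A. \<epsilon> (r \<odot>\<^bsub>A\<^esub> x) = r \<otimes>\<^bsub>K\<^esub> \<epsilon> x)"

definition id_coeff :: "('r, 'k) ring_scheme \<Rightarrow> (nat \<Rightarrow> ('r, 'm) module) \<Rightarrow> ('r, 'm) perm \<Rightarrow> 'r"
  where "id_coeff K M = the_inv_into (carrier K) (\<lambda>r. r \<odot>\<^bsub>Pobj K M 1\<^esub> unit_id K M)"

definition preserves_form ::
    "(nat \<Rightarrow> ('r, 'm) module) \<Rightarrow> ('m \<Rightarrow> 'r) \<Rightarrow> ('n \<Rightarrow> 'r) \<Rightarrow> (nat \<Rightarrow> 'm \<Rightarrow> 'n) \<Rightarrow> bool"
  where "preserves_form M \<epsilon> \<eta> f \<longleftrightarrow> (\<forall>x\<in>carrier (M 1). \<eta> (f 1 x) = \<epsilon> x)"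

definition Iota ::
    "('r, 'k) ring_scheme \<Rightarrow> (nat \<Rightarrow> ('r, 'm) module) \<Rightarrow> ('m \<Rightarrow> 'r) \<Rightarrow> nat \<Rightarrow> 'm \<Rightarrow> ('r, 'm) perm"
  where "Iota K M \<epsilon> a \<mu> =
    (if a = 1 then \<epsilon> \<mu> \<odot>\<^bsub>Pobj K M 1\<^esub> unit_id K M
     else deco K M (a - 1) (corolla (a - 1)) (\<lambda>v\<in>{1}. \<mu>))"

end

theory Submission
  imports Defs
begin

text \<open>
  Linear maps out of \<open>Pobj K M (n + 1)\<close> are families, indexed by \<open>t \<in> Surj n\<close>, of maps that are
  multilinear in the decorations of the vertices of \<open>t\<close>. To define \<open>\<Gamma>\<close> one therefore needs a map
  that is multilinear in elements of \<open>Pobj K M\<close> placed at the vertices of \<open>t\<close>, while substitution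
  prescribes it only on families of decorated surjective maps. Such a prescription extends as soon
  as, with all other vertices fixed, it extends linearly in each single vertex
  (\<open>multilinear_extension\<close>). Every identity between linear maps is then checked on decorated
  surjective maps, nested as deeply as \<open>\<bbbP>\<close> is iterated, where associativity becomes the identity
  \<open>(t; (s\<^sub>j; r\<^sub>j\<^sub>i)\<^sub>j) = ((t; s\<^sub>j); r\<^sub>j\<^sub>i)\<close>. The latter holds because the rank of \<open>a\<close> in its fibre under
  \<open>(t; s\<^sub>j)\<close> is the rank, in its fibre under \<open>s\<^sub>j\<close>, of the rank of \<open>a\<close> in \<open>t\<^sup>-\<^sup>1(j)\<close>.
\<close>

section \<open>Linear maps and spanning sets\<close>

text \<open>Decorated surjective maps generate \<bbbP>(M) but are far from a basis: different
  decorations may give the same tensor, and tensor products of arbitrary modules carry relations. No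
  formula on generators is automatically well defined. Existence of a linear map has to come from a
  universal property and uniqueness from a spanning set, so the algebraic part provides these two
  for free modules, quotients, tensor products and direct sums. The second obstacle is arity 1. A
  vertex has at least one input, hence arity at least 2 (\<open>inputs_pos\<close>), so the
  component of arity 1 never decorates anything. This makes the right unit law hold for every linear
  form \<epsilon>, whereas the left unit law in arity 1 needs the coordinate \<open>id_coeff\<close>
  on \<open>\<bbbP>(M)\<^sub>1\<close>. On the combinatorial side the vertices of a substitution are
  plain numbers, and the bookkeeping reduces to consecutive blocks: \<open>offset m j\<close> is the
  last number before block \<open>j\<close>.\<close>

lemma linear_mapsI:
  assumes "\<And>x. x \<in> carrier A \<Longrightarrow> h x \<in> carrier B"
    and "\<And>x y. x \<in> carrier A \<Longrightarrow> y \<in> carrier A \<Longrightarrow> h (x \<oplus>\<^bsub>A\<^esub> y) = h x \<oplus>\<^bsub>B\<^esub> h y"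
    and "\<And>r x. r \<in> carrier K \<Longrightarrow> x \<in> carrier A \<Longrightarrow> h (r \<odot>\<^bsub>A\<^esub> x) = r \<odot>\<^bsub>B\<^esub> h x"
  shows "h \<in> linear_maps K A B"
  using assms by (auto simp: linear_maps_def)

lemma linear_mapsD:
  assumes "h \<in> linear_maps K A B"
  shows "\<And>x. x \<in> carrier A \<Longrightarrow> h x \<in> carrier B"
    and "\<And>x y. x \<in> carrier A \<Longrightarrow> y \<in> carrier A \<Longrightarrow> h (x \<oplus>\<^bsub>A\<^esub> y) = h x \<oplus>\<^bsub>B\<^esub> h y"
    and "\<And>r x. r \<in> carrier K \<Longrightarrow> x \<in> carrier A \<Longrightarrow> h (r \<odot>\<^bsub>A\<^esub> x) = r \<odot>\<^bsub>B\<^esub> h x"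
  using assms by (auto simp: linear_maps_def)

lemma linear_maps_zero:
  assumes "module K A" "module K B" "h \<in> linear_maps K A B"
  shows "h \<zero>\<^bsub>A\<^esub> = \<zero>\<^bsub>B\<^esub>"
proof -
  interpret A: module K A by fact
  interpret B: module K B by fact
  have "h (\<zero>\<^bsub>K\<^esub> \<odot>\<^bsub>A\<^esub> \<zero>\<^bsub>A\<^esub>) = \<zero>\<^bsub>K\<^esub> \<odot>\<^bsub>B\<^esub> h \<zero>\<^bsub>A\<^esub>"
    using linear_mapsD(3)[OF assms(3)] by blast
  then show ?thesis
    using linear_mapsD(1)[OF assms(3)] by simp
qed

lemma linear_maps_id: "(\<lambda>x. x) \<in> linear_maps K A A"
  by (simp add: linear_maps_def)

lemma linear_maps_comp:
  assumes "h \<in> linear_maps K A B" "k \<in> linear_maps K B C"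
  shows "(\<lambda>x. k (h x)) \<in> linear_maps K A C"
  using assms by (auto simp: linear_maps_def Pi_def)

lemma linear_maps_cong:
  assumes "module K A" "h \<in> linear_maps K A B" "\<And>x. x \<in> carrier A \<Longrightarrow> k x = h x"
  shows "k \<in> linear_maps K A B"
proof -
  interpret A: module K A by fact
  show ?thesis
    using assms(2,3) by (auto simp: linear_maps_def Pi_def)
qed

lemma linear_maps_add:
  assumes "module K B" "h \<in> linear_maps K A B" "k \<in> linear_maps K A B"
  shows "(\<lambda>x. h x \<oplus>\<^bsub>B\<^esub> k x) \<in> linear_maps K A B"
proof -
  interpret B: module K B by fact
  show ?thesis
    using linear_mapsD[OF assms(2)] linear_mapsD[OF assms(3)]
    by (intro linear_mapsI) (auto simp: B.smult_r_distr B.M.a_ac)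
qed

lemma linear_maps_smult:
  assumes "module K B" "h \<in> linear_maps K A B" "r \<in> carrier K"
  shows "(\<lambda>x. r \<odot>\<^bsub>B\<^esub> h x) \<in> linear_maps K A B"
proof -
  interpret B: module K B by fact
  show ?thesis
    using linear_mapsD[OF assms(2)] assms(3)
    by (intro linear_mapsI) (auto simp: B.smult_r_distr B.smult_assoc1[symmetric] B.R.m_comm)
qed

lemma linear_maps_const_zero:
  assumes "module K B"
  shows "(\<lambda>x. \<zero>\<^bsub>B\<^esub>) \<in> linear_maps K A B"
proof -
  interpret B: module K B by fact
  show ?thesis by (intro linear_mapsI) auto
qed

text \<open>Closure under negation comes from closure under scalars: \<open>\<ominus> a\<close> is
  the multiple of \<open>a\<close> by \<open>\<ominus> \<one>\<close>.\<close>

lemma submoduleI':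
  assumes "module K A" "S \<subseteq> carrier A" "\<zero>\<^bsub>A\<^esub> \<in> S"
    and "\<And>a b. a \<in> S \<Longrightarrow> b \<in> S \<Longrightarrow> a \<oplus>\<^bsub>A\<^esub> b \<in> S"
    and "\<And>r a. r \<in> carrier K \<Longrightarrow> a \<in> S \<Longrightarrow> r \<odot>\<^bsub>A\<^esub> a \<in> S"
  shows "submodule S K A"
proof -
  interpret A: module K A by fact
  show ?thesis
  proof (rule A.submoduleI)
    fix a assume a: "a \<in> S"
    then have "\<ominus>\<^bsub>A\<^esub> a = (\<ominus>\<^bsub>K\<^esub> \<one>\<^bsub>K\<^esub>) \<odot>\<^bsub>A\<^esub> a"
      using assms(2) by (subst A.smult_l_minus) auto
    then show "\<ominus>\<^bsub>A\<^esub> a \<in> S" using a assms(5) by simp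
  qed (use assms in auto)
qed

lemma submoduleD:
  assumes "module K A" "submodule S K A"
  shows "S \<subseteq> carrier A" "\<zero>\<^bsub>A\<^esub> \<in> S"
    and "\<And>a b. a \<in> S \<Longrightarrow> b \<in> S \<Longrightarrow> a \<oplus>\<^bsub>A\<^esub> b \<in> S"
    and "\<And>r a. r \<in> carrier K \<Longrightarrow> a \<in> S \<Longrightarrow> r \<odot>\<^bsub>A\<^esub> a \<in> S"
    and "\<And>a b. a \<in> S \<Longrightarrow> b \<in> S \<Longrightarrow> a \<ominus>\<^bsub>A\<^esub> b \<in> S"
proof -
  interpret A: module K A by fact
  show "S \<subseteq> carrier A"
    and "\<And>a b. a \<in> S \<Longrightarrow> b \<in> S \<Longrightarrow> a \<oplus>\<^bsub>A\<^esub> b \<in> S"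
    and "\<And>r a. r \<in> carrier K \<Longrightarrow> a \<in> S \<Longrightarrow> r \<odot>\<^bsub>A\<^esub> a \<in> S"
    and "\<And>a b. a \<in> S \<Longrightarrow> b \<in> S \<Longrightarrow> a \<ominus>\<^bsub>A\<^esub> b \<in> S"
    using A.submoduleE[OF assms(2)] by (auto simp: a_minus_def)
  show "\<zero>\<^bsub>A\<^esub> \<in> S"
    using subgroup.one_closed[OF submodule.axioms(1)[OF assms(2)]] by simp
qed

text \<open>Together with \<open>submodule_vimage\<close> this supplies the submodules on which
  inductions over spanning sets run: agreement of two linear maps, or landing in a given
  submodule.\<close>

lemma submodule_equalizer:
  assumes "module K A" "module K B" "h \<in> linear_maps K A B" "k \<in> linear_maps K A B"
  shows "submodule {x \<in> carrier A. h x = k x} K A"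
proof -
  interpret A: module K A by fact
  show ?thesis
    using linear_mapsD[OF assms(3)] linear_mapsD[OF assms(4)]
    by (intro submoduleI' assms) (auto simp: linear_maps_zero[OF assms(1,2)] assms(3,4))
qed

lemma submodule_vimage:
  assumes "module K A" "module K B" "h \<in> linear_maps K A B" "submodule S K B"
  shows "submodule {x \<in> carrier A. h x \<in> S} K A"
proof -
  interpret A: module K A by fact
  show ?thesis
    using linear_mapsD[OF assms(3)] submoduleD[OF assms(2,4)]
    by (intro submoduleI' assms) (auto simp: linear_maps_zero[OF assms(1,2,3)])
qed

text \<open>Spanning is expressed by the absence of a proper submodule containing \<open>G\<close>,
  not by linear combinations. It is thus an induction principle (\<open>spans_induct\<close>), and
  no finite sums have to be manipulated.\<close>

definition spans :: "('r, 'k) ring_scheme \<Rightarrow> ('r, 'a) module \<Rightarrow> 'a set \<Rightarrow> bool"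
  where "spans K A G \<longleftrightarrow>
    G \<subseteq> carrier A \<and> (\<forall>S. submodule S K A \<longrightarrow> G \<subseteq> S \<longrightarrow> carrier A \<subseteq> S)"

lemma spans_carrier: "spans K A (carrier A)"
  by (auto simp: spans_def)

lemma spansD: "spans K A G \<Longrightarrow> x \<in> G \<Longrightarrow> x \<in> carrier A"
  by (auto simp: spans_def)

lemma spans_induct:
  assumes "spans K A G" "submodule {x \<in> carrier A. P x} K A"
    and "\<And>x. x \<in> G \<Longrightarrow> P x" "x \<in> carrier A"
  shows "P x"
  using assms unfolding spans_def by blast

lemma spans_eqI:
  assumes "module K A" "module K B" "spans K A G"
    and "h \<in> linear_maps K A B" "k \<in> linear_maps K A B"
    and "\<And>x. x \<in> G \<Longrightarrow> h x = k x" "x \<in> carrier A"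
  shows "h x = k x"
  using assms(3) submodule_equalizer[OF assms(1,2,4,5)] assms(6,7) by (rule spans_induct)

text \<open>The preimage of a submodule containing the image of \<open>G\<close> is a submodule
  containing \<open>G\<close>, hence everything.\<close>

lemma spans_linear_image:
  assumes "module K A" "module K B" "h \<in> linear_maps K A B" "h ` carrier A = carrier B"
    and "spans K A G"
  shows "spans K B (h ` G)"
  unfolding spans_def
proof (intro conjI allI impI)
  show "h ` G \<subseteq> carrier B" using assms(4,5) by (auto simp: spans_def)
  fix S assume S: "submodule S K B" "h ` G \<subseteq> S"
  have "h x \<in> S" if "x \<in> carrier A" for x
    using assms(5) submodule_vimage[OF assms(1-3) S(1)] _ that
    by (rule spans_induct) (use S(2) in auto)
  then show "carrier B \<subseteq> S" unfolding assms(4)[symmetric] by blast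
qed

text \<open>The axioms are equations between images, apart from inverses, whose witness is the image
  of an inverse. As \<open>B\<close> may be any record with compatible operations, the axioms need
  not be checked on cosets.\<close>

lemma module_surj_image:
  assumes "module K A" "h ` carrier A = carrier B"
    and add: "\<And>x y. x \<in> carrier A \<Longrightarrow> y \<in> carrier A \<Longrightarrow> h (x \<oplus>\<^bsub>A\<^esub> y) = h x \<oplus>\<^bsub>B\<^esub> h y"
    and smult: "\<And>r x. r \<in> carrier K \<Longrightarrow> x \<in> carrier A \<Longrightarrow> h (r \<odot>\<^bsub>A\<^esub> x) = r \<odot>\<^bsub>B\<^esub> h x"
    and zero: "h \<zero>\<^bsub>A\<^esub> = \<zero>\<^bsub>B\<^esub>"
  shows "module K B"
proof -
  interpret A: module K A by fact
  have B: "(x \<in> carrier B) = (\<exists>a\<in>carrier A. x = h a)" for x using assms(2) by auto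
  show ?thesis
  proof (rule moduleI)
    show "abelian_group B"
    proof (rule abelian_groupI)
      fix x assume "x \<in> carrier B"
      then obtain a where a: "a \<in> carrier A" "x = h a" using B by blast
      then have "h (\<ominus>\<^bsub>A\<^esub> a) \<oplus>\<^bsub>B\<^esub> x = \<zero>\<^bsub>B\<^esub>"
        using add[of "\<ominus>\<^bsub>A\<^esub> a" a] by (simp add: zero A.M.l_neg)
      with a show "\<exists>y\<in>carrier B. y \<oplus>\<^bsub>B\<^esub> x = \<zero>\<^bsub>B\<^esub>" using B A.M.a_inv_closed by blast
    next
      show "\<zero>\<^bsub>B\<^esub> \<in> carrier B" using B zero A.M.zero_closed by metis
    next
      fix x assume "x \<in> carrier B"
      then show "\<zero>\<^bsub>B\<^esub> \<oplus>\<^bsub>B\<^esub> x = x" using B zero add[of "\<zero>\<^bsub>A\<^esub>"] by auto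
    next
      fix x y assume "x \<in> carrier B" "y \<in> carrier B"
      then show "x \<oplus>\<^bsub>B\<^esub> y \<in> carrier B" "x \<oplus>\<^bsub>B\<^esub> y = y \<oplus>\<^bsub>B\<^esub> x"
        by (auto simp: B add[symmetric] A.M.a_comm)
    next
      fix x y z assume "x \<in> carrier B" "y \<in> carrier B" "z \<in> carrier B"
      then show "x \<oplus>\<^bsub>B\<^esub> y \<oplus>\<^bsub>B\<^esub> z = x \<oplus>\<^bsub>B\<^esub> (y \<oplus>\<^bsub>B\<^esub> z)"
        by (auto simp: B add[symmetric] A.M.a_assoc)
    qed
  qed (auto simp: B add[symmetric] smult[symmetric] A.smult_l_distr A.smult_r_distr
        A.smult_assoc1 A.R.is_cring)
qed

section \<open>Free modules and quotient modules\<close>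

lemma free_module_simps:
  "carrier (free_module K Y) =
    {f. (\<forall>x. f x \<in> carrier K) \<and> finite {x. f x \<noteq> \<zero>\<^bsub>K\<^esub>} \<and> {x. f x \<noteq> \<zero>\<^bsub>K\<^esub>} \<subseteq> Y}"
  "\<zero>\<^bsub>free_module K Y\<^esub> = (\<lambda>_. \<zero>\<^bsub>K\<^esub>)"
  "f \<oplus>\<^bsub>free_module K Y\<^esub> g = (\<lambda>x. f x \<oplus>\<^bsub>K\<^esub> g x)"
  "r \<odot>\<^bsub>free_module K Y\<^esub> f = (\<lambda>x. r \<otimes>\<^bsub>K\<^esub> f x)"
  by (simp_all add: free_module_def)

lemma module_free_module:
  fixes K :: "('r, 'k) ring_scheme" and Y :: "'x set"
  assumes "cring K"
  shows "module K (free_module K Y)"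
proof -
  interpret K: cring K by fact
  \<comment> \<open>Finiteness of supports is the only part of the axioms that is not pointwise: a
    sum is supported in the union, a multiple in the support itself.\<close>
  have fin: "finite {x. f x \<oplus>\<^bsub>K\<^esub> g x \<noteq> \<zero>\<^bsub>K\<^esub>}" "{x. f x \<oplus>\<^bsub>K\<^esub> g x \<noteq> \<zero>\<^bsub>K\<^esub>} \<subseteq> Y"
    if "finite {x. f x \<noteq> \<zero>\<^bsub>K\<^esub>}" "finite {x. g x \<noteq> \<zero>\<^bsub>K\<^esub>}"
      "{x. f x \<noteq> \<zero>\<^bsub>K\<^esub>} \<subseteq> Y" "{x. g x \<noteq> \<zero>\<^bsub>K\<^esub>} \<subseteq> Y" for f g :: "'x \<Rightarrow> 'r"
  proof -
    have "{x. f x \<oplus>\<^bsub>K\<^esub> g x \<noteq> \<zero>\<^bsub>K\<^esub>} \<subseteq> {x. f x \<noteq> \<zero>\<^bsub>K\<^esub>} \<union> {x. g x \<noteq> \<zero>\<^bsub>K\<^esub>}" by auto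
    then show "finite {x. f x \<oplus>\<^bsub>K\<^esub> g x \<noteq> \<zero>\<^bsub>K\<^esub>}" "{x. f x \<oplus>\<^bsub>K\<^esub> g x \<noteq> \<zero>\<^bsub>K\<^esub>} \<subseteq> Y"
      using that by (auto intro: finite_subset)
  qed
  have fins: "finite {x. r \<otimes>\<^bsub>K\<^esub> f x \<noteq> \<zero>\<^bsub>K\<^esub>}" "{x. r \<otimes>\<^bsub>K\<^esub> f x \<noteq> \<zero>\<^bsub>K\<^esub>} \<subseteq> Y"
    if "finite {x. f x \<noteq> \<zero>\<^bsub>K\<^esub>}" "{x. f x \<noteq> \<zero>\<^bsub>K\<^esub>} \<subseteq> Y" "r \<in> carrier K" for f :: "'x \<Rightarrow> 'r" and r
  proof -
    have "{x. r \<otimes>\<^bsub>K\<^esub> f x \<noteq> \<zero>\<^bsub>K\<^esub>} \<subseteq> {x. f x \<noteq> \<zero>\<^bsub>K\<^esub>}" using that by auto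
    then show "finite {x. r \<otimes>\<^bsub>K\<^esub> f x \<noteq> \<zero>\<^bsub>K\<^esub>}" "{x. r \<otimes>\<^bsub>K\<^esub> f x \<noteq> \<zero>\<^bsub>K\<^esub>} \<subseteq> Y"
      using that by (auto intro: finite_subset)
  qed
  show ?thesis
  proof (rule moduleI)
    show "abelian_group (free_module K Y)"
    proof (rule abelian_groupI)
      fix f assume f: "f \<in> carrier (free_module K Y)"
      then have "(\<lambda>x. \<ominus>\<^bsub>K\<^esub> \<one>\<^bsub>K\<^esub> \<otimes>\<^bsub>K\<^esub> f x) \<in> carrier (free_module K Y)"
        using fins by (auto simp: free_module_simps simp del: K.l_minus)
      moreover have "(\<lambda>x. \<ominus>\<^bsub>K\<^esub> \<one>\<^bsub>K\<^esub> \<otimes>\<^bsub>K\<^esub> f x) \<oplus>\<^bsub>free_module K Y\<^esub> f = \<zero>\<^bsub>free_module K Y\<^esub>"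
        using f by (auto simp: free_module_simps K.l_minus K.l_neg)
      ultimately show "\<exists>g\<in>carrier (free_module K Y).
          g \<oplus>\<^bsub>free_module K Y\<^esub> f = \<zero>\<^bsub>free_module K Y\<^esub>" by blast
    qed (use fin in \<open>auto simp: free_module_simps K.a_ac\<close>)
  qed (use fins in \<open>auto simp: free_module_simps K.is_cring K.l_distr K.r_distr K.m_assoc\<close>)
qed

lemma free_gen_closed:
  assumes "cring K" "y \<in> Y"
  shows "free_gen K y \<in> carrier (free_module K Y)"
proof -
  interpret K: cring K by fact
  have "{x. free_gen K y x \<noteq> \<zero>\<^bsub>K\<^esub>} \<subseteq> {y}" by (auto simp: free_gen_def)
  then show ?thesis
    using assms(2) by (auto simp: free_module_simps intro: finite_subset) (auto simp: free_gen_def)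
qed

lemma free_module_lift:
  assumes "module K B" "\<And>y. y \<in> Y \<Longrightarrow> f y \<in> carrier B"
  shows "\<exists>h\<in>linear_maps K (free_module K Y) B. \<forall>y\<in>Y. h (free_gen K y) = f y"
proof -
  interpret B: module K B by fact
  let ?F = "free_module K Y"
  define h where "h = (\<lambda>w. finsum B (\<lambda>y. w y \<odot>\<^bsub>B\<^esub> f y) {y. w y \<noteq> \<zero>\<^bsub>K\<^esub>})"
  \<comment> \<open>The support changes under addition, so the sum is freed from it: any finite
    subset of \<open>Y\<close> containing the support gives the same value, and two elements can be
    compared over the union of their supports.\<close>
  have h: "h w = finsum B (\<lambda>y. w y \<odot>\<^bsub>B\<^esub> f y) Z"
    if "w \<in> carrier ?F" "finite Z" "Z \<subseteq> Y" "{y. w y \<noteq> \<zero>\<^bsub>K\<^esub>} \<subseteq> Z" for w Z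
    unfolding h_def using that assms(2)
    by (intro B.M.add.finprod_mono_neutral_cong_left) (auto simp: free_module_simps)
  have lin: "h \<in> linear_maps K ?F B"
  proof (rule linear_mapsI)
    fix w assume "w \<in> carrier ?F"
    then show "h w \<in> carrier B"
      unfolding h_def using assms(2) by (intro B.M.finsum_closed) (auto simp: free_module_simps)
  next
    fix w v assume w: "w \<in> carrier ?F" and v: "v \<in> carrier ?F"
    let ?Z = "{y. w y \<noteq> \<zero>\<^bsub>K\<^esub>} \<union> {y. v y \<noteq> \<zero>\<^bsub>K\<^esub>}"
    have wv: "w \<oplus>\<^bsub>?F\<^esub> v \<in> carrier ?F"
      using module_free_module[OF B.R.is_cring, of Y] w v
      by (meson abelian_groupE(1) module_def)
    have Z: "finite ?Z" "?Z \<subseteq> Y" using w v by (auto simp: free_module_simps)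
    have "h (w \<oplus>\<^bsub>?F\<^esub> v) = finsum B (\<lambda>y. (w y \<oplus>\<^bsub>K\<^esub> v y) \<odot>\<^bsub>B\<^esub> f y) ?Z"
      by (subst h[OF wv Z]) (auto simp: free_module_simps)
    also have "\<dots> = finsum B (\<lambda>y. w y \<odot>\<^bsub>B\<^esub> f y \<oplus>\<^bsub>B\<^esub> v y \<odot>\<^bsub>B\<^esub> f y) ?Z"
      using w v assms(2) Z(2)
      by (intro B.M.finsum_cong') (auto simp: free_module_simps intro!: B.smult_l_distr)
    also have "\<dots> = h w \<oplus>\<^bsub>B\<^esub> h v"
      using w v assms(2) Z
      by (subst h[OF w Z], simp, subst h[OF v Z], simp, intro B.M.finsum_addf)
        (auto simp: free_module_simps)
    finally show "h (w \<oplus>\<^bsub>?F\<^esub> v) = h w \<oplus>\<^bsub>B\<^esub> h v" .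
  next
    fix r w assume r: "r \<in> carrier K" and w: "w \<in> carrier ?F"
    let ?Z = "{y. w y \<noteq> \<zero>\<^bsub>K\<^esub>}"
    have rw: "r \<odot>\<^bsub>?F\<^esub> w \<in> carrier ?F"
      using module.smult_closed[OF module_free_module[OF B.R.is_cring, of Y] r w] .
    have Z: "finite ?Z" "?Z \<subseteq> Y" using w by (auto simp: free_module_simps)
    have "h (r \<odot>\<^bsub>?F\<^esub> w) = finsum B (\<lambda>y. (r \<otimes>\<^bsub>K\<^esub> w y) \<odot>\<^bsub>B\<^esub> f y) ?Z"
      using r by (subst h[OF rw Z]) (auto simp: free_module_simps)
    also have "\<dots> = finsum B (\<lambda>y. r \<odot>\<^bsub>B\<^esub> (w y \<odot>\<^bsub>B\<^esub> f y)) ?Z"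
      using r w assms(2) Z(2)
      by (intro B.M.finsum_cong') (auto simp: free_module_simps intro!: B.smult_assoc1)
    also have "\<dots> = r \<odot>\<^bsub>B\<^esub> h w"
      unfolding h_def using r w assms(2) Z
      by (intro B.finsum_smult_ldistr[symmetric]) (auto simp: free_module_simps)
    finally show "h (r \<odot>\<^bsub>?F\<^esub> w) = r \<odot>\<^bsub>B\<^esub> h w" .
  qed
  have "h (free_gen K y) = f y" if y: "y \<in> Y" for y
  proof -
    have "h (free_gen K y) = finsum B (\<lambda>x. free_gen K y x \<odot>\<^bsub>B\<^esub> f x) {y}"
      using y by (intro h free_gen_closed B.R.is_cring) (auto simp: free_gen_def)
    also have "\<dots> = f y" using y assms(2) by (simp add: free_gen_def)
    finally show ?thesis .
  qed
  with lin show ?thesis by blast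
qed

lemma spans_free_gen:
  assumes "cring K"
  shows "spans K (free_module K Y) (free_gen K ` Y)"
  unfolding spans_def
proof (intro conjI allI impI subsetI)
  interpret K: cring K by fact
  interpret F: module K "free_module K Y" by (rule module_free_module) fact
  show "x \<in> carrier (free_module K Y)" if "x \<in> free_gen K ` Y" for x
    using that free_gen_closed[OF assms] by auto
  fix S w assume S: "submodule S K (free_module K Y)" "free_gen K ` Y \<subseteq> S"
    and w: "w \<in> carrier (free_module K Y)"
  note Sc = submoduleD[OF F.module_axioms S(1)]
  have "finite Z \<Longrightarrow> w \<in> carrier (free_module K Y) \<Longrightarrow> {y. w y \<noteq> \<zero>\<^bsub>K\<^esub>} = Z \<Longrightarrow> w \<in> S" for w Z
  proof (induction Z arbitrary: w rule: finite_induct)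
    case empty
    then have "w = \<zero>\<^bsub>free_module K Y\<^esub>" by (auto simp: free_module_simps)
    then show ?case using Sc(2) by simp
  next
    case (insert y Z)
    \<comment> \<open>Removing the coordinate \<open>y\<close> shrinks the support; the removed part
      is \<open>w y\<close> times the generator at \<open>y\<close>.\<close>
    let ?v = "w(y := \<zero>\<^bsub>K\<^esub>)"
    have "{x. ?v x \<noteq> \<zero>\<^bsub>K\<^esub>} = Z" using insert.prems(2) insert.hyps(2) by auto
    moreover have "?v \<in> carrier (free_module K Y)"
      using insert.prems insert.hyps calculation by (auto simp: free_module_simps)
    ultimately have v: "?v \<in> S" by (intro insert.IH)
    have y: "y \<in> Y" "w y \<in> carrier K" using insert.prems by (auto simp: free_module_simps)
    then have "w y \<odot>\<^bsub>free_module K Y\<^esub> free_gen K y \<in> S" using S(2) Sc(4) by blast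
    then have "(w y \<odot>\<^bsub>free_module K Y\<^esub> free_gen K y) \<oplus>\<^bsub>free_module K Y\<^esub> ?v \<in> S"
      using v Sc(3) by blast
    also have "(w y \<odot>\<^bsub>free_module K Y\<^esub> free_gen K y) \<oplus>\<^bsub>free_module K Y\<^esub> ?v = w"
      using insert.prems(1) by (auto simp: free_module_simps free_gen_def fun_eq_iff)
    finally show ?case .
  qed
  then show "w \<in> S" using w by (auto simp: free_module_simps)
qed

section \<open>Quotients by a submodule\<close>

context
  fixes K :: "('r, 'k) ring_scheme" and A :: "('r, 'a) module" and S
  assumes A: "module K A" and S: "submodule S K A"
begin

interpretation A: module K A by (rule A)

interpretation S: abelian_subgroup S A
  by (rule abelian_subgroupI3[OF additive_subgroupI[OF submodule.axioms(1)[OF S]] A.abelian_group_axioms])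

lemma coset_eq_iff:
  assumes "a \<in> carrier A" "b \<in> carrier A"
  shows "S +>\<^bsub>A\<^esub> a = S +>\<^bsub>A\<^esub> b \<longleftrightarrow> a \<ominus>\<^bsub>A\<^esub> b \<in> S"
proof
  assume "S +>\<^bsub>A\<^esub> a = S +>\<^bsub>A\<^esub> b"
  then have "a \<in> S +>\<^bsub>A\<^esub> b" using S.a_rcos_self[of a] assms by auto
  then obtain s where "s \<in> S" "a = s \<oplus>\<^bsub>A\<^esub> b" by (auto simp: a_r_coset_def')
  then show "a \<ominus>\<^bsub>A\<^esub> b \<in> S"
    using assms S.a_subset by (auto simp: a_minus_def A.M.a_assoc A.M.r_neg)
next
  assume "a \<ominus>\<^bsub>A\<^esub> b \<in> S"
  then have "(a \<ominus>\<^bsub>A\<^esub> b) \<oplus>\<^bsub>A\<^esub> b \<in> S +>\<^bsub>A\<^esub> b" by (auto simp: a_r_coset_def')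
  then have "a \<in> S +>\<^bsub>A\<^esub> b" using assms by (simp add: a_minus_def A.M.a_assoc A.M.l_neg)
  then show "S +>\<^bsub>A\<^esub> a = S +>\<^bsub>A\<^esub> b"
    using A.M.a_repr_independence[of a S b] assms submodule.axioms(1)[OF S] by simp
qed

lemma quot_module_carrier: "carrier (quot_module A S) = (\<lambda>a. S +>\<^bsub>A\<^esub> a) ` carrier A"
  by (auto simp: quot_module_def A_RCOSETS_def RCOSETS_def a_r_coset_def)

lemma quot_module_add:
  assumes "a \<in> carrier A" "b \<in> carrier A"
  shows "S +>\<^bsub>A\<^esub> (a \<oplus>\<^bsub>A\<^esub> b) = (S +>\<^bsub>A\<^esub> a) \<oplus>\<^bsub>quot_module A S\<^esub> (S +>\<^bsub>A\<^esub> b)"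
  using S.a_rcos_sum[OF assms] by (simp add: quot_module_def)

lemma quot_module_smult:
  assumes "r \<in> carrier K" "a \<in> carrier A"
  shows "S +>\<^bsub>A\<^esub> (r \<odot>\<^bsub>A\<^esub> a) = r \<odot>\<^bsub>quot_module A S\<^esub> (S +>\<^bsub>A\<^esub> a)"
proof -
  \<comment> \<open>The scalar action in \<open>quot_module\<close> is a union over all
    representatives \<open>c\<close>. Every member of that union is the same coset, since
    \<open>c\<close> differs from \<open>a\<close> by some \<open>s\<close> in \<open>S\<close> and
    the multiple of \<open>s\<close> by \<open>r\<close> stays in \<open>S\<close>.\<close>
  have "S +>\<^bsub>A\<^esub> (r \<odot>\<^bsub>A\<^esub> c) = S +>\<^bsub>A\<^esub> (r \<odot>\<^bsub>A\<^esub> a)" if "c \<in> S +>\<^bsub>A\<^esub> a" for c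
  proof -
    obtain s where s: "s \<in> S" "c = s \<oplus>\<^bsub>A\<^esub> a" using \<open>c \<in> S +>\<^bsub>A\<^esub> a\<close> by (auto simp: a_r_coset_def')
    then have sA: "s \<in> carrier A" using S.a_subset by blast
    have "r \<odot>\<^bsub>A\<^esub> c \<ominus>\<^bsub>A\<^esub> r \<odot>\<^bsub>A\<^esub> a = r \<odot>\<^bsub>A\<^esub> s"
      using s sA assms by (simp add: A.smult_r_distr a_minus_def A.M.a_assoc A.M.r_neg)
    then show ?thesis
      using s sA assms submoduleD(4)[OF A S, of r s] by (subst coset_eq_iff) auto
  qed
  moreover have "a \<in> S +>\<^bsub>A\<^esub> a" using S.a_rcos_self assms(2) by simp
  ultimately have "(\<Union>c\<in>S +>\<^bsub>A\<^esub> a. S +>\<^bsub>A\<^esub> (r \<odot>\<^bsub>A\<^esub> c)) = S +>\<^bsub>A\<^esub> (r \<odot>\<^bsub>A\<^esub> a)"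
    by blast
  then show ?thesis by (simp add: quot_module_def)
qed

lemma module_quot_module: "module K (quot_module A S)"
proof (rule module_surj_image[where A = A])
  show "S +>\<^bsub>A\<^esub> \<zero>\<^bsub>A\<^esub> = \<zero>\<^bsub>quot_module A S\<^esub>"
    using A.M.a_coset_add_zero[OF S.a_subset] by (simp add: quot_module_def)
qed (auto simp: A quot_module_carrier quot_module_add quot_module_smult)

lemma quot_module_proj: "(\<lambda>a. S +>\<^bsub>A\<^esub> a) \<in> linear_maps K A (quot_module A S)"
  by (rule linear_mapsI) (auto simp: quot_module_carrier quot_module_add quot_module_smult)

lemma quot_module_lift:
  assumes "module K B" "h \<in> linear_maps K A B" "\<And>s. s \<in> S \<Longrightarrow> h s = \<zero>\<^bsub>B\<^esub>"
  shows "\<exists>k\<in>linear_maps K (quot_module A S) B. \<forall>a\<in>carrier A. k (S +>\<^bsub>A\<^esub> a) = h a"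
proof -
  interpret B: module K B by fact
  have eq: "h a = h b" if "S +>\<^bsub>A\<^esub> a = S +>\<^bsub>A\<^esub> b" "a \<in> carrier A" "b \<in> carrier A" for a b
  proof -
    have "h ((a \<ominus>\<^bsub>A\<^esub> b) \<oplus>\<^bsub>A\<^esub> b) = h (a \<ominus>\<^bsub>A\<^esub> b) \<oplus>\<^bsub>B\<^esub> h b"
      using that by (intro linear_mapsD(2)[OF assms(2)]) auto
    moreover have "h (a \<ominus>\<^bsub>A\<^esub> b) = \<zero>\<^bsub>B\<^esub>" using coset_eq_iff that assms(3) by blast
    moreover have "(a \<ominus>\<^bsub>A\<^esub> b) \<oplus>\<^bsub>A\<^esub> b = a"
      using that by (simp add: a_minus_def A.M.a_assoc A.M.l_neg)
    ultimately show ?thesis using linear_mapsD(1)[OF assms(2)] that by simp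
  qed
  \<comment> \<open>A coset has no preferred representative; the choice made by \<open>SOME\<close>
    is harmless because \<open>h\<close> is constant on cosets by \<open>eq\<close>.\<close>
  define k where "k = (\<lambda>C. h (SOME a. a \<in> carrier A \<and> S +>\<^bsub>A\<^esub> a = C))"
  have k: "k (S +>\<^bsub>A\<^esub> a) = h a" if "a \<in> carrier A" for a
    unfolding k_def by (rule someI2[of _ a]) (use that in \<open>auto intro: eq\<close>)
  have "k \<in> linear_maps K (quot_module A S) B"
    using linear_mapsD[OF assms(2)]
    by (intro linear_mapsI)
      (auto simp: quot_module_carrier k quot_module_add[symmetric] quot_module_smult[symmetric])
  with k show ?thesis by blast
qed

end

section \<open>Multilinear maps, tensor products and direct sums\<close>

text \<open>Linearity in slot \<open>i\<close> is stated through function update, so each slot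
  yields a member of \<open>linear_maps\<close>. For empty \<open>I\<close> the only condition is
  that the value at the empty family lies in \<open>B\<close>.\<close>

definition multilinear_maps ::
    "('r, 'k) ring_scheme \<Rightarrow> 'i set \<Rightarrow> ('i \<Rightarrow> ('r, 'a) module) \<Rightarrow> ('r, 'b) module \<Rightarrow> (('i \<Rightarrow> 'a) \<Rightarrow> 'b) set"
  where "multilinear_maps K I A B =
    {\<phi>. \<forall>x\<in>(\<Pi>\<^sub>E i\<in>I. carrier (A i)). \<phi> x \<in> carrier B \<and>
         (\<forall>i\<in>I. (\<lambda>a. \<phi> (x(i := a))) \<in> linear_maps K (A i) B)}"

lemma multilinear_mapsI:
  assumes "\<And>x. x \<in> (\<Pi>\<^sub>E i\<in>I. carrier (A i)) \<Longrightarrow> \<phi> x \<in> carrier B"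
    and "\<And>x i. x \<in> (\<Pi>\<^sub>E i\<in>I. carrier (A i)) \<Longrightarrow> i \<in> I \<Longrightarrow>
      (\<lambda>a. \<phi> (x(i := a))) \<in> linear_maps K (A i) B"
  shows "\<phi> \<in> multilinear_maps K I A B"
  using assms by (auto simp: multilinear_maps_def)

lemma multilinear_mapsD:
  assumes "\<phi> \<in> multilinear_maps K I A B" "x \<in> (\<Pi>\<^sub>E i\<in>I. carrier (A i))"
  shows "\<phi> x \<in> carrier B"
    and "i \<in> I \<Longrightarrow> (\<lambda>a. \<phi> (x(i := a))) \<in> linear_maps K (A i) B"
  using assms by (auto simp: multilinear_maps_def)

lemma multilinear_maps_comp:
  assumes "\<phi> \<in> multilinear_maps K I A B" "h \<in> linear_maps K B C"
  shows "(\<lambda>x. h (\<phi> x)) \<in> multilinear_maps K I A C"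
  using linear_maps_comp[OF multilinear_mapsD(2)[OF assms(1)] assms(2)]
    multilinear_mapsD(1)[OF assms(1)] linear_mapsD(1)[OF assms(2)]
  by (intro multilinear_mapsI) auto

lemma fun_upd_PiE: "x \<in> (\<Pi>\<^sub>E i\<in>I. C i) \<Longrightarrow> i \<in> I \<Longrightarrow> a \<in> C i \<Longrightarrow> x(i := a) \<in> (\<Pi>\<^sub>E i\<in>I. C i)"
  by (auto simp: PiE_iff extensional_def)

text \<open>The slots are released one at a time: the inner induction is on the set \<open>J\<close>
  of slots that may hold arbitrary elements while all others hold generators. Releasing one slot,
  with the others fixed, is an instance of \<open>spans_induct\<close>.\<close>

lemma PiE_spans_induct:
  assumes "finite I" and G: "\<And>i. i \<in> I \<Longrightarrow> spans K (A i) (G i)"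
    and sub: "\<And>x i. x \<in> (\<Pi>\<^sub>E i\<in>I. carrier (A i)) \<Longrightarrow> i \<in> I \<Longrightarrow>
      submodule {a \<in> carrier (A i). P (x(i := a))} K (A i)"
    and base: "\<And>x. x \<in> (\<Pi>\<^sub>E i\<in>I. G i) \<Longrightarrow> P x"
    and x: "x \<in> (\<Pi>\<^sub>E i\<in>I. carrier (A i))"
  shows "P x"
proof -
  have "P x" if "finite J" "J \<subseteq> I" "x \<in> (\<Pi>\<^sub>E i\<in>I. carrier (A i))" "\<forall>i\<in>I - J. x i \<in> G i" for J x
    using that
  proof (induction J arbitrary: x rule: finite_induct)
    case empty
    then show ?case by (intro base) (auto simp: PiE_iff)
  next
    case (insert j J)
    have j: "j \<in> I" using insert.prems by auto
    have "P (x(j := x j))"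
    proof (rule spans_induct[where P = "\<lambda>a. P (x(j := a))"])
      show "spans K (A j) (G j)" using G j .
      show "submodule {a \<in> carrier (A j). P (x(j := a))} K (A j)"
        using insert.prems j by (intro sub) auto
      show "x j \<in> carrier (A j)" using insert.prems j by auto
      fix a assume a: "a \<in> G j"
      then have "x(j := a) \<in> (\<Pi>\<^sub>E i\<in>I. carrier (A i))"
        using insert.prems j spansD[OF G[OF j]] by (intro fun_upd_PiE) auto
      then show "P (x(j := a))" using a insert.prems by (intro insert.IH) auto
    qed
    then show ?case by simp
  qed
  from this[OF assms(1) subset_refl x] show ?thesis by simp
qed

text \<open>The labels \<open>y\<close> in \<open>Y j\<close> are kept apart from the elements
  \<open>e j y\<close>, which need not determine them and may satisfy linear relations.
  Well-definedness sits in the last hypothesis: in a single slot the prescription already comes from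
  a linear map. When a slot \<open>j\<close> is added, the induction hypothesis extends the
  remaining slots to a multilinear \<open>\<Phi> z\<close> for each label \<open>z\<close> in
  \<open>Y j\<close>. What has to be shown is that \<open>\<Phi> z p\<close>, as a function of
  \<open>z\<close>, comes from a linear map for arbitrary \<open>p\<close> and not only for families
  of generators.\<close>

lemma multilinear_extension:
  fixes P :: "'j \<Rightarrow> ('r, 'p) module" and e :: "'j \<Rightarrow> 'x \<Rightarrow> 'p" and \<phi> :: "('j \<Rightarrow> 'x) \<Rightarrow> 'b"
  assumes "finite J" and B: "module K B" and P: "\<And>j. j \<in> J \<Longrightarrow> module K (P j)"
    and e: "\<And>j. j \<in> J \<Longrightarrow> spans K (P j) (e j ` Y j)"
    and "\<And>y. y \<in> (\<Pi>\<^sub>E j\<in>J. Y j) \<Longrightarrow> \<phi> y \<in> carrier B"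
    and "\<And>y j. y \<in> (\<Pi>\<^sub>E j\<in>J. Y j) \<Longrightarrow> j \<in> J \<Longrightarrow>
      \<exists>h\<in>linear_maps K (P j) B. \<forall>z\<in>Y j. h (e j z) = \<phi> (y(j := z))"
  shows "\<exists>\<Phi>\<in>multilinear_maps K J P B. \<forall>y\<in>(\<Pi>\<^sub>E j\<in>J. Y j). \<Phi> (\<lambda>j\<in>J. e j (y j)) = \<phi> y"
  using assms(1) P e assms(5,6)
proof (induction J arbitrary: \<phi> rule: finite_induct)
  case empty
  then show ?case
    by (intro bexI[where x = "\<lambda>_. \<phi> (\<lambda>_. undefined)"] multilinear_mapsI) auto
next
  case (insert j J)
  interpret B: module K B by (rule B)
  have eq: "\<phi> ((y(i := w))(j := z)) = \<phi> ((y(j := z))(i := w))" if "i \<in> J" for y z i w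
    using that insert.hyps by (metis fun_upd_twist)
  have upd: "y(j := z) \<in> (\<Pi>\<^sub>E j\<in>insert j J. Y j)" if "y \<in> (\<Pi>\<^sub>E j\<in>J. Y j)" "z \<in> Y j" for y z
    using that insert.hyps by (auto simp: PiE_iff extensional_def)
  have "\<exists>\<Phi>\<in>multilinear_maps K J P B. \<forall>y\<in>(\<Pi>\<^sub>E j\<in>J. Y j). \<Phi> (\<lambda>j\<in>J. e j (y j)) = \<phi> (y(j := z))"
    if z: "z \<in> Y j" for z
  proof (rule insert.IH)
    fix y i assume y: "y \<in> (\<Pi>\<^sub>E j\<in>J. Y j)" and i: "i \<in> J"
    have "\<exists>h\<in>linear_maps K (P i) B. \<forall>w\<in>Y i. h (e i w) = \<phi> ((y(j := z))(i := w))"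
      by (rule insert.prems(4)[OF upd[OF y z]]) (use i in auto)
    then show "\<exists>h\<in>linear_maps K (P i) B. \<forall>w\<in>Y i. h (e i w) = \<phi> ((y(i := w))(j := z))"
      using eq i by simp
  next
    show "\<phi> (y(j := z)) \<in> carrier B" if "y \<in> (\<Pi>\<^sub>E j\<in>J. Y j)" for y
      by (rule insert.prems(3)[OF upd[OF that z]])
  qed (use insert.prems(1,2) in auto)
  then obtain \<Phi> where \<Phi>: "\<And>z. z \<in> Y j \<Longrightarrow> \<Phi> z \<in> multilinear_maps K J P B"
    and \<Phi>e: "\<And>z y. z \<in> Y j \<Longrightarrow> y \<in> (\<Pi>\<^sub>E j\<in>J. Y j) \<Longrightarrow> \<Phi> z (\<lambda>j\<in>J. e j (y j)) = \<phi> (y(j := z))"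
    by metis
  have Pj: "module K (P j)" and ej: "spans K (P j) (e j ` Y j)" using insert.prems by auto
  \<comment> \<open>The existence of a linear map in slot \<open>j\<close> passes to sums and
    multiples in every slot of \<open>p\<close>, by adding and scaling the maps; so it may be
    checked on families of generators.\<close>
  have "\<exists>h\<in>linear_maps K (P j) B. \<forall>z\<in>Y j. h (e j z) = \<Phi> z p"
    if "p \<in> (\<Pi>\<^sub>E i\<in>J. carrier (P i))" for p
  proof (rule PiE_spans_induct[where A = P and I = J and G = "\<lambda>i. e i ` Y i"
        and P = "\<lambda>p. \<exists>h\<in>linear_maps K (P j) B. \<forall>z\<in>Y j. h (e j z) = \<Phi> z p"])
    fix p i assume p: "p \<in> (\<Pi>\<^sub>E i\<in>J. carrier (P i))" and i: "i \<in> J"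
    then have lin: "(\<lambda>a. \<Phi> z (p(i := a))) \<in> linear_maps K (P i) B" if "z \<in> Y j" for z
      using multilinear_mapsD(2)[OF \<Phi>] that by blast
    have Pi: "module K (P i)" using insert.prems i by auto
    interpret Pi: module K "P i" by fact
    show "submodule {a \<in> carrier (P i). \<exists>h\<in>linear_maps K (P j) B.
        \<forall>z\<in>Y j. h (e j z) = \<Phi> z (p(i := a))} K (P i)" (is "submodule ?S K (P i)")
    proof (rule submoduleI'[OF Pi])
      have SI: "a \<in> ?S" if "a \<in> carrier (P i)" "h \<in> linear_maps K (P j) B"
        "\<And>z. z \<in> Y j \<Longrightarrow> h (e j z) = \<Phi> z (p(i := a))" for a h
        using that by blast
      show "\<zero>\<^bsub>P i\<^esub> \<in> ?S"
        by (rule SI[OF _ linear_maps_const_zero[OF B]]) (simp_all add: linear_maps_zero[OF Pi B lin])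
      fix a assume "a \<in> ?S"
      then obtain h where h: "h \<in> linear_maps K (P j) B" "\<And>z. z \<in> Y j \<Longrightarrow> h (e j z) = \<Phi> z (p(i := a))"
        and a: "a \<in> carrier (P i)" by blast
      show "r \<odot>\<^bsub>P i\<^esub> a \<in> ?S" if r: "r \<in> carrier K" for r
        by (rule SI[OF _ linear_maps_smult[OF B h(1) r]])
          (use r a in \<open>simp_all add: h(2) linear_mapsD(3)[OF lin r a]\<close>)
      fix b assume "b \<in> ?S"
      then obtain k where k: "k \<in> linear_maps K (P j) B" "\<And>z. z \<in> Y j \<Longrightarrow> k (e j z) = \<Phi> z (p(i := b))"
        and b: "b \<in> carrier (P i)" by blast
      show "a \<oplus>\<^bsub>P i\<^esub> b \<in> ?S"
        by (rule SI[OF _ linear_maps_add[OF B h(1) k(1)]])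
          (use a b in \<open>simp_all add: h(2) k(2) linear_mapsD(2)[OF lin a b]\<close>)
    qed auto
  next
    fix p assume p: "p \<in> (\<Pi>\<^sub>E i\<in>J. e i ` Y i)"
    then have "\<forall>i\<in>J. \<exists>w. w \<in> Y i \<and> p i = e i w" by (auto simp: PiE_iff)
    then obtain w where w: "\<And>i. i \<in> J \<Longrightarrow> w i \<in> Y i" "\<And>i. i \<in> J \<Longrightarrow> p i = e i (w i)"
      by metis
    define y where "y = restrict w J"
    have y: "y \<in> (\<Pi>\<^sub>E j\<in>J. Y j)" "p = (\<lambda>i\<in>J. e i (y i))"
      using w p by (auto simp: y_def PiE_iff extensional_def fun_eq_iff)
    show "\<exists>h\<in>linear_maps K (P j) B. \<forall>z\<in>Y j. h (e j z) = \<Phi> z p"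
    \<comment> \<open>The hypothesis asks for a complete family of labels, hence for some label in
      slot \<open>j\<close>, although that slot is overwritten. If there is no label, the zero map
      satisfies the claim vacuously.\<close>
    proof (cases "Y j = {}")
      case True
      then show ?thesis using linear_maps_const_zero[OF B] by blast
    next
      case False
      then obtain z0 where "z0 \<in> Y j" by blast
      then have "\<exists>h\<in>linear_maps K (P j) B. \<forall>z\<in>Y j. h (e j z) = \<phi> ((y(j := z0))(j := z))"
        by (intro insert.prems(4) upd[OF y(1)]) simp_all
      then show ?thesis using \<Phi>e y by simp
    qed
  qed (use that insert in auto)
  then obtain H where H: "\<And>p. p \<in> (\<Pi>\<^sub>E i\<in>J. carrier (P i)) \<Longrightarrow> H p \<in> linear_maps K (P j) B"
    and He: "\<And>p z. p \<in> (\<Pi>\<^sub>E i\<in>J. carrier (P i)) \<Longrightarrow> z \<in> Y j \<Longrightarrow> H p (e j z) = \<Phi> z p"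
    by metis
  define \<Psi> where "\<Psi> q = H (restrict q J) (q j)" for q
  have "\<Psi> \<in> multilinear_maps K (insert j J) P B"
  proof (rule multilinear_mapsI)
    fix q assume q: "q \<in> (\<Pi>\<^sub>E i\<in>insert j J. carrier (P i))"
    define p where "p = restrict q J"
    have r: "p \<in> (\<Pi>\<^sub>E i\<in>J. carrier (P i))" using q by (auto simp: p_def)
    show "\<Psi> q \<in> carrier B"
      unfolding \<Psi>_def p_def[symmetric] using linear_mapsD(1)[OF H[OF r]] q by auto
    fix i assume "i \<in> insert j J"
    then consider "i = j" | "i \<in> J" "i \<noteq> j" using insert.hyps by auto
    then show "(\<lambda>a. \<Psi> (q(i := a))) \<in> linear_maps K (P i) B"
    proof cases
      case 1
      have "restrict (q(j := a)) J = p" for a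
        using insert.hyps by (auto simp: fun_eq_iff p_def)
      then show ?thesis using 1 H[OF r] by (simp add: \<Psi>_def)
    next
      case 2
      have i: "module K (P i)" using insert.prems 2 by auto
      interpret Pi: module K "P i" by fact
      have ra: "p(i := a) \<in> (\<Pi>\<^sub>E i\<in>J. carrier (P i))" if "a \<in> carrier (P i)" for a
        using r 2 that by (intro fun_upd_PiE) auto
      have lin: "(\<lambda>a. \<Phi> z (p(i := a))) \<in> linear_maps K (P i) B" if "z \<in> Y j" for z
        using multilinear_mapsD(2)[OF \<Phi> r] that 2 by blast
      have qj: "q j \<in> carrier (P j)" using q by auto
      \<comment> \<open>\<open>H p\<close> was chosen separately for each \<open>p\<close>, so its
        dependence on \<open>p\<close> has to be recovered. Linear maps in slot \<open>j\<close>
        agree once they agree on the spanning elements \<open>e j z\<close>; there \<open>H\<close>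
        takes the values of \<Phi>, which are linear in slot \<open>i\<close>.\<close>
      have "(\<lambda>a. H (p(i := a)) (q j)) \<in> linear_maps K (P i) B"
      proof (rule linear_mapsI)
        fix a assume "a \<in> carrier (P i)"
        then show "H (p(i := a)) (q j) \<in> carrier B"
          using linear_mapsD(1)[OF H[OF ra]] qj by blast
      next
        fix a b assume ab: "a \<in> carrier (P i)" "b \<in> carrier (P i)"
        show "H (p(i := a \<oplus>\<^bsub>P i\<^esub> b)) (q j) =
            H (p(i := a)) (q j) \<oplus>\<^bsub>B\<^esub> H (p(i := b)) (q j)"
        proof (rule spans_eqI[OF Pj B ej _ _ _ qj])
          show "H (p(i := a \<oplus>\<^bsub>P i\<^esub> b)) \<in> linear_maps K (P j) B"
            using ab by (intro H ra) auto
          show "(\<lambda>c. H (p(i := a)) c \<oplus>\<^bsub>B\<^esub> H (p(i := b)) c)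
              \<in> linear_maps K (P j) B"
            using ab by (intro linear_maps_add B H ra)
        qed (use ab He[OF ra] linear_mapsD(2)[OF lin] in \<open>auto simp del: fun_upd_apply\<close>)
      next
        fix s a assume s: "s \<in> carrier K" and a: "a \<in> carrier (P i)"
        show "H (p(i := s \<odot>\<^bsub>P i\<^esub> a)) (q j) = s \<odot>\<^bsub>B\<^esub> H (p(i := a)) (q j)"
        proof (rule spans_eqI[OF Pj B ej _ _ _ qj])
          show "H (p(i := s \<odot>\<^bsub>P i\<^esub> a)) \<in> linear_maps K (P j) B"
            using s a by (intro H ra) auto
          show "(\<lambda>c. s \<odot>\<^bsub>B\<^esub> H (p(i := a)) c) \<in> linear_maps K (P j) B"
            using s a by (intro linear_maps_smult B H ra)
        qed (use s a He[OF ra] linear_mapsD(3)[OF lin] in \<open>auto simp del: fun_upd_apply\<close>)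
      qed
      moreover have "restrict (q(i := a)) J = p(i := a)" for a
        using 2 by (auto simp: fun_eq_iff p_def)
      ultimately show ?thesis using 2 by (simp add: \<Psi>_def)
    qed
  qed
  moreover have "\<Psi> (\<lambda>i\<in>insert j J. e i (y i)) = \<phi> y" if y: "y \<in> (\<Pi>\<^sub>E j\<in>insert j J. Y j)" for y
  proof -
    let ?y = "restrict y J"
    have y': "?y \<in> (\<Pi>\<^sub>E j\<in>J. Y j)" "y j \<in> Y j" "?y(j := y j) = y"
      using y by (auto simp: PiE_iff extensional_def fun_eq_iff)
    have r: "restrict (\<lambda>i\<in>insert j J. e i (y i)) J = (\<lambda>i\<in>J. e i (?y i))"
      by (auto simp: fun_eq_iff)
    have c: "(\<lambda>i\<in>J. e i (?y i)) \<in> (\<Pi>\<^sub>E i\<in>J. carrier (P i))"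
      using y' insert.prems(2) by (auto simp: PiE_iff intro: spansD)
    have "\<Psi> (\<lambda>i\<in>insert j J. e i (y i)) = H (\<lambda>i\<in>J. e i (?y i)) (e j (y j))"
      unfolding \<Psi>_def r by simp
    also have "\<dots> = \<phi> y" using He[OF c y'(2)] \<Phi>e[OF y'(2,1)] y'(3) by simp
    finally show ?thesis .
  qed
  ultimately show ?case by blast
qed

section \<open>Tensor products and their universal property\<close>

context
  fixes K :: "('r, 'k) ring_scheme" and I :: "'i set" and A :: "'i \<Rightarrow> ('r, 'a) module"
  assumes K: "cring K" and A: "\<And>i. i \<in> I \<Longrightarrow> module K (A i)"
begin

abbreviation (input) "tensor_index \<equiv> (\<Pi>\<^sub>E i\<in>I. carrier (A i))"
abbreviation (input) "tensor_free \<equiv> free_module K tensor_index"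

interpretation F: module K tensor_free by (rule module_free_module[OF K])

lemma tensor_upd_closed:
  assumes "x \<in> tensor_index" "i \<in> I" "a \<in> carrier (A i)"
  shows "free_gen K (x(i := a)) \<in> carrier tensor_free"
  using assms by (intro free_gen_closed K fun_upd_PiE)

lemma tensor_rels_closed: "tensor_rels K I A \<subseteq> carrier tensor_free"
proof -
  have "abelian_group (A i)" if "i \<in> I" for i using A[OF that] by (simp add: module_def)
  note closed = abelian_groupE(1)[OF this] module.smult_closed[OF A]
  show ?thesis
    unfolding tensor_rels_def Let_def
    by (safe intro!: F.M.minus_closed F.M.a_closed F.smult_closed tensor_upd_closed closed)
qed

lemma submodule_tensor_ker: "submodule (tensor_ker K I A) K tensor_free"
proof (rule submoduleI'[OF F.module_axioms])
  \<comment> \<open>The intersection lies in the carrier because the carrier itself is one of the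
    submodules containing the relations.\<close>
  show "tensor_ker K I A \<subseteq> carrier tensor_free"
    using F.carrier_is_submodule tensor_rels_closed by (auto simp: tensor_ker_def)
qed (auto simp: tensor_ker_def intro: submoduleD[OF F.module_axioms])

lemma tensor_rels_ker: "tensor_rels K I A \<subseteq> tensor_ker K I A"
  by (auto simp: tensor_ker_def)

lemma module_tensor: "module K (tensor K I A)"
  unfolding tensor_def by (rule module_quot_module[OF F.module_axioms submodule_tensor_ker])

text \<open>The relations are the differences that must vanish for additivity and homogeneity in a
  slot, so the required equalities of cosets are memberships of relations in
  \<open>tensor_ker\<close>.\<close>

lemma pure_tensor_multilinear: "pure_tensor K I A \<in> multilinear_maps K I A (tensor K I A)"
proof (rule multilinear_mapsI)
  note S = F.module_axioms submodule_tensor_ker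
  have closed: "pure_tensor K I A x \<in> carrier (tensor K I A)" if "x \<in> tensor_index" for x
    unfolding tensor_def pure_tensor_def quot_module_carrier[OF S]
    by (intro imageI free_gen_closed[OF K] that)
  fix x assume x: "x \<in> tensor_index"
  show "pure_tensor K I A x \<in> carrier (tensor K I A)" using closed x .
  fix i assume i: "i \<in> I"
  interpret Ai: module K "A i" by (rule A) fact
  show "(\<lambda>a. pure_tensor K I A (x(i := a))) \<in> linear_maps K (A i) (tensor K I A)"
  proof (rule linear_mapsI)
    fix a assume "a \<in> carrier (A i)"
    then show "pure_tensor K I A (x(i := a)) \<in> carrier (tensor K I A)"
      using x i by (intro closed fun_upd_PiE)
  next
    fix a b assume ab: "a \<in> carrier (A i)" "b \<in> carrier (A i)"
    note c = tensor_upd_closed[OF x i]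
    have "free_gen K (x(i := a \<oplus>\<^bsub>A i\<^esub> b)) \<ominus>\<^bsub>tensor_free\<^esub>
        (free_gen K (x(i := a)) \<oplus>\<^bsub>tensor_free\<^esub> free_gen K (x(i := b))) \<in> tensor_ker K I A"
      by (rule subsetD[OF tensor_rels_ker]) (use x i ab in \<open>auto simp: tensor_rels_def Let_def\<close>)
    then have "pure_tensor K I A (x(i := a \<oplus>\<^bsub>A i\<^esub> b)) = tensor_ker K I A +>\<^bsub>tensor_free\<^esub>
        (free_gen K (x(i := a)) \<oplus>\<^bsub>tensor_free\<^esub> free_gen K (x(i := b)))"
      unfolding pure_tensor_def using ab c by (subst coset_eq_iff[OF S]) auto
    then show "pure_tensor K I A (x(i := a \<oplus>\<^bsub>A i\<^esub> b)) =
        pure_tensor K I A (x(i := a)) \<oplus>\<^bsub>tensor K I A\<^esub> pure_tensor K I A (x(i := b))"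
      using quot_module_add[OF S c[OF ab(1)] c[OF ab(2)]] by (simp add: tensor_def pure_tensor_def)
  next
    fix r a assume ra: "r \<in> carrier K" "a \<in> carrier (A i)"
    note c = tensor_upd_closed[OF x i]
    have "free_gen K (x(i := r \<odot>\<^bsub>A i\<^esub> a)) \<ominus>\<^bsub>tensor_free\<^esub>
        (r \<odot>\<^bsub>tensor_free\<^esub> free_gen K (x(i := a))) \<in> tensor_ker K I A"
      by (rule subsetD[OF tensor_rels_ker]) (use x i ra in \<open>auto simp: tensor_rels_def Let_def\<close>)
    then have "pure_tensor K I A (x(i := r \<odot>\<^bsub>A i\<^esub> a)) = tensor_ker K I A +>\<^bsub>tensor_free\<^esub>
        (r \<odot>\<^bsub>tensor_free\<^esub> free_gen K (x(i := a)))"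
      unfolding pure_tensor_def using ra c by (subst coset_eq_iff[OF S]) auto
    then show "pure_tensor K I A (x(i := r \<odot>\<^bsub>A i\<^esub> a)) =
        r \<odot>\<^bsub>tensor K I A\<^esub> pure_tensor K I A (x(i := a))"
      using quot_module_smult[OF S ra(1) c[OF ra(2)]] by (simp add: tensor_def pure_tensor_def)
  qed
qed

text \<open>\<phi> extends to the free module, and the zero set of the extension is a submodule.
  Multilinearity puts the relations into it, hence also \<open>tensor_ker\<close>, the least
  submodule containing them.\<close>

lemma tensor_lift:
  assumes B: "module K B" and \<phi>: "\<phi> \<in> multilinear_maps K I A B"
  shows "\<exists>h\<in>linear_maps K (tensor K I A) B. \<forall>x\<in>tensor_index. h (pure_tensor K I A x) = \<phi> x"
proof -
  interpret B: module K B by fact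
  note S = F.module_axioms submodule_tensor_ker
  obtain h where h: "h \<in> linear_maps K tensor_free B" "\<And>x. x \<in> tensor_index \<Longrightarrow> h (free_gen K x) = \<phi> x"
    using free_module_lift[OF B, of tensor_index \<phi>] multilinear_mapsD(1)[OF \<phi>] by blast
  let ?Z = "{w \<in> carrier tensor_free. h w = \<zero>\<^bsub>B\<^esub>}"
  have Z: "submodule ?Z K tensor_free"
    by (rule submodule_equalizer[OF F.module_axioms B h(1) linear_maps_const_zero[OF B]])
  have diff: "h (v \<ominus>\<^bsub>tensor_free\<^esub> w) = \<zero>\<^bsub>B\<^esub>"
    if "v \<in> carrier tensor_free" "w \<in> carrier tensor_free" "h v = h w" for v w
  proof -
    have "v = (v \<ominus>\<^bsub>tensor_free\<^esub> w) \<oplus>\<^bsub>tensor_free\<^esub> w"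
      using that by (simp add: a_minus_def F.M.a_assoc F.M.l_neg)
    then have "h v = h (v \<ominus>\<^bsub>tensor_free\<^esub> w) \<oplus>\<^bsub>B\<^esub> h w"
      using linear_mapsD(2)[OF h(1), of "v \<ominus>\<^bsub>tensor_free\<^esub> w" w] that by simp
    then show ?thesis
      using that linear_mapsD(1)[OF h(1)] by (metis B.M.add.r_cancel_one' F.M.minus_closed)
  qed
  have "tensor_rels K I A \<subseteq> ?Z"
  proof
    fix w assume w: "w \<in> tensor_rels K I A"
    have wc: "w \<in> carrier tensor_free" using w tensor_rels_closed by blast
    from w consider
      (add) x i a b where "x \<in> tensor_index" "i \<in> I" "a \<in> carrier (A i)" "b \<in> carrier (A i)"
        "w = free_gen K (x(i := a \<oplus>\<^bsub>A i\<^esub> b)) \<ominus>\<^bsub>tensor_free\<^esub>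
          (free_gen K (x(i := a)) \<oplus>\<^bsub>tensor_free\<^esub> free_gen K (x(i := b)))"
      | (smult) x i a r where "x \<in> tensor_index" "i \<in> I" "a \<in> carrier (A i)" "r \<in> carrier K"
        "w = free_gen K (x(i := r \<odot>\<^bsub>A i\<^esub> a)) \<ominus>\<^bsub>tensor_free\<^esub>
          (r \<odot>\<^bsub>tensor_free\<^esub> free_gen K (x(i := a)))"
      unfolding tensor_rels_def Let_def by blast
    then have "h w = \<zero>\<^bsub>B\<^esub>"
    proof cases
      case add
      interpret Ai: module K "A i" by (rule A) fact
      have l: "(\<lambda>a. \<phi> (x(i := a))) \<in> linear_maps K (A i) B"
        using multilinear_mapsD(2)[OF \<phi>] add by blast
      note c = tensor_upd_closed[OF add(1,2)] and u = fun_upd_PiE[OF add(1,2)]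
      show ?thesis
        unfolding add(5) using add(3,4) c u linear_mapsD(2)[OF l] linear_mapsD(2)[OF h(1)]
        by (intro diff) (auto simp: h(2))
    next
      case smult
      interpret Ai: module K "A i" by (rule A) fact
      have l: "(\<lambda>a. \<phi> (x(i := a))) \<in> linear_maps K (A i) B"
        using multilinear_mapsD(2)[OF \<phi>] smult by blast
      note c = tensor_upd_closed[OF smult(1,2)] and u = fun_upd_PiE[OF smult(1,2)]
      show ?thesis
        unfolding smult(5) using smult(3,4) c u linear_mapsD(3)[OF l] linear_mapsD(3)[OF h(1)]
        by (intro diff) (auto simp: h(2))
    qed
    then show "w \<in> ?Z" using wc by simp
  qed
  then have "\<And>s. s \<in> tensor_ker K I A \<Longrightarrow> h s = \<zero>\<^bsub>B\<^esub>"
    using Z by (auto simp: tensor_ker_def)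
  then obtain k where "k \<in> linear_maps K (quot_module tensor_free (tensor_ker K I A)) B"
    "\<And>w. w \<in> carrier tensor_free \<Longrightarrow> k (tensor_ker K I A +>\<^bsub>tensor_free\<^esub> w) = h w"
    using quot_module_lift[OF S B h(1)] by blast
  then show ?thesis
    unfolding tensor_def pure_tensor_def using h(2)
    by (intro bexI[of _ k]) (auto simp: free_gen_closed[OF K])
qed

text \<open>Pure tensors of arbitrary elements span, being the images of the free generators. Those
  with entries in the sets \<open>G i\<close> reach all pure tensors one slot at a time by
  \<open>PiE_spans_induct\<close>.\<close>

lemma spans_tensor:
  assumes "finite I" "\<And>i. i \<in> I \<Longrightarrow> spans K (A i) (G i)"
  shows "spans K (tensor K I A) (pure_tensor K I A ` (\<Pi>\<^sub>E i\<in>I. G i))"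
  unfolding spans_def
proof (intro conjI allI impI)
  note S = F.module_axioms submodule_tensor_ker
  note p = pure_tensor_multilinear
  have "(\<Pi>\<^sub>E i\<in>I. G i) \<subseteq> tensor_index" using spansD[OF assms(2)] by (auto simp: PiE_iff)
  then show "pure_tensor K I A ` (\<Pi>\<^sub>E i\<in>I. G i) \<subseteq> carrier (tensor K I A)"
    using multilinear_mapsD(1)[OF p] by auto
  fix T assume T: "submodule T K (tensor K I A)" "pure_tensor K I A ` (\<Pi>\<^sub>E i\<in>I. G i) \<subseteq> T"
  have "pure_tensor K I A x \<in> T" if "x \<in> tensor_index" for x
  proof (rule PiE_spans_induct[OF assms _ _ that])
    fix x i assume x: "x \<in> tensor_index" "i \<in> I"
    show "submodule {a \<in> carrier (A i). pure_tensor K I A (x(i := a)) \<in> T} K (A i)"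
      by (rule submodule_vimage[OF A[OF x(2)] module_tensor multilinear_mapsD(2)[OF p x] T(1)])
  qed (use T(2) in auto)
  moreover have "spans K (tensor K I A)
      ((\<lambda>w. tensor_ker K I A +>\<^bsub>tensor_free\<^esub> w) ` (free_gen K ` tensor_index))"
    unfolding tensor_def
    by (intro spans_linear_image[OF F.module_axioms module_quot_module[OF S] quot_module_proj[OF S]]
        spans_free_gen K quot_module_carrier[OF S, symmetric])
  ultimately show "carrier (tensor K I A) \<subseteq> T"
    using T(1) by (auto simp: spans_def image_image pure_tensor_def)
qed

end

section \<open>Finite direct sums\<close>

definition sum_inj :: "'i set \<Rightarrow> ('i \<Rightarrow> ('r, 'a) module) \<Rightarrow> 'i \<Rightarrow> 'a \<Rightarrow> 'i \<Rightarrow> 'a"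
  where "sum_inj I A i a = (\<lambda>j\<in>I. if j = i then a else \<zero>\<^bsub>A j\<^esub>)"

lemma finite_direct_sum_simps:
  "carrier (finite_direct_sum I A) = (\<Pi>\<^sub>E i\<in>I. carrier (A i))"
  "\<zero>\<^bsub>finite_direct_sum I A\<^esub> = (\<lambda>i\<in>I. \<zero>\<^bsub>A i\<^esub>)"
  "x \<oplus>\<^bsub>finite_direct_sum I A\<^esub> y = (\<lambda>i\<in>I. x i \<oplus>\<^bsub>A i\<^esub> y i)"
  "r \<odot>\<^bsub>finite_direct_sum I A\<^esub> x = (\<lambda>i\<in>I. r \<odot>\<^bsub>A i\<^esub> x i)"
  by (simp_all add: finite_direct_sum_def)

context
  fixes K :: "('r, 'k) ring_scheme" and I :: "'i set" and A :: "'i \<Rightarrow> ('r, 'a) module"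
  assumes K: "cring K" and A: "\<And>i. i \<in> I \<Longrightarrow> module K (A i)"
begin

lemma module_finite_direct_sum: "module K (finite_direct_sum I A)"
proof -
  interpret K: cring K by (rule K)
  have g: "abelian_group (A i)" if "i \<in> I" for i using A[OF that] by (simp add: module_def)
  note ag = abelian_groupE[OF g]
  show ?thesis
  proof (rule moduleI)
    show "abelian_group (finite_direct_sum I A)"
    proof (rule abelian_groupI)
      fix x assume x: "x \<in> carrier (finite_direct_sum I A)"
      have "\<forall>i\<in>I. \<exists>y\<in>carrier (A i). y \<oplus>\<^bsub>A i\<^esub> x i = \<zero>\<^bsub>A i\<^esub>"
        using ag(6) x by (auto simp: finite_direct_sum_simps)
      then obtain y where "\<forall>i\<in>I. y i \<in> carrier (A i) \<and> y i \<oplus>\<^bsub>A i\<^esub> x i = \<zero>\<^bsub>A i\<^esub>" by metis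
      then show "\<exists>y\<in>carrier (finite_direct_sum I A).
          y \<oplus>\<^bsub>finite_direct_sum I A\<^esub> x = \<zero>\<^bsub>finite_direct_sum I A\<^esub>"
        by (intro bexI[of _ "restrict y I"]) (auto simp: finite_direct_sum_simps fun_eq_iff)
    next
      fix x y assume "x \<in> carrier (finite_direct_sum I A)" "y \<in> carrier (finite_direct_sum I A)"
      then show "x \<oplus>\<^bsub>finite_direct_sum I A\<^esub> y = y \<oplus>\<^bsub>finite_direct_sum I A\<^esub> x"
        using ag(4) by (auto simp: finite_direct_sum_simps fun_eq_iff PiE_iff)
    qed (auto simp: finite_direct_sum_simps fun_eq_iff ag(1,2,3,5) PiE_iff extensional_def)
  qed (auto simp: finite_direct_sum_simps fun_eq_iff PiE_iff extensional_def K
        module.smult_closed[OF A] module.smult_l_distr[OF A] module.smult_r_distr[OF A]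
        module.smult_assoc1[OF A] module.smult_one[OF A])
qed

lemma sum_inj_linear:
  assumes "i \<in> I"
  shows "sum_inj I A i \<in> linear_maps K (A i) (finite_direct_sum I A)"
proof -
  have g: "abelian_group (A i)" if "i \<in> I" for i using A[OF that] by (simp add: module_def)
  note ag = abelian_groupE[OF g]
  show ?thesis
    using assms by (intro linear_mapsI)
      (auto simp: sum_inj_def finite_direct_sum_simps fun_eq_iff ag module.smult_r_null[OF A])
qed

lemma finite_direct_sum_lift:
  assumes "finite I" "module K B" and h: "\<And>i. i \<in> I \<Longrightarrow> h i \<in> linear_maps K (A i) B"
  shows "\<exists>k\<in>linear_maps K (finite_direct_sum I A) B.
    \<forall>i\<in>I. \<forall>a\<in>carrier (A i). k (sum_inj I A i a) = h i a"
proof -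
  interpret B: module K B by fact
  note hD = linear_mapsD[OF h]
  let ?k = "\<lambda>z. finsum B (\<lambda>i. h i (z i)) I"
  have "?k \<in> linear_maps K (finite_direct_sum I A) B"
  proof (rule linear_mapsI)
    fix x y assume xy: "x \<in> carrier (finite_direct_sum I A)" "y \<in> carrier (finite_direct_sum I A)"
    have "?k (x \<oplus>\<^bsub>finite_direct_sum I A\<^esub> y) = finsum B (\<lambda>i. h i (x i) \<oplus>\<^bsub>B\<^esub> h i (y i)) I"
      using xy hD by (intro B.M.finsum_cong') (auto simp: finite_direct_sum_simps PiE_iff)
    then show "?k (x \<oplus>\<^bsub>finite_direct_sum I A\<^esub> y) = ?k x \<oplus>\<^bsub>B\<^esub> ?k y"
      using xy hD(1) by (simp add: finite_direct_sum_simps PiE_iff B.M.finsum_addf Pi_def)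
  next
    fix r x assume rx: "r \<in> carrier K" "x \<in> carrier (finite_direct_sum I A)"
    have "?k (r \<odot>\<^bsub>finite_direct_sum I A\<^esub> x) = finsum B (\<lambda>i. r \<odot>\<^bsub>B\<^esub> h i (x i)) I"
      using rx hD by (intro B.M.finsum_cong') (auto simp: finite_direct_sum_simps PiE_iff)
    then show "?k (r \<odot>\<^bsub>finite_direct_sum I A\<^esub> x) = r \<odot>\<^bsub>B\<^esub> ?k x"
      using rx hD(1) assms(1)
      by (simp add: finite_direct_sum_simps PiE_iff B.finsum_smult_ldistr Pi_def)
  qed (use hD(1) in \<open>auto simp: finite_direct_sum_simps intro!: B.M.finsum_closed\<close>)
  moreover have "?k (sum_inj I A i a) = h i a" if i: "i \<in> I" and a: "a \<in> carrier (A i)" for i a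
  proof -
    have "?k (sum_inj I A i a) = finsum B (\<lambda>j. if i = j then h j a else \<zero>\<^bsub>B\<^esub>) I"
      using i a hD(1) linear_maps_zero[OF A assms(2) h]
      by (intro B.M.finsum_cong') (auto simp: sum_inj_def)
    also have "\<dots> = h i a"
      using B.M.add.finprod_singleton[OF i assms(1), of "\<lambda>j. if i = j then h j a else \<zero>\<^bsub>B\<^esub>"]
        i a hD(1) by (simp add: Pi_def cong: if_cong)
    finally show ?thesis .
  qed
  ultimately show ?thesis by (intro bexI[of _ ?k]) auto
qed

lemma spans_finite_direct_sum:
  assumes "finite I" and G: "\<And>i. i \<in> I \<Longrightarrow> spans K (A i) (G i)"
  shows "spans K (finite_direct_sum I A) (\<Union>i\<in>I. sum_inj I A i ` G i)"
  unfolding spans_def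
proof (intro conjI allI impI)
  have g: "abelian_group (A i)" if "i \<in> I" for i using A[OF that] by (simp add: module_def)
  note ag = abelian_groupE[OF g]
  note inj = sum_inj_linear
  show "(\<Union>i\<in>I. sum_inj I A i ` G i) \<subseteq> carrier (finite_direct_sum I A)"
    using linear_mapsD(1)[OF inj] spansD[OF G] by blast
  fix T assume T: "submodule T K (finite_direct_sum I A)" "(\<Union>i\<in>I. sum_inj I A i ` G i) \<subseteq> T"
  note TD = submoduleD[OF module_finite_direct_sum T(1)]
  have 1: "sum_inj I A i a \<in> T" if "i \<in> I" "a \<in> carrier (A i)" for i a
    using G[OF that(1)] submodule_vimage[OF A[OF that(1)] module_finite_direct_sum inj T(1)] _ that(2)
    by (rule spans_induct) (use that T(2) in auto)
  \<comment> \<open>Induction on a set \<open>J\<close> of coordinates outside which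
    \<open>z\<close> vanishes; clearing coordinate \<open>j\<close> splits off the element
    \<open>sum_inj I A j (z j)\<close>.\<close>
  have "z \<in> T" if "finite J" "J \<subseteq> I" "z \<in> carrier (finite_direct_sum I A)"
    "\<forall>i\<in>I - J. z i = \<zero>\<^bsub>A i\<^esub>" for J z
    using that
  proof (induction J arbitrary: z rule: finite_induct)
    case empty
    then have "z = \<zero>\<^bsub>finite_direct_sum I A\<^esub>"
      by (auto simp: finite_direct_sum_simps fun_eq_iff PiE_iff extensional_def)
    then show ?case using TD(2) by simp
  next
    case (insert j J)
    have j: "j \<in> I" "z j \<in> carrier (A j)" using insert.prems by (auto simp: finite_direct_sum_simps)
    have "z(j := \<zero>\<^bsub>A j\<^esub>) \<in> carrier (finite_direct_sum I A)"
      using insert.prems j ag(2) unfolding finite_direct_sum_simps by (intro fun_upd_PiE) auto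
    moreover have "\<forall>i\<in>I - J. (z(j := \<zero>\<^bsub>A j\<^esub>)) i = \<zero>\<^bsub>A i\<^esub>" using insert.prems by auto
    ultimately have "z(j := \<zero>\<^bsub>A j\<^esub>) \<in> T" using insert.prems by (intro insert.IH) blast+
    then have "sum_inj I A j (z j) \<oplus>\<^bsub>finite_direct_sum I A\<^esub> z(j := \<zero>\<^bsub>A j\<^esub>) \<in> T"
      using TD(3) 1 j by blast
    also have "sum_inj I A j (z j) \<oplus>\<^bsub>finite_direct_sum I A\<^esub> z(j := \<zero>\<^bsub>A j\<^esub>) = z"
    proof
      fix i
      have "z j \<oplus>\<^bsub>A j\<^esub> \<zero>\<^bsub>A j\<^esub> = z j" using j ag(2,4,5) by metis
      moreover have "\<zero>\<^bsub>A i\<^esub> \<oplus>\<^bsub>A i\<^esub> z i = z i" if "i \<in> I"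
        using that ag(5) insert.prems(2) by (auto simp: finite_direct_sum_simps)
      ultimately show "(sum_inj I A j (z j) \<oplus>\<^bsub>finite_direct_sum I A\<^esub> z(j := \<zero>\<^bsub>A j\<^esub>)) i = z i"
        using insert.prems(2) j
        by (auto simp: sum_inj_def finite_direct_sum_simps PiE_iff extensional_def)
    qed
    finally show ?case .
  qed
  from this[OF assms(1) subset_refl] show "carrier (finite_direct_sum I A) \<subseteq> T" by auto
qed

end

section \<open>Surjective maps and substitution\<close>

lemma SurjE:
  assumes "t \<in> Surj n"
  obtains k where "t \<in> extensional {1..n}" "t ` {1..n} = {1..k}"
  using assms by (auto simp: Surj_def Sur_def PiE_def)

lemma SurjI:
  assumes "t \<in> extensional {1..n}" "t ` {1..n} = {1..k}"
  shows "t \<in> Surj n"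
proof -
  have "t \<in> Sur n k" using assms unfolding Sur_def PiE_def by blast
  then show ?thesis by (auto simp: Surj_def)
qed

text \<open>A surjection onto \<open>{1..k}\<close> forces \<open>k \<le> n\<close>, so
  \<open>Surj n\<close> sits in the finite set of self-maps of \<open>{1..n}\<close>. This is what
  lets \<open>finite_direct_sum\<close>, a product, stand for the direct sum.\<close>

lemma finite_Surj: "finite (Surj n)"
proof -
  have "t \<in> {1..n} \<rightarrow>\<^sub>E {1..n}" if "t \<in> Surj n" for t
    using that
  proof (rule SurjE)
    fix k assume k: "t \<in> extensional {1..n}" "t ` {1..n} = {1..k}"
    have "k \<le> n" using card_image_le[of "{1..n}" t] k by simp
    then have "t ` {1..n} \<subseteq> {1..n}" using k by auto
    then show ?thesis using k(1) by (simp add: PiE_def image_subset_iff_funcset)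
  qed
  then show ?thesis by (meson finite_PiE finite_atLeastAtMost finite_subset subsetI)
qed

lemma finite_verts [simp]: "finite (verts n t)"
  by (simp add: verts_def)

lemma verts_Surj: "t \<in> Surj n \<Longrightarrow> verts n t = {1..card (verts n t)}"
  by (erule SurjE) (simp add: verts_def)

lemma in_verts: "a \<in> {1..n} \<Longrightarrow> t a \<in> verts n t"
  by (simp add: verts_def)

text \<open>Vertices lie in the image, so their fibres are nonempty. The arity of a vertex is
  therefore at least 2.\<close>

lemma inputs_pos: "v \<in> verts n t \<Longrightarrow> 1 \<le> inputs n t v"
  unfolding verts_def inputs_def by (auto simp: Suc_le_eq card_gt_0_iff)

section \<open>Positions of elements within their fibres\<close>

definition fibre_rank :: "(nat \<Rightarrow> nat) \<Rightarrow> nat \<Rightarrow> nat"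
  where "fibre_rank t a = card {c \<in> {1..a}. t c = t a}"

text \<open>Ranks increase strictly along the fibre and lie between 1 and its size, so counting
  forces them to exhaust the interval.\<close>

lemma bij_fibre_rank: "bij_betw (fibre_rank t) {a \<in> {1..n}. t a = v} {1..inputs n t v}"
proof -
  let ?F = "{a \<in> {1..n}. t a = v}"
  have less: "fibre_rank t a < fibre_rank t b" if "a \<in> ?F" "b \<in> ?F" "a < b" for a b
    unfolding fibre_rank_def
  proof (intro psubset_card_mono psubsetI)
    have "b \<in> {c \<in> {1..b}. t c = t b} - {c \<in> {1..a}. t c = t a}" using that by auto
    then show "{c \<in> {1..a}. t c = t a} \<noteq> {c \<in> {1..b}. t c = t b}" by blast
  qed (use that in auto)
  have inj: "inj_on (fibre_rank t) ?F"
    by (rule linorder_inj_onI') (rule less_imp_neq[OF less])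
  have "fibre_rank t a \<in> {1..inputs n t v}" if "a \<in> ?F" for a
  proof -
    have "a \<in> {c \<in> {1..a}. t c = t a}" using that by auto
    then have "1 \<le> fibre_rank t a" by (auto simp: fibre_rank_def Suc_le_eq card_gt_0_iff)
    moreover have "fibre_rank t a \<le> inputs n t v"
      unfolding fibre_rank_def inputs_def using that by (intro card_mono) auto
    ultimately show ?thesis by simp
  qed
  then have "fibre_rank t ` ?F = {1..inputs n t v}"
    using card_image[OF inj] by (intro card_subset_eq) (auto simp: inputs_def)
  with inj show ?thesis by (simp add: bij_betw_def)
qed

lemma fibre_rank_mem: "a \<in> {1..n} \<Longrightarrow> fibre_rank t a \<in> {1..inputs n t (t a)}"
  using bij_betwE[OF bij_fibre_rank[of t n "t a"]] by blast

section \<open>Numbering in consecutive blocks of sizes \<open>m 1\<close>, \<open>m 2\<close>,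
  ..\<close>

definition offset :: "(nat \<Rightarrow> nat) \<Rightarrow> nat \<Rightarrow> nat"
  where "offset m j = (\<Sum>i\<in>{1..<j}. m i)"

lemma offset_Suc: "1 \<le> j \<Longrightarrow> offset m (Suc j) = offset m j + m j"
  by (simp add: offset_def)

lemma offset_mono: "i \<le> j \<Longrightarrow> offset m i \<le> offset m j"
  unfolding offset_def by (intro sum_mono2) auto

text \<open>This evaluates the \<open>LEAST\<close> in \<open>subst_deco\<close>: partial sums that
  stop before block \<open>j\<close> do not exceed \<open>offset m j\<close>, and \<open>i\<close>
  is positive, so \<open>j\<close> is the first block whose end is not before the given
  number.\<close>

lemma offset_block:
  assumes "1 \<le> j" "1 \<le> i" "i \<le> m j"
  shows "(LEAST j'. offset m j + i \<le> (\<Sum>i\<in>{1..j'}. m i)) = j"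
proof (rule Least_equality)
  have S: "(\<Sum>i\<in>{1..j'}. m i) = offset m (Suc j')" for j'
    by (simp add: offset_def atLeastLessThanSuc_atLeastAtMost)
  show "offset m j + i \<le> (\<Sum>i\<in>{1..j}. m i)"
    unfolding S using assms by (simp add: offset_Suc)
  fix j' assume "offset m j + i \<le> (\<Sum>i\<in>{1..j'}. m i)"
  then have "offset m j < offset m (Suc j')" unfolding S using assms(2) by simp
  then show "j \<le> j'"
    using offset_mono[of "Suc j'" j m] by (meson not_less not_less_eq_eq)
qed

lemma offset_inj:
  assumes "1 \<le> j" "1 \<le> i" "i \<le> m j" "1 \<le> j'" "1 \<le> i'" "i' \<le> m j'"
    and "offset m j + i = offset m j' + i'"
  shows "j = j'" "i = i'"
proof -
  show "j = j'" using offset_block[of j i m] offset_block[of j' i' m] assms by simp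
  then show "i = i'" using assms by simp
qed

lemma sum_blocks:
  assumes "1 \<le> j"
  shows "(\<Sum>p\<in>{1..<Suc (offset m j)}. g p) =
    (\<Sum>j'\<in>{1..<j}. \<Sum>i\<in>{1..<Suc (m j')}. g (offset m j' + i))"
  using assms
proof (induction j rule: dec_induct)
  case base
  then show ?case by (simp add: offset_def)
next
  case (step j)
  have "(\<Sum>p\<in>{1..<Suc (offset m (Suc j))}. g p) =
      (\<Sum>p\<in>{1..<Suc (offset m j)}. g p) + (\<Sum>p\<in>{Suc (offset m j)..<Suc (offset m j + m j)}. g p)"
    using step by (subst sum.atLeastLessThan_concat) (auto simp: offset_Suc)
  also have "(\<Sum>p\<in>{Suc (offset m j)..<Suc (offset m j + m j)}. g p) =
      (\<Sum>i\<in>{1..<Suc (m j)}. g (offset m j + i))"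
    using sum.shift_bounds_nat_ivl[of g 1 "offset m j" "Suc (m j)"] by (simp add: add.commute)
  finally show ?case using step by simp
qed

text \<open>Two-level numbering: what precedes position \<open>i\<close> of the coarse block
  \<open>j\<close> consists of the complete coarse blocks before \<open>j\<close> and the first
  \<open>i - 1\<close> entries of block \<open>j\<close>. With \<open>g\<close> counting the
  vertices on a third level, this is the arithmetic behind associativity.\<close>

lemma offset_offset:
  assumes "1 \<le> j" "1 \<le> i"
  shows "offset g (offset m j + i) =
    offset (\<lambda>j. offset (\<lambda>i. g (offset m j + i)) (Suc (m j))) j + offset (\<lambda>i. g (offset m j + i)) i"
proof -
  have "offset g (offset m j + i) = (\<Sum>p\<in>{1..<Suc (offset m j)}. g p) +
      (\<Sum>p\<in>{Suc (offset m j)..<offset m j + i}. g p)"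
    unfolding offset_def[of g] using assms by (subst sum.atLeastLessThan_concat) auto
  also have "(\<Sum>p\<in>{Suc (offset m j)..<offset m j + i}. g p) = (\<Sum>i\<in>{1..<i}. g (offset m j + i))"
    using sum.shift_bounds_nat_ivl[of g 1 "offset m j" i] by (simp add: add.commute)
  finally show ?thesis
    unfolding sum_blocks[OF assms(1)]
    by (simp add: offset_def[of _ i] offset_def[of _ j] offset_def[of _ "Suc _"] del: sum.op_ivl_Suc)
qed

text \<open>Consecutive blocks tile an initial segment; this makes a substitution surjective onto
  some \<open>{1..k}\<close>.\<close>

lemma blocks_cover: "(\<Union>j\<in>{1..k}. (\<lambda>i. offset m j + i) ` {1..m j}) = {1..offset m (Suc k)}"
proof (induction k)
  case 0
  then show ?case by (simp add: offset_def)
next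
  case (Suc k)
  have "{1..Suc k} = insert (Suc k) {1..k}" by auto
  then have "(\<Union>j\<in>{1..Suc k}. (\<lambda>i. offset m j + i) ` {1..m j}) =
      (\<lambda>i. offset m (Suc k) + i) ` {1..m (Suc k)} \<union> {1..offset m (Suc k)}"
    using Suc by simp
  also have "\<dots> = {1..offset m (Suc (Suc k))}"
    by (auto simp: offset_Suc image_add_atLeastAtMost)
  finally show ?case .
qed

section \<open>Substitution into one surjective map\<close>

locale substitution =
  fixes n :: nat and t :: "nat \<Rightarrow> nat" and s :: "nat \<Rightarrow> nat \<Rightarrow> nat"
  assumes t: "t \<in> Surj n" and s: "\<And>j. j \<in> verts n t \<Longrightarrow> s j \<in> Surj (inputs n t j)"
begin

abbreviation "u \<equiv> subst n t s"
abbreviation "m \<equiv> nverts n t s"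

lemma verts_t: "j \<in> verts n t \<longleftrightarrow> 1 \<le> j \<and> j \<le> card (verts n t)"
  using verts_Surj[OF t] by (metis atLeastAtMost_iff)

lemma verts_s: "j \<in> verts n t \<Longrightarrow> verts (inputs n t j) (s j) = {1..m j}"
  using verts_Surj[OF s] by (simp add: nverts_def)

lemma subst_apply: "a \<in> {1..n} \<Longrightarrow> u a = offset m (t a) + s (t a) (fibre_rank t a)"
  by (simp add: subst_def offset_def fibre_rank_def)

lemma inner_vertex: "a \<in> {1..n} \<Longrightarrow> s (t a) (fibre_rank t a) \<in> {1..m (t a)}"
  using verts_s[OF in_verts] in_verts[OF fibre_rank_mem] by blast

text \<open>The number \<open>offset m j + i\<close> determines the outer vertex \<open>j\<close>
  and the inner vertex \<open>i\<close>, since inner vertices range over \<open>{1..m j}\<close>.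
  The fibres of the substitution thereby become explicit.\<close>

lemma vertex_cases:
  assumes "j \<in> verts n t" "i \<in> verts (inputs n t j) (s j)" "a \<in> {1..n}"
  shows "u a = offset m j + i \<longleftrightarrow> t a = j \<and> s j (fibre_rank t a) = i"
proof
  assume "u a = offset m j + i"
  then have "offset m (t a) + s (t a) (fibre_rank t a) = offset m j + i"
    using subst_apply[OF assms(3)] by simp
  moreover have "1 \<le> t a" using in_verts[OF assms(3)] verts_t by blast
  moreover have "1 \<le> j" using assms(1) verts_t by blast
  moreover have "1 \<le> i" "i \<le> m j" using assms verts_s by auto
  ultimately show "t a = j \<and> s j (fibre_rank t a) = i"
    using offset_inj[of "t a" "s (t a) (fibre_rank t a)" m j i] inner_vertex[OF assms(3)] by auto
qed (use subst_apply assms in auto)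

lemma verts_subst: "verts n u = (\<Union>j\<in>verts n t. (\<lambda>i. offset m j + i) ` verts (inputs n t j) (s j))"
proof (intro equalityI subsetI)
  fix p assume "p \<in> verts n u"
  then obtain a where a: "a \<in> {1..n}" "p = u a" by (auto simp: verts_def)
  then show "p \<in> (\<Union>j\<in>verts n t. (\<lambda>i. offset m j + i) ` verts (inputs n t j) (s j))"
    using subst_apply[OF a(1)] in_verts[OF a(1)] in_verts[OF fibre_rank_mem[OF a(1)]] by blast
next
  fix p assume "p \<in> (\<Union>j\<in>verts n t. (\<lambda>i. offset m j + i) ` verts (inputs n t j) (s j))"
  then obtain j i where j: "j \<in> verts n t" "i \<in> verts (inputs n t j) (s j)" "p = offset m j + i"
    by blast
  then obtain b where b: "b \<in> {1..inputs n t j}" "i = s j b" by (auto simp: verts_def)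
  \<comment> \<open>The preimage of the vertex: the \<open>b\<close>-th element of the fibre of
    \<open>t\<close> over \<open>j\<close>.\<close>
  then obtain a where "a \<in> {1..n}" "t a = j" "b = fibre_rank t a"
    using bij_betw_imp_surj_on[OF bij_fibre_rank, of t n j] by blast
  then have "p = u a" using subst_apply j b by simp
  then show "p \<in> verts n u" using \<open>a \<in> {1..n}\<close> by (simp add: in_verts)
qed

lemma vertexE:
  assumes "p \<in> verts n u"
  obtains j i where "j \<in> verts n t" "i \<in> verts (inputs n t j) (s j)" "p = offset m j + i"
  using assms verts_subst by blast

lemma vertexI:
  "j \<in> verts n t \<Longrightarrow> i \<in> verts (inputs n t j) (s j) \<Longrightarrow> offset m j + i \<in> verts n u"
  using verts_subst by blast

lemma verts_subst_interval: "verts n u = {1..offset m (Suc (card (verts n t)))}"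
proof -
  have "verts n u = (\<Union>j\<in>{1..card (verts n t)}. (\<lambda>i. offset m j + i) ` {1..m j})"
    unfolding verts_subst using verts_s verts_Surj[OF t] by auto
  then show ?thesis by (simp only: blocks_cover)
qed

lemma subst_Surj: "u \<in> Surj n"
proof (rule SurjI)
  show "u \<in> extensional {1..n}" by (simp add: subst_def)
  show "u ` {1..n} = {1..offset m (Suc (card (verts n t)))}"
    using verts_subst_interval by (simp add: verts_def)
qed

lemma subst_deco_vertex:
  assumes "j \<in> verts n t" "i \<in> verts (inputs n t j) (s j)"
  shows "subst_deco n t s x (offset m j + i) = x j i"
proof -
  have "1 \<le> j" "1 \<le> i" "i \<le> m j" using assms verts_t verts_s by auto
  then have L: "(LEAST j'. offset m j + i \<le> (\<Sum>i\<in>{1..j'}. m i)) = j" by (rule offset_block)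
  have "subst_deco n t s x (offset m j + i) =
      (let j' = LEAST j'. offset m j + i \<le> (\<Sum>i\<in>{1..j'}. m i) in x j' (offset m j + i - offset m j'))"
    using vertexI[OF assms] by (simp add: subst_deco_def offset_def)
  then show ?thesis by (simp only: L Let_def diff_add_inverse)
qed

lemma subst_deco_ext: "subst_deco n t s x \<in> extensional (verts n u)"
  by (simp add: subst_deco_def)

text \<open>\<open>fibre_rank t\<close> carries the fibre of \<open>u\<close> over the vertex
  bijectively to the fibre of \<open>s j\<close> over \<open>i\<close>. Inner vertices thus keep
  their arity, and decorations can be transported unchanged.\<close>

lemma inputs_subst:
  assumes "j \<in> verts n t" "i \<in> verts (inputs n t j) (s j)"
  shows "inputs n u (offset m j + i) = inputs (inputs n t j) (s j) i"
proof -
  have "bij_betw (fibre_rank t) {a \<in> {1..n}. t a = j \<and> s j (fibre_rank t a) = i}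
      {b \<in> {1..inputs n t j}. s j b = i}"
  proof -
    note B = bij_fibre_rank[of t n j]
    have "fibre_rank t ` {a \<in> {1..n}. t a = j \<and> s j (fibre_rank t a) = i} =
        {b \<in> fibre_rank t ` {a \<in> {1..n}. t a = j}. s j b = i}" by blast
    moreover have "inj_on (fibre_rank t) {a \<in> {1..n}. t a = j \<and> s j (fibre_rank t a) = i}"
      by (rule inj_on_subset[OF bij_betw_imp_inj_on[OF B]]) blast
    ultimately show ?thesis using bij_betw_imp_surj_on[OF B] by (simp add: bij_betw_def)
  qed
  moreover have "{a \<in> {1..n}. u a = offset m j + i} =
      {a \<in> {1..n}. t a = j \<and> s j (fibre_rank t a) = i}"
    using vertex_cases[OF assms] by blast
  ultimately show ?thesis by (simp add: inputs_def bij_betw_same_card)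
qed

lemma fibre_rank_subst:
  assumes a: "a \<in> {1..n}"
  shows "fibre_rank u a = fibre_rank (s (t a)) (fibre_rank t a)"
proof -
  let ?j = "t a" let ?b = "fibre_rank t a"
  have j: "?j \<in> verts n t" "s ?j ?b \<in> verts (inputs n t ?j) (s ?j)"
    using in_verts[OF a] in_verts[OF fibre_rank_mem[OF a]] by auto
  \<comment> \<open>Ranks count elements up to \<open>a\<close>, so \<open>bij_fibre_rank\<close> is
    used with \<open>a\<close> in place of \<open>n\<close>; the number of inputs of
    \<open>t a\<close> within \<open>{1..a}\<close> is by definition the rank of
    \<open>a\<close>.\<close>
  have B: "bij_betw (fibre_rank t) {c \<in> {1..a}. t c = ?j} {1..?b}"
    using bij_fibre_rank[of t a ?j] by (simp add: inputs_def fibre_rank_def)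
  have "fibre_rank t ` {c \<in> {1..a}. t c = ?j \<and> s ?j (fibre_rank t c) = s ?j ?b} =
      {b \<in> fibre_rank t ` {c \<in> {1..a}. t c = ?j}. s ?j b = s ?j ?b}" by blast
  moreover have "inj_on (fibre_rank t) {c \<in> {1..a}. t c = ?j \<and> s ?j (fibre_rank t c) = s ?j ?b}"
    by (rule inj_on_subset[OF bij_betw_imp_inj_on[OF B]]) blast
  ultimately have "bij_betw (fibre_rank t)
      {c \<in> {1..a}. t c = ?j \<and> s ?j (fibre_rank t c) = s ?j ?b} {b \<in> {1..?b}. s ?j b = s ?j ?b}"
    using bij_betw_imp_surj_on[OF B] by (simp add: bij_betw_def)
  moreover have "{c \<in> {1..a}. u c = u a} = {c \<in> {1..a}. t c = ?j \<and> s ?j (fibre_rank t c) = s ?j ?b}"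
    unfolding subst_apply[OF a] using vertex_cases[OF j] a by (intro Collect_cong) auto
  ultimately show ?thesis by (simp add: fibre_rank_def[of u] fibre_rank_def[of "s (t a)"] bij_betw_same_card)
qed

lemma subst_deco_decorations:
  assumes "\<And>j. j \<in> verts n t \<Longrightarrow> x j \<in> decorations M (inputs n t j) (s j)"
  shows "subst_deco n t s x \<in> decorations M n u"
proof -
  have "subst_deco n t s x p \<in> carrier (M (arity n u p))" if "p \<in> verts n u" for p
    using that
  proof (rule vertexE)
    fix j i assume ji: "j \<in> verts n t" "i \<in> verts (inputs n t j) (s j)" "p = offset m j + i"
    then show ?thesis
      using assms[OF ji(1)] by (auto simp: subst_deco_vertex arity_def inputs_subst decorations_def)
  qed
  then show ?thesis using subst_deco_ext by (auto simp: decorations_def PiE_iff)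
qed

lemma subst_deco_eqI:
  assumes "y \<in> extensional (verts n u)"
    and "\<And>j i. j \<in> verts n t \<Longrightarrow> i \<in> verts (inputs n t j) (s j) \<Longrightarrow> y (offset m j + i) = x j i"
  shows "subst_deco n t s x = y"
proof (rule extensionalityI[OF subst_deco_ext assms(1)])
  fix p assume "p \<in> verts n u"
  then show "subst_deco n t s x p = y p"
    by (rule vertexE) (simp add: subst_deco_vertex assms(2))
qed

text \<open>Changing one decoration of one inner vertex changes exactly one slot of the result; this
  is how multilinearity of decorations passes through substitution.\<close>

lemma subst_deco_upd:
  assumes "j \<in> verts n t" "i \<in> verts (inputs n t j) (s j)"
  shows "subst_deco n t s (x(j := (x j)(i := a))) = (subst_deco n t s x)(offset m j + i := a)"
proof (rule subst_deco_eqI)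
  show "(subst_deco n t s x)(offset m j + i := a) \<in> extensional (verts n u)"
    using subst_deco_ext vertexI[OF assms] by (auto simp: extensional_def)
  fix j' i' assume j': "j' \<in> verts n t" "i' \<in> verts (inputs n t j') (s j')"
  have "offset m j' + i' = offset m j + i \<longleftrightarrow> j' = j \<and> i' = i"
    using offset_inj[of j' i' m j i] assms j' verts_t verts_s by auto
  then show "((subst_deco n t s x)(offset m j + i := a)) (offset m j' + i') =
      (x(j := (x j)(i := a))) j' i'"
    using subst_deco_vertex[OF j'] by auto
qed

text \<open>Only the values of \<open>s\<close> at vertices of \<open>t\<close> matter, so
  restricted families and plain lambda terms may be interchanged. Offsets are compared up to one
  past the last vertex, because \<open>offset m j\<close> sums over the indices below
  \<open>j\<close>.\<close>

lemma substitution_cong: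
  assumes "\<And>j. j \<in> verts n t \<Longrightarrow> s' j = s j"
  shows "j \<le> Suc (card (verts n t)) \<Longrightarrow> offset (nverts n t s') j = offset m j"
    and "subst n t s' = u"
    and "subst_deco n t s' x = subst_deco n t s x"
proof -
  show off: "offset (nverts n t s') j = offset m j" if "j \<le> Suc (card (verts n t))" for j
    unfolding offset_def using assms verts_t that by (intro sum.cong) (auto simp: nverts_def)
  interpret s': substitution n t s' using t s assms by unfold_locales simp_all
  show eq: "subst n t s' = u"
  proof (rule extensionalityI)
    fix a assume a: "a \<in> {1..n}"
    have "t a \<le> Suc (card (verts n t))" using in_verts[OF a, of t] verts_t[of "t a"] by simp
    then show "subst n t s' a = u a"
      using off assms in_verts[OF a] by (simp only: subst_apply[OF a] s'.subst_apply[OF a])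
  qed (simp_all add: subst_def)
  show "subst_deco n t s' x = subst_deco n t s x"
  proof (rule s'.subst_deco_eqI)
    show "subst_deco n t s x \<in> extensional (verts n (subst n t s'))"
      unfolding eq by (rule subst_deco_ext)
    fix j i assume ji: "j \<in> verts n t" "i \<in> verts (inputs n t j) (s' j)"
    have "offset (nverts n t s') j = offset m j" using off verts_t ji by auto
    then show "subst_deco n t s x (offset (nverts n t s') j + i) = x j i"
      using subst_deco_vertex ji assms by simp
  qed
qed

end

lemma subst_deco_cong:
  assumes "\<And>j i. j \<in> verts n t \<Longrightarrow> i \<in> verts (inputs n t j) (s j) \<Longrightarrow> x j i = y j i"
    and "t \<in> Surj n" "\<And>j. j \<in> verts n t \<Longrightarrow> s j \<in> Surj (inputs n t j)"
  shows "subst_deco n t s x = subst_deco n t s y"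
proof -
  interpret substitution n t s using assms(2,3) by unfold_locales
  show ?thesis
    by (rule subst_deco_eqI) (simp_all add: subst_deco_ext subst_deco_vertex assms(1))
qed

section \<open>Two successive substitutions and associativity\<close>

locale double_substitution = substitution +
  fixes r :: "nat \<Rightarrow> nat \<Rightarrow> nat \<Rightarrow> nat"
  assumes r: "\<And>j i. j \<in> verts n t \<Longrightarrow> i \<in> verts (inputs n t j) (s j) \<Longrightarrow>
    r j i \<in> Surj (inputs (inputs n t j) (s j) i)"
begin

lemma inner: "j \<in> verts n t \<Longrightarrow> substitution (inputs n t j) (s j) (r j)"
  using s r by unfold_locales

text \<open>The third level of surjective maps is itself a decoration of the inner vertices, so
  \<open>subst_deco\<close>, being polymorphic in the decorations, also renumbers \<open>r\<close>
  along the vertices of \<open>u\<close>.\<close>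

lemma outer: "substitution n u (subst_deco n t s r)"
proof
  show "u \<in> Surj n" by (rule subst_Surj)
  fix p assume "p \<in> verts n u"
  then show "subst_deco n t s r p \<in> Surj (inputs n u p)"
    by (rule vertexE) (simp add: subst_deco_vertex inputs_subst r)
qed

lemma assembled: "substitution n t (\<lambda>j. subst (inputs n t j) (s j) (r j))"
  using t substitution.subst_Surj[OF inner] by unfold_locales

lemma nverts_outer:
  assumes "j \<in> verts n t" "i \<in> verts (inputs n t j) (s j)"
  shows "nverts n u (subst_deco n t s r) (offset m j + i) = nverts (inputs n t j) (s j) (r j) i"
  using assms by (simp add: nverts_def inputs_subst subst_deco_vertex)

lemma nverts_assembled:
  assumes "j \<in> verts n t"
  shows "nverts n t (\<lambda>j. subst (inputs n t j) (s j) (r j)) j =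
    offset (nverts (inputs n t j) (s j) (r j)) (Suc (m j))"
  using substitution.verts_subst_interval[OF inner[OF assms]] by (simp add: nverts_def)

text \<open>An instance of \<open>offset_offset\<close>: complete blocks are counted by the
  assembled maps \<open>subst (inputs n t j) (s j) (r j)\<close>, the incomplete last one by
  \<open>r j\<close> alone.\<close>

lemma offset_outer:
  assumes ji: "j \<in> verts n t" "i \<in> verts (inputs n t j) (s j)"
  shows "offset (nverts n u (subst_deco n t s r)) (offset m j + i) =
    offset (nverts n t (\<lambda>j. subst (inputs n t j) (s j) (r j))) j +
    offset (nverts (inputs n t j) (s j) (r j)) i"
proof -
  let ?g = "nverts n u (subst_deco n t s r)"
  have j: "1 \<le> j" "1 \<le> i" "i \<le> m j" using ji verts_t verts_s by auto
  \<comment> \<open>The range of \<open>i'\<close> includes \<open>Suc (m j')\<close>: that value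
    gives the total of a complete block, smaller ones the part before a vertex.\<close>
  have 1: "offset (\<lambda>i. ?g (offset m j' + i)) i' = offset (nverts (inputs n t j') (s j') (r j')) i'"
    if "j' \<in> verts n t" "i' \<le> Suc (m j')" for j' i'
    unfolding offset_def[of _ i']
  proof (rule sum.cong)
    fix i assume "i \<in> {1..<i'}"
    then have "i \<in> verts (inputs n t j') (s j')" using that verts_s[OF that(1)] by simp
    then show "?g (offset m j' + i) = nverts (inputs n t j') (s j') (r j') i"
      by (rule nverts_outer[OF that(1)])
  qed simp
  have 2: "offset (\<lambda>j. offset (\<lambda>i. ?g (offset m j + i)) (Suc (m j))) j =
      offset (nverts n t (\<lambda>j. subst (inputs n t j) (s j) (r j))) j"
    unfolding offset_def[of _ j]
  proof (rule sum.cong)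
    fix j' assume "j' \<in> {1..<j}"
    then have "j' \<in> verts n t" using ji(1) unfolding verts_t by auto
    then show "offset (\<lambda>i. ?g (offset m j' + i)) (Suc (m j')) =
        nverts n t (\<lambda>j. subst (inputs n t j) (s j) (r j)) j'"
      using 1 nverts_assembled by simp
  qed simp
  show ?thesis
    using offset_offset[OF j(1,2), of ?g m] 1[OF ji(1), of i] j 2 by simp
qed

text \<open>Both sides send \<open>a\<close> to an offset plus a value of the same map
  \<open>r j i\<close>; \<open>fibre_rank_subst\<close> identifies the arguments and
  \<open>offset_outer\<close> the offsets.\<close>

lemma subst_assoc:
  "subst n u (subst_deco n t s r) = subst n t (\<lambda>j. subst (inputs n t j) (s j) (r j))"
proof (rule extensionalityI)
  fix a assume a: "a \<in> {1..n}"
  let ?j = "t a" let ?b = "fibre_rank t a" let ?i = "s (t a) (fibre_rank t a)"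
  have ji: "?j \<in> verts n t" "?i \<in> verts (inputs n t ?j) (s ?j)"
    using in_verts[OF a] in_verts[OF fibre_rank_mem[OF a]] by auto
  have "subst n u (subst_deco n t s r) a =
      offset (nverts n u (subst_deco n t s r)) (offset m ?j + ?i) + r ?j ?i (fibre_rank (s ?j) ?b)"
    using substitution.subst_apply[OF outer a] ji
    by (simp only: subst_apply[OF a] fibre_rank_subst[OF a] subst_deco_vertex)
  also have "\<dots> = offset (nverts n t (\<lambda>j. subst (inputs n t j) (s j) (r j))) ?j +
      subst (inputs n t ?j) (s ?j) (r ?j) ?b"
    using substitution.subst_apply[OF inner[OF ji(1)] fibre_rank_mem[OF a]] offset_outer[OF ji] by simp
  also have "\<dots> = subst n t (\<lambda>j. subst (inputs n t j) (s j) (r j)) a"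
    using substitution.subst_apply[OF assembled a] by simp
  finally show "subst n u (subst_deco n t s r) a = subst n t (\<lambda>j. subst (inputs n t j) (s j) (r j)) a" .
qed (simp_all add: subst_def)

text \<open>At the vertex addressed by \<open>j\<close>, \<open>i\<close> and \<open>l\<close> both
  sides read \<open>x j i l\<close>, and by \<open>offset_outer\<close> the two numberings give this
  address the same number.\<close>

lemma subst_deco_assoc:
  "subst_deco n u (subst_deco n t s r) (subst_deco n t s x) =
   subst_deco n t (\<lambda>j. subst (inputs n t j) (s j) (r j))
     (\<lambda>j. subst_deco (inputs n t j) (s j) (r j) (x j))"
proof (rule substitution.subst_deco_eqI[OF outer])
  show "subst_deco n t (\<lambda>j. subst (inputs n t j) (s j) (r j))
     (\<lambda>j. subst_deco (inputs n t j) (s j) (r j) (x j))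
     \<in> extensional (verts n (subst n u (subst_deco n t s r)))"
    unfolding subst_assoc by (rule substitution.subst_deco_ext[OF assembled])
  fix q l assume q: "q \<in> verts n u" and l: "l \<in> verts (inputs n u q) (subst_deco n t s r q)"
  obtain j i where ji: "j \<in> verts n t" "i \<in> verts (inputs n t j) (s j)" "q = offset m j + i"
    using q by (rule vertexE)
  have l': "l \<in> verts (inputs (inputs n t j) (s j) i) (r j i)"
    using l ji by (simp add: inputs_subst subst_deco_vertex)
  note I = inner[OF ji(1)]
  show "subst_deco n t (\<lambda>j. subst (inputs n t j) (s j) (r j))
     (\<lambda>j. subst_deco (inputs n t j) (s j) (r j) (x j))
     (offset (nverts n u (subst_deco n t s r)) q + l) = subst_deco n t s x q l"
    unfolding ji(3) offset_outer[OF ji(1,2)] add.assoc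
      substitution.subst_deco_vertex[OF assembled ji(1) substitution.vertexI[OF I ji(2) l']]
      substitution.subst_deco_vertex[OF I ji(2) l'] subst_deco_vertex[OF ji(1,2)] ..
qed

end

section \<open>Corollas as units for substitution\<close>

lemma corolla_simps [simp]:
  assumes "1 \<le> n"
  shows "corolla n \<in> Surj n" "verts n (corolla n) = {1}" "inputs n (corolla n) 1 = n"
    "inputs n (corolla n) (Suc 0) = n"
proof -
  have "corolla n ` {1..n} = {1..1}" using assms by (auto simp: corolla_def)
  then show "corolla n \<in> Surj n" by (intro SurjI) (auto simp: corolla_def)
  show "verts n (corolla n) = {1}" using assms by (auto simp: verts_def corolla_def)
  have "{a \<in> {1..n}. corolla n a = 1} = {1..n}" by (auto simp: corolla_def)
  then show "inputs n (corolla n) 1 = n" by (simp add: inputs_def)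
  then show "inputs n (corolla n) (Suc 0) = n" by simp
qed

text \<open>There is one block, with offset 0, and the only fibre is all of \<open>{1..n}\<close>,
  so ranks are the elements themselves.\<close>

lemma subst_corolla_left:
  assumes "1 \<le> n" "s 1 \<in> Surj n"
  shows "subst n (corolla n) s = s 1"
    and "x 1 \<in> extensional (verts n (s 1)) \<Longrightarrow> subst_deco n (corolla n) s x = x 1"
proof -
  interpret substitution n "corolla n" s using assms by unfold_locales auto
  have off: "offset m 1 = 0" by (simp add: offset_def)
  show eq: "u = s 1"
  proof (rule extensionalityI)
    show "s 1 \<in> extensional {1..n}" using assms(2) by (auto elim: SurjE)
    fix a assume a: "a \<in> {1..n}"
    then have "{c \<in> {1..a}. corolla n c = corolla n a} = {1..a}" by (auto simp: corolla_def)
    then have "fibre_rank (corolla n) a = a" by (simp add: fibre_rank_def)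
    moreover have "corolla n a = 1" using a by (simp add: corolla_def)
    ultimately show "u a = s 1 a" using subst_apply[OF a] off by simp
  qed (simp add: subst_def)
  show "subst_deco n (corolla n) s x = x 1" if "x 1 \<in> extensional (verts n (s 1))"
    by (rule subst_deco_eqI) (use that assms off in \<open>auto simp: eq\<close>)
qed

text \<open>Every block has size 1, so block \<open>j\<close> consists of the single number
  \<open>j\<close> and nothing is renumbered.\<close>

lemma subst_corolla_right:
  assumes t: "t \<in> Surj n"
  shows "subst n t (\<lambda>j. corolla (inputs n t j)) = t"
    and "x \<in> extensional (verts n t) \<Longrightarrow>
      subst_deco n t (\<lambda>j. corolla (inputs n t j)) (\<lambda>j. \<lambda>v\<in>{1}. x j) = x"
proof -
  interpret substitution n t "\<lambda>j. corolla (inputs n t j)"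
    using assms inputs_pos by unfold_locales auto
  have m: "m j = 1" if "j \<in> verts n t" for j using inputs_pos[OF that] by (simp add: nverts_def)
  have off: "offset m j + 1 = j" if "j \<in> verts n t" for j
  proof -
    have "offset m j = (\<Sum>i\<in>{1..<j}. 1)"
      unfolding offset_def using that m verts_t by (intro sum.cong) auto
    then show ?thesis using that verts_t by simp
  qed
  show eq: "u = t"
  proof (rule extensionalityI)
    show "t \<in> extensional {1..n}" using t by (auto elim: SurjE)
    fix a assume a: "a \<in> {1..n}"
    then have "corolla (inputs n t (t a)) (fibre_rank t a) = 1"
      using fibre_rank_mem[OF a, of t] by (simp add: corolla_def)
    then show "u a = t a" using subst_apply[OF a] off[OF in_verts[OF a]] by simp
  qed (simp add: subst_def)
  show "subst_deco n t (\<lambda>j. corolla (inputs n t j)) (\<lambda>j. \<lambda>v\<in>{1}. x j) = x"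
    if "x \<in> extensional (verts n t)"
  proof (rule subst_deco_eqI)
    fix j i assume j: "j \<in> verts n t" "i \<in> verts (inputs n t j) (corolla (inputs n t j))"
    then have "i = 1" using inputs_pos by auto
    then show "x (offset m j + i) = (\<lambda>v\<in>{1}. x j) i" using off[OF j(1)] by simp
  qed (use that in \<open>simp add: eq\<close>)
qed

lemma Surj_0 [simp]: "Surj 0 = {\<lambda>_. undefined}"
  by (auto simp: Surj_def Sur_def)

lemma verts_0 [simp]: "verts 0 t = {}"
  by (simp add: verts_def)

section \<open>The functor and the substitution transformation\<close>

text \<open>Needed for \<bbbP>(f), which applies linear maps vertex by vertex: an update in slot
  \<open>i\<close> remains an update in slot \<open>i\<close>.\<close>

lemma multilinear_maps_precomp:
  assumes \<phi>: "\<phi> \<in> multilinear_maps K I A B" and f: "\<And>i. i \<in> I \<Longrightarrow> f i \<in> linear_maps K (C i) (A i)"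
  shows "(\<lambda>x. \<phi> (\<lambda>i\<in>I. f i (x i))) \<in> multilinear_maps K I C B"
proof (rule multilinear_mapsI)
  fix x assume x: "x \<in> (\<Pi>\<^sub>E i\<in>I. carrier (C i))"
  then have fx: "(\<lambda>i\<in>I. f i (x i)) \<in> (\<Pi>\<^sub>E i\<in>I. carrier (A i))"
    using linear_mapsD(1)[OF f] by (auto simp: PiE_iff)
  then show "\<phi> (\<lambda>i\<in>I. f i (x i)) \<in> carrier B" by (rule multilinear_mapsD(1)[OF \<phi>])
  fix i assume i: "i \<in> I"
  have "(\<lambda>k\<in>I. f k ((x(i := a)) k)) = (\<lambda>k\<in>I. f k (x k))(i := f i a)" for a
    using i by (auto simp: fun_eq_iff)
  then show "(\<lambda>a. \<phi> (\<lambda>k\<in>I. f k ((x(i := a)) k))) \<in> linear_maps K (C i) B"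
    using linear_maps_comp[OF f[OF i] multilinear_mapsD(2)[OF \<phi> fx i]] by simp
qed

lemma restrict_linear_map:
  "module K A \<Longrightarrow> h \<in> linear_maps K A B \<Longrightarrow> restrict h (carrier A) \<in> linear_maps K A B"
  by (rule linear_maps_cong) auto

lemma graded_moduleD: "graded_module K M \<Longrightarrow> 1 \<le> a \<Longrightarrow> module K (M a)"
  by (simp add: graded_module_def)

lemma graded_homD: "graded_hom K M N f \<Longrightarrow> 1 \<le> a \<Longrightarrow> f a \<in> linear_maps K (M a) (N a)"
  by (simp add: graded_hom_def)

lemma graded_hom_comp:
  assumes "graded_hom K L M f" "graded_hom K M N g"
  shows "graded_hom K L N (g \<circ>\<^sub>g f)"
  using linear_maps_comp[OF graded_homD[OF assms(1)] graded_homD[OF assms(2)]]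
  by (simp add: graded_hom_def graded_comp_def comp_def)

lemma decorationsD: "x \<in> decorations M n t \<Longrightarrow> v \<in> verts n t \<Longrightarrow> x v \<in> carrier (M (arity n t v))"
  by (auto simp: decorations_def)

lemma decorations_ext: "x \<in> decorations M n t \<Longrightarrow> x \<in> extensional (verts n t)"
  by (auto simp: decorations_def PiE_iff)

lemma deco_restrict: "x \<in> decorations M n t \<Longrightarrow> deco K M n t (\<lambda>v\<in>verts n t. x v) = deco K M n t x"
  by (simp add: decorations_ext extensional_restrict)

section \<open>The module \<bbbP>(M): universal property and generators\<close>

locale graded =
  fixes K :: "('r, 'k) ring_scheme" and M :: "nat \<Rightarrow> ('r, 'm) module"
  assumes K: "cring K" and M: "graded_module K M"
begin

text \<open>Arities are successors, so the unspecified \<open>M 0\<close> is never reached.\<close>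

lemma module_arity: "module K (M (arity n t v))"
  by (rule graded_moduleD[OF M]) (simp add: arity_def)

lemma module_deco_module: "module K (deco_module K M n t)"
  unfolding deco_module_def by (rule module_tensor[OF K module_arity])

lemma module_Pobj: "module K (Pobj K M a)"
  unfolding Pobj_def by (rule module_finite_direct_sum[OF K module_deco_module])

lemma graded_Pobj: "graded_module K (Pobj K M)"
  by (simp add: graded_module_def module_Pobj)

lemma deco_sum_inj:
  "deco K M n t x = sum_inj (Surj n) (deco_module K M n) t
    (pure_tensor K (verts n t) (\<lambda>v. M (arity n t v)) x)"
  by (simp add: deco_def sum_inj_def)

lemma pure_tensor_multilinear_deco:
  "pure_tensor K (verts n t) (\<lambda>v. M (arity n t v)) \<in>
    multilinear_maps K (verts n t) (\<lambda>v. M (arity n t v)) (deco_module K M n t)"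
  unfolding deco_module_def by (rule pure_tensor_multilinear[OF K module_arity])

lemma deco_multilinear:
  assumes "t \<in> Surj n"
  shows "deco K M n t \<in> multilinear_maps K (verts n t) (\<lambda>v. M (arity n t v)) (Pobj K M (Suc n))"
proof -
  have "sum_inj (Surj n) (deco_module K M n) t \<in> linear_maps K (deco_module K M n t) (Pobj K M (Suc n))"
    using sum_inj_linear[of K "Surj n" "deco_module K M n", OF K module_deco_module assms]
    by (simp add: Pobj_def)
  from multilinear_maps_comp[OF pure_tensor_multilinear_deco this]
  show ?thesis by (simp add: deco_sum_inj[abs_def])
qed

lemma deco_closed:
  "t \<in> Surj n \<Longrightarrow> x \<in> decorations M n t \<Longrightarrow> deco K M n t x \<in> carrier (Pobj K M (Suc n))"
  using multilinear_mapsD(1)[OF deco_multilinear] by (simp add: decorations_def)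

lemma deco_closed_arity:
  "s \<in> Surj (inputs n t j) \<Longrightarrow> x \<in> decorations M (inputs n t j) s \<Longrightarrow>
    deco K M (inputs n t j) s x \<in> carrier (Pobj K M (arity n t j))"
  using deco_closed by (simp add: arity_def)

text \<open>The universal property of \<bbbP>(M), obtained summand by summand from the tensor
  products and glued by \<open>finite_direct_sum_lift\<close>.\<close>

lemma Pobj_lift:
  assumes B: "module K B"
    and \<phi>: "\<And>t. t \<in> Surj n \<Longrightarrow> \<phi> t \<in> multilinear_maps K (verts n t) (\<lambda>v. M (arity n t v)) B"
  shows "\<exists>h\<in>linear_maps K (Pobj K M (Suc n)) B.
    \<forall>t\<in>Surj n. \<forall>x\<in>decorations M n t. h (deco K M n t x) = \<phi> t x"
proof -
  have "\<forall>t\<in>Surj n. \<exists>h\<in>linear_maps K (deco_module K M n t) B. \<forall>x\<in>decorations M n t.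
      h (pure_tensor K (verts n t) (\<lambda>v. M (arity n t v)) x) = \<phi> t x"
    unfolding deco_module_def decorations_def using tensor_lift[OF K module_arity B \<phi>] by blast
  then obtain h where h: "\<And>t. t \<in> Surj n \<Longrightarrow> h t \<in> linear_maps K (deco_module K M n t) B"
    "\<And>t x. t \<in> Surj n \<Longrightarrow> x \<in> decorations M n t \<Longrightarrow>
      h t (pure_tensor K (verts n t) (\<lambda>v. M (arity n t v)) x) = \<phi> t x"
    by metis
  obtain k where k: "k \<in> linear_maps K (finite_direct_sum (Surj n) (deco_module K M n)) B"
    "\<And>t a. t \<in> Surj n \<Longrightarrow> a \<in> carrier (deco_module K M n t) \<Longrightarrow>
      k (sum_inj (Surj n) (deco_module K M n) t a) = h t a"
    using finite_direct_sum_lift[where h = h, OF K module_deco_module finite_Surj B h(1)] by blast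
  have p: "pure_tensor K (verts n t) (\<lambda>v. M (arity n t v)) x \<in> carrier (deco_module K M n t)"
    if "x \<in> decorations M n t" for t x
    using that by (intro multilinear_mapsD(1)[OF pure_tensor_multilinear_deco])
      (simp add: decorations_def)
  show ?thesis
    using k(1) by (intro bexI[of _ k]) (auto simp: deco_sum_inj k(2) p h(2) Pobj_def)
qed

text \<open>Generators are required only in arities from 2 on, as vertices have inputs. Taking
  generators of \<bbbP>(M) for \<open>G\<close> in turn gives nested generators for the iterates of
  \<bbbP>.\<close>

lemma spans_Pobj:
  assumes "\<And>a. 2 \<le> a \<Longrightarrow> spans K (M a) (G a)"
  shows "spans K (Pobj K M (Suc n))
    (\<Union>t\<in>Surj n. deco K M n t ` (\<Pi>\<^sub>E v\<in>verts n t. G (arity n t v)))"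
proof -
  have "spans K (deco_module K M n t) (pure_tensor K (verts n t) (\<lambda>v. M (arity n t v)) `
      (\<Pi>\<^sub>E v\<in>verts n t. G (arity n t v)))" for t
    unfolding deco_module_def using inputs_pos
    by (intro spans_tensor K module_arity finite_verts assms) (simp add: arity_def)
  from spans_finite_direct_sum[OF K module_deco_module finite_Surj this, of n]
  show ?thesis by (simp add: Pobj_def deco_sum_inj[abs_def] image_image)
qed

lemma Pobj_eqI:
  assumes "module K B" "h \<in> linear_maps K (Pobj K M (Suc n)) B" "k \<in> linear_maps K (Pobj K M (Suc n)) B"
    and eq: "\<And>t x. t \<in> Surj n \<Longrightarrow> x \<in> decorations M n t \<Longrightarrow> h (deco K M n t x) = k (deco K M n t x)"
    and "z \<in> carrier (Pobj K M (Suc n))"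
  shows "h z = k z"
  by (rule spans_eqI[OF module_Pobj assms(1) spans_Pobj[OF spans_carrier] assms(2,3) _ assms(5)])
    (use eq in \<open>auto simp: decorations_def\<close>)

interpretation P: graded K "Pobj K M"
  by (rule graded.intro[OF K graded_Pobj])

interpretation PP: graded K "Pobj K (Pobj K M)"
  by (rule graded.intro[OF K P.graded_Pobj])

lemma spans_Pobj_deco:
  "2 \<le> a \<Longrightarrow> spans K (Pobj K M a) (\<Union>s\<in>Surj (a - 1). deco K M (a - 1) s ` decorations M (a - 1) s)"
  using spans_Pobj[OF spans_carrier, of "a - 1"] by (simp add: decorations_def)

text \<open>Membership in a product of unions is turned into choice functions \<open>s\<close> and
  \<open>x\<close>, the form in which substitution takes its arguments.\<close>

lemma PPobj_generator:
  assumes "y \<in> (\<Pi>\<^sub>E v\<in>verts n t. \<Union>s\<in>Surj (arity n t v - 1).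
      deco K M (arity n t v - 1) s ` decorations M (arity n t v - 1) s)"
  obtains s x where "\<And>j. j \<in> verts n t \<Longrightarrow> s j \<in> Surj (inputs n t j)"
    "\<And>j. j \<in> verts n t \<Longrightarrow> x j \<in> decorations M (inputs n t j) (s j)"
    "y = (\<lambda>j\<in>verts n t. deco K M (inputs n t j) (s j) (x j))"
proof -
  have "\<forall>v\<in>verts n t. \<exists>s x. s \<in> Surj (inputs n t v) \<and> x \<in> decorations M (inputs n t v) s \<and>
      y v = deco K M (inputs n t v) s x"
    using assms by (fastforce simp: PiE_iff arity_def)
  then obtain s x where "\<forall>v\<in>verts n t. s v \<in> Surj (inputs n t v) \<and>
      x v \<in> decorations M (inputs n t v) (s v) \<and> y v = deco K M (inputs n t v) (s v) (x v)"
    by metis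
  moreover have "y \<in> extensional (verts n t)" using assms by (simp add: PiE_iff)
  ultimately show ?thesis
    by (intro that[of s x]) (auto simp: fun_eq_iff extensional_def)
qed

lemma PPobj_eqI:
  assumes "module K B" "h \<in> linear_maps K (Pobj K (Pobj K M) (Suc n)) B"
    "k \<in> linear_maps K (Pobj K (Pobj K M) (Suc n)) B"
    and eq: "\<And>t s x. t \<in> Surj n \<Longrightarrow> (\<And>j. j \<in> verts n t \<Longrightarrow> s j \<in> Surj (inputs n t j)) \<Longrightarrow>
      (\<And>j. j \<in> verts n t \<Longrightarrow> x j \<in> decorations M (inputs n t j) (s j)) \<Longrightarrow>
      h (deco K (Pobj K M) n t (\<lambda>j\<in>verts n t. deco K M (inputs n t j) (s j) (x j))) =
      k (deco K (Pobj K M) n t (\<lambda>j\<in>verts n t. deco K M (inputs n t j) (s j) (x j)))"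
    and z: "z \<in> carrier (Pobj K (Pobj K M) (Suc n))"
  shows "h z = k z"
proof (rule spans_eqI[OF P.module_Pobj assms(1) P.spans_Pobj[OF spans_Pobj_deco] assms(2,3) _ z])
  fix z assume "z \<in> (\<Union>t\<in>Surj n. deco K (Pobj K M) n t ` (\<Pi>\<^sub>E v\<in>verts n t.
    \<Union>s\<in>Surj (arity n t v - 1). deco K M (arity n t v - 1) s ` decorations M (arity n t v - 1) s))"
  then obtain t y where t: "t \<in> Surj n" "z = deco K (Pobj K M) n t y"
    and y: "y \<in> (\<Pi>\<^sub>E v\<in>verts n t. \<Union>s\<in>Surj (arity n t v - 1).
      deco K M (arity n t v - 1) s ` decorations M (arity n t v - 1) s)" by blast
  from y show "h z = k z"
    by (rule PPobj_generator) (simp add: t eq)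
qed

lemma PPPobj_eqI:
  assumes "module K B" "h \<in> linear_maps K (Pobj K (Pobj K (Pobj K M)) (Suc n)) B"
    "k \<in> linear_maps K (Pobj K (Pobj K (Pobj K M)) (Suc n)) B"
    and eq: "\<And>t s r x. double_substitution n t s r \<Longrightarrow>
      (\<And>j i. j \<in> verts n t \<Longrightarrow> i \<in> verts (inputs n t j) (s j) \<Longrightarrow>
        x j i \<in> decorations M (inputs (inputs n t j) (s j) i) (r j i)) \<Longrightarrow>
      h (deco K (Pobj K (Pobj K M)) n t (\<lambda>j\<in>verts n t. deco K (Pobj K M) (inputs n t j) (s j)
        (\<lambda>i\<in>verts (inputs n t j) (s j). deco K M (inputs (inputs n t j) (s j) i) (r j i) (x j i)))) =
      k (deco K (Pobj K (Pobj K M)) n t (\<lambda>j\<in>verts n t. deco K (Pobj K M) (inputs n t j) (s j)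
        (\<lambda>i\<in>verts (inputs n t j) (s j). deco K M (inputs (inputs n t j) (s j) i) (r j i) (x j i))))"
    and z: "z \<in> carrier (Pobj K (Pobj K (Pobj K M)) (Suc n))"
  shows "h z = k z"
proof -
  let ?G = "\<lambda>a. \<Union>s\<in>Surj (a - 1). deco K M (a - 1) s ` decorations M (a - 1) s"
  \<comment> \<open>\<open>?G\<close> consists of decorated surjective maps in \<bbbP>(M), and
    \<open>?H\<close> of those whose decorations lie in \<open>?G\<close>, which span
    \<bbbP>(\<bbbP>(M)); one more layer spans the threefold iterate.\<close>
  let ?H = "\<lambda>a. \<Union>s\<in>Surj (a - 1). deco K (Pobj K M) (a - 1) s `
      (\<Pi>\<^sub>E v\<in>verts (a - 1) s. ?G (arity (a - 1) s v))"
  have H: "spans K (Pobj K (Pobj K M) a) (?H a)" if "2 \<le> a" for a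
    using P.spans_Pobj[OF spans_Pobj_deco, of "a - 1"] that by simp
  show ?thesis
  proof (rule spans_eqI[OF PP.module_Pobj assms(1) PP.spans_Pobj[OF H] assms(2,3) _ z])
    fix z assume "z \<in> (\<Union>t\<in>Surj n. deco K (Pobj K (Pobj K M)) n t `
      (\<Pi>\<^sub>E v\<in>verts n t. ?H (arity n t v)))"
    then obtain t y where t: "t \<in> Surj n" "z = deco K (Pobj K (Pobj K M)) n t y"
      and y: "y \<in> (\<Pi>\<^sub>E v\<in>verts n t. ?H (arity n t v))" by blast
    have "\<forall>j\<in>verts n t. \<exists>s r x. s \<in> Surj (inputs n t j) \<and>
        (\<forall>i\<in>verts (inputs n t j) s. r i \<in> Surj (inputs (inputs n t j) s i) \<and>
          x i \<in> decorations M (inputs (inputs n t j) s i) (r i)) \<and>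
        y j = deco K (Pobj K M) (inputs n t j) s
          (\<lambda>i\<in>verts (inputs n t j) s. deco K M (inputs (inputs n t j) s i) (r i) (x i))"
    proof
      fix j assume j: "j \<in> verts n t"
      have "y j \<in> ?H (arity n t j)" using y j by (rule PiE_mem)
      then obtain s w where s: "s \<in> Surj (inputs n t j)" "y j = deco K (Pobj K M) (inputs n t j) s w"
        and w: "w \<in> (\<Pi>\<^sub>E v\<in>verts (inputs n t j) s. ?G (arity (inputs n t j) s v))"
        by (auto simp: arity_def[of n])
      from w show "\<exists>s r x. s \<in> Surj (inputs n t j) \<and>
        (\<forall>i\<in>verts (inputs n t j) s. r i \<in> Surj (inputs (inputs n t j) s i) \<and>
          x i \<in> decorations M (inputs (inputs n t j) s i) (r i)) \<and>
        y j = deco K (Pobj K M) (inputs n t j) s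
          (\<lambda>i\<in>verts (inputs n t j) s. deco K M (inputs (inputs n t j) s i) (r i) (x i))"
      proof (rule PPobj_generator, goal_cases)
        case (1 r x)
        then show ?case using s by blast
      qed
    qed
    \<comment> \<open>The families are chosen one after the other, because the conditions on
      \<open>r\<close> and \<open>x\<close> mention the earlier choices.\<close>
    from bchoice[OF this] obtain s where "\<forall>j\<in>verts n t. \<exists>r x. s j \<in> Surj (inputs n t j) \<and>
        (\<forall>i\<in>verts (inputs n t j) (s j). r i \<in> Surj (inputs (inputs n t j) (s j) i) \<and>
          x i \<in> decorations M (inputs (inputs n t j) (s j) i) (r i)) \<and>
        y j = deco K (Pobj K M) (inputs n t j) (s j)
          (\<lambda>i\<in>verts (inputs n t j) (s j). deco K M (inputs (inputs n t j) (s j) i) (r i) (x i))" ..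
    from bchoice[OF this] obtain r where "\<forall>j\<in>verts n t. \<exists>x. s j \<in> Surj (inputs n t j) \<and>
        (\<forall>i\<in>verts (inputs n t j) (s j). r j i \<in> Surj (inputs (inputs n t j) (s j) i) \<and>
          x i \<in> decorations M (inputs (inputs n t j) (s j) i) (r j i)) \<and>
        y j = deco K (Pobj K M) (inputs n t j) (s j)
          (\<lambda>i\<in>verts (inputs n t j) (s j). deco K M (inputs (inputs n t j) (s j) i) (r j i) (x i))" ..
    from bchoice[OF this] obtain x where x: "\<forall>j\<in>verts n t. s j \<in> Surj (inputs n t j) \<and>
        (\<forall>i\<in>verts (inputs n t j) (s j). r j i \<in> Surj (inputs (inputs n t j) (s j) i) \<and>
          x j i \<in> decorations M (inputs (inputs n t j) (s j) i) (r j i)) \<and>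
        y j = deco K (Pobj K M) (inputs n t j) (s j)
          (\<lambda>i\<in>verts (inputs n t j) (s j). deco K M (inputs (inputs n t j) (s j) i) (r j i) (x j i))" ..
    have "y = (\<lambda>j\<in>verts n t. y j)" using y by (simp add: PiE_iff extensional_restrict)
    also have "\<dots> = (\<lambda>j\<in>verts n t. deco K (Pobj K M) (inputs n t j) (s j)
        (\<lambda>i\<in>verts (inputs n t j) (s j). deco K M (inputs (inputs n t j) (s j) i) (r j i) (x j i)))"
      by (rule restrict_ext) (use x in blast)
    finally have y': "y = \<dots>" .
    have "double_substitution n t s r" using t x by unfold_locales auto
    then show "h z = k z" unfolding t(2) y' by (rule eq) (use x in blast)
  qed
qed

end

section \<open>The action of \<bbbP> on morphisms\<close>

lemma is_Pmap_unique:
  assumes "cring K" "graded_module K M" "graded_module K N" "graded_hom K M N f"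
  shows "\<exists>!h. is_Pmap K M N f n h"
proof -
  interpret M: graded K M by (rule graded.intro) fact+
  interpret N: graded K N by (rule graded.intro) fact+
  have "\<exists>h\<in>linear_maps K (Pobj K M (Suc n)) (Pobj K N (Suc n)). \<forall>t\<in>Surj n. \<forall>x\<in>decorations M n t.
      h (deco K M n t x) = deco K N n t (\<lambda>v\<in>verts n t. f (arity n t v) (x v))"
    by (intro M.Pobj_lift N.module_Pobj multilinear_maps_precomp[OF N.deco_multilinear]
        graded_homD[OF assms(4)]) (simp_all add: arity_def)
  then obtain h where "h \<in> linear_maps K (Pobj K M (Suc n)) (Pobj K N (Suc n))"
    "\<forall>t\<in>Surj n. \<forall>x\<in>decorations M n t.
      h (deco K M n t x) = deco K N n t (\<lambda>v\<in>verts n t. f (arity n t v) (x v))" ..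
  \<comment> \<open>Linearity says nothing off the carrier; restricting to it makes the map unique,
    so that \<open>THE\<close> in \<open>Pmap\<close> denotes it.\<close>
  then have "is_Pmap K M N f n (restrict h (carrier (Pobj K M (Suc n))))"
    by (simp add: is_Pmap_def restrict_linear_map[OF M.module_Pobj] M.deco_closed)
  moreover have "h = k" if "is_Pmap K M N f n h" "is_Pmap K M N f n k" for h k
  proof (rule extensionalityI)
    show "h z = k z" if "z \<in> carrier (Pobj K M (Suc n))" for z
      by (rule M.Pobj_eqI[OF N.module_Pobj _ _ _ that])
        (use \<open>is_Pmap K M N f n h\<close> \<open>is_Pmap K M N f n k\<close> in \<open>auto simp: is_Pmap_def\<close>)
  qed (use that in \<open>auto simp: is_Pmap_def\<close>)
  ultimately show ?thesis by blast
qed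

lemma Pmap_props:
  assumes "cring K" "graded_module K M" "graded_module K N" "graded_hom K M N f"
  shows "graded_hom K (Pobj K M) (Pobj K N) (Pmap K M N f)"
    and "t \<in> Surj n \<Longrightarrow> x \<in> decorations M n t \<Longrightarrow>
      Pmap K M N f (Suc n) (deco K M n t x) = deco K N n t (\<lambda>v\<in>verts n t. f (arity n t v) (x v))"
proof -
  have *: "is_Pmap K M N f n (Pmap K M N f (Suc n))" for n
    unfolding Pmap_def using theI'[OF is_Pmap_unique[OF assms]] by simp
  have "Pmap K M N f a \<in> linear_maps K (Pobj K M a) (Pobj K N a)" if "1 \<le> a" for a
    using *[of "a - 1"] that by (simp add: is_Pmap_def)
  then show "graded_hom K (Pobj K M) (Pobj K N) (Pmap K M N f)" by (simp add: graded_hom_def)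
  show "t \<in> Surj n \<Longrightarrow> x \<in> decorations M n t \<Longrightarrow>
      Pmap K M N f (Suc n) (deco K M n t x) = deco K N n t (\<lambda>v\<in>verts n t. f (arity n t v) (x v))"
    using *[of n] by (simp add: is_Pmap_def)
qed

lemma Pmap_PPobj_deco:
  assumes "cring K" "graded_module K M" "graded_module K N" "graded_hom K (Pobj K M) N f"
    and t: "t \<in> Surj n" and s: "\<And>j. j \<in> verts n t \<Longrightarrow> s j \<in> Surj (inputs n t j)"
    and x: "\<And>j. j \<in> verts n t \<Longrightarrow> x j \<in> decorations M (inputs n t j) (s j)"
  shows "Pmap K (Pobj K M) N f (Suc n)
      (deco K (Pobj K M) n t (\<lambda>j\<in>verts n t. deco K M (inputs n t j) (s j) (x j))) =
    deco K N n t (\<lambda>j\<in>verts n t. f (arity n t j) (deco K M (inputs n t j) (s j) (x j)))"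
proof -
  interpret M: graded K M by (rule graded.intro) fact+
  have "(\<lambda>j\<in>verts n t. deco K M (inputs n t j) (s j) (x j)) \<in> decorations (Pobj K M) n t"
    using s x M.deco_closed_arity by (simp add: decorations_def)
  from Pmap_props(2)[OF assms(1) M.graded_Pobj assms(3,4) t this] show ?thesis
    by (simp cong: restrict_cong)
qed

section \<open>Substitution as a linear map\<close>

context graded
begin

interpretation P: graded K "Pobj K M"
  by (rule graded.intro[OF K graded_Pobj])

text \<open>\<open>multilinear_extension\<close> is applied with labels \<open>?Y j\<close>, the
  pairs of a surjective map and a decoration. A decorated surjective map, as an element of
  \<bbbP>(M), does not determine its decoration, while the prescribed value \<open>?\<phi>\<close>
  refers to it. The condition at a single vertex follows from \<open>Pobj_lift\<close>: for a fixed
  surjective map at that vertex, the value is multilinear in its decorations.\<close>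

lemma Gamma_multilinear:
  assumes t: "t \<in> Surj n"
  shows "\<exists>\<Phi>\<in>multilinear_maps K (verts n t) (\<lambda>j. Pobj K M (arity n t j)) (Pobj K M (Suc n)).
    \<forall>s x. (\<forall>j\<in>verts n t. s j \<in> Surj (inputs n t j)) \<longrightarrow>
      (\<forall>j\<in>verts n t. x j \<in> decorations M (inputs n t j) (s j)) \<longrightarrow>
      \<Phi> (\<lambda>j\<in>verts n t. deco K M (inputs n t j) (s j) (x j)) =
      deco K M n (subst n t s) (subst_deco n t s x)"
proof -
  let ?e = "\<lambda>j (s, x). deco K M (inputs n t j) s x"
  let ?Y = "\<lambda>j. SIGMA s:Surj (inputs n t j). decorations M (inputs n t j) s"
  let ?\<phi> = "\<lambda>y. deco K M n (subst n t (\<lambda>j. fst (y j))) (subst_deco n t (\<lambda>j. fst (y j)) (\<lambda>j. snd (y j)))"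
  have subs: "substitution n t (\<lambda>j. fst (y j))" if "y \<in> (\<Pi>\<^sub>E j\<in>verts n t. ?Y j)" for y
    using t that by unfold_locales (auto simp: PiE_iff mem_Times_iff)
  have closed: "?\<phi> y \<in> carrier (Pobj K M (Suc n))" if "y \<in> (\<Pi>\<^sub>E j\<in>verts n t. ?Y j)" for y
    using that by (intro deco_closed substitution.subst_Surj[OF subs]
        substitution.subst_deco_decorations[OF subs]) (auto simp: PiE_iff)
  have "\<exists>\<Phi>\<in>multilinear_maps K (verts n t) (\<lambda>j. Pobj K M (arity n t j)) (Pobj K M (Suc n)).
      \<forall>y\<in>(\<Pi>\<^sub>E j\<in>verts n t. ?Y j). \<Phi> (\<lambda>j\<in>verts n t. ?e j (y j)) = ?\<phi> y"
  proof (rule multilinear_extension)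
    fix j assume j: "j \<in> verts n t"
    have "?e j ` ?Y j = (\<Union>s\<in>Surj (inputs n t j). deco K M (inputs n t j) s ` decorations M (inputs n t j) s)"
      by force
    then show "spans K (Pobj K M (arity n t j)) (?e j ` ?Y j)"
      using spans_Pobj_deco[of "arity n t j"] inputs_pos[OF j] by (simp add: arity_def)
    fix y assume y: "y \<in> (\<Pi>\<^sub>E j\<in>verts n t. ?Y j)"
    have "\<exists>h\<in>linear_maps K (Pobj K M (Suc (inputs n t j))) (Pobj K M (Suc n)).
        \<forall>s\<in>Surj (inputs n t j). \<forall>x\<in>decorations M (inputs n t j) s.
          h (deco K M (inputs n t j) s x) = (\<lambda>s x. ?\<phi> (y(j := (s, x)))) s x"
    proof (rule Pobj_lift[OF module_Pobj], rule multilinear_mapsI)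
      fix s x assume s: "s \<in> Surj (inputs n t j)"
        and "x \<in> (\<Pi>\<^sub>E v\<in>verts (inputs n t j) s. carrier (M (arity (inputs n t j) s v)))"
      then have x: "x \<in> decorations M (inputs n t j) s" by (simp add: decorations_def)
      let ?z = "y(j := (s, x))"
      have z: "?z \<in> (\<Pi>\<^sub>E j\<in>verts n t. ?Y j)" using y j s x by (intro fun_upd_PiE) auto
      show "?\<phi> ?z \<in> carrier (Pobj K M (Suc n))" by (rule closed[OF z])
      fix i assume i: "i \<in> verts (inputs n t j) s"
      let ?s = "\<lambda>k. fst (?z k)" and ?x = "\<lambda>k. snd (?z k)"
      interpret substitution n t ?s by (rule subs[OF z])
      have i': "i \<in> verts (inputs n t j) (?s j)" using i by simp
      \<comment> \<open>The element \<open>a\<close> at vertex \<open>i\<close> of \<open>s\<close>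
        enters only at the vertex \<open>offset m j + i\<close> of the substitution, so linearity in
        \<open>a\<close> is that of \<open>deco\<close> in this slot.\<close>
      have "?\<phi> (y(j := (s, x(i := a)))) =
          deco K M n u ((subst_deco n t ?s ?x)(offset m j + i := a))" for a
      proof -
        have "(\<lambda>k. fst ((y(j := (s, x(i := a)))) k)) = ?s" by (auto simp: fun_eq_iff)
        moreover have "(\<lambda>k. snd ((y(j := (s, x(i := a)))) k)) = ?x(j := (?x j)(i := a))"
          by (auto simp: fun_eq_iff)
        ultimately show ?thesis using subst_deco_upd[OF j i', of ?x a] by simp
      qed
      moreover have "subst_deco n t ?s ?x \<in> decorations M n u"
        using z by (intro subst_deco_decorations) (auto simp: PiE_iff split: if_splits)
      then have "(\<lambda>a. deco K M n u ((subst_deco n t ?s ?x)(offset m j + i := a)))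
          \<in> linear_maps K (M (arity n u (offset m j + i))) (Pobj K M (Suc n))"
        using vertexI[OF j i']
        by (intro multilinear_mapsD(2)[OF deco_multilinear[OF subst_Surj]]) (auto simp: decorations_def)
      moreover have "arity n u (offset m j + i) = arity (inputs n t j) s i"
        using inputs_subst[OF j i'] by (simp add: arity_def)
      ultimately show "(\<lambda>a. ?\<phi> (y(j := (s, x(i := a)))))
          \<in> linear_maps K (M (arity (inputs n t j) s i)) (Pobj K M (Suc n))" by simp
    qed
    then show "\<exists>h\<in>linear_maps K (Pobj K M (arity n t j)) (Pobj K M (Suc n)).
        \<forall>z\<in>?Y j. h (?e j z) = ?\<phi> (y(j := z))"
      by (simp add: arity_def split_beta)
  qed (simp_all add: module_Pobj closed)
  then obtain \<Phi> where \<Phi>: "\<Phi> \<in> multilinear_maps K (verts n t) (\<lambda>j. Pobj K M (arity n t j)) (Pobj K M (Suc n))"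
    "\<And>y. y \<in> (\<Pi>\<^sub>E j\<in>verts n t. ?Y j) \<Longrightarrow> \<Phi> (\<lambda>j\<in>verts n t. ?e j (y j)) = ?\<phi> y" by blast
  show ?thesis
  proof (intro bexI[OF _ \<Phi>(1)] allI impI)
    fix s :: "nat \<Rightarrow> nat \<Rightarrow> nat" and x :: "nat \<Rightarrow> nat \<Rightarrow> 'm"
    assume s: "\<forall>j\<in>verts n t. s j \<in> Surj (inputs n t j)"
      and x: "\<forall>j\<in>verts n t. x j \<in> decorations M (inputs n t j) (s j)"
    let ?y = "\<lambda>j\<in>verts n t. (s j, x j)"
    interpret substitution n t s using t s by unfold_locales auto
    have "\<Phi> (\<lambda>j\<in>verts n t. ?e j (?y j)) = ?\<phi> ?y"
      by (rule \<Phi>(2)) (use s x in auto)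
    also have "(\<lambda>j\<in>verts n t. ?e j (?y j)) = (\<lambda>j\<in>verts n t. deco K M (inputs n t j) (s j) (x j))"
      by (rule restrict_ext) simp
    also have "subst n t (\<lambda>j. fst (?y j)) = subst n t s"
      by (rule substitution_cong) simp
    also have "subst_deco n t (\<lambda>j. fst (?y j)) (\<lambda>j. snd (?y j)) = subst_deco n t s (\<lambda>j. snd (?y j))"
      by (rule substitution_cong) simp
    also have "\<dots> = subst_deco n t s x"
      by (rule subst_deco_cong) (use t s in auto)
    finally show "\<Phi> (\<lambda>j\<in>verts n t. deco K M (inputs n t j) (s j) (x j)) =
      deco K M n (subst n t s) (subst_deco n t s x)" .
  qed
qed

text \<open>\<open>is_Gamma\<close> speaks of extensional families; since only values at vertices
  matter, the rule is available for arbitrary \<open>s\<close> and \<open>x\<close>.\<close>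

lemma is_Gamma_deco:
  assumes h: "is_Gamma K M n h"
    and t: "t \<in> Surj n" and s: "\<And>j. j \<in> verts n t \<Longrightarrow> s j \<in> Surj (inputs n t j)"
    and x: "\<And>j. j \<in> verts n t \<Longrightarrow> x j \<in> decorations M (inputs n t j) (s j)"
  shows "h (deco K (Pobj K M) n t (\<lambda>j\<in>verts n t. deco K M (inputs n t j) (s j) (x j))) =
    deco K M n (subst n t s) (subst_deco n t s x)"
proof -
  interpret substitution n t s using t s by unfold_locales
  let ?s = "restrict s (verts n t)" and ?x = "restrict x (verts n t)"
  have "h (deco K (Pobj K M) n t (\<lambda>j\<in>verts n t. deco K M (inputs n t j) (?s j) (?x j))) =
      deco K M n (subst n t ?s) (subst_deco n t ?s ?x)"
  proof -
    have "?s \<in> (\<Pi>\<^sub>E j\<in>verts n t. Surj (inputs n t j))" using s by auto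
    moreover have "?x \<in> (\<Pi>\<^sub>E j\<in>verts n t. decorations M (inputs n t j) (?s j))" using x by auto
    ultimately show ?thesis using h t unfolding is_Gamma_def by blast
  qed
  also have "(\<lambda>j\<in>verts n t. deco K M (inputs n t j) (?s j) (?x j)) =
      (\<lambda>j\<in>verts n t. deco K M (inputs n t j) (s j) (x j))"
    by (rule restrict_ext) simp
  also have "subst n t ?s = u" by (rule substitution_cong) simp
  also have "subst_deco n t ?s ?x = subst_deco n t s ?x" by (rule substitution_cong) simp
  also have "\<dots> = subst_deco n t s x" by (rule subst_deco_cong) (use t s in auto)
  finally show ?thesis .
qed

text \<open>Existence uses the universal property a second time, over \<bbbP>(M): the maps of
  \<open>Gamma_multilinear\<close>, one for each \<open>t\<close>, are glued by
  \<open>P.Pobj_lift\<close>. Uniqueness holds because doubly decorated surjective maps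
  span.\<close>

lemma is_Gamma_unique: "\<exists>!h. is_Gamma K M n h"
proof -
  have "\<forall>t\<in>Surj n. \<exists>\<Phi>.
      \<Phi> \<in> multilinear_maps K (verts n t) (\<lambda>j. Pobj K M (arity n t j)) (Pobj K M (Suc n)) \<and>
      (\<forall>s x. (\<forall>j\<in>verts n t. s j \<in> Surj (inputs n t j)) \<longrightarrow>
        (\<forall>j\<in>verts n t. x j \<in> decorations M (inputs n t j) (s j)) \<longrightarrow>
        \<Phi> (\<lambda>j\<in>verts n t. deco K M (inputs n t j) (s j) (x j)) =
        deco K M n (subst n t s) (subst_deco n t s x))"
    using Gamma_multilinear unfolding Bex_def by (rule ballI)
  from bchoice[OF this] obtain \<Phi> where \<Phi>: "\<And>t. t \<in> Surj n \<Longrightarrow>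
      \<Phi> t \<in> multilinear_maps K (verts n t) (\<lambda>j. Pobj K M (arity n t j)) (Pobj K M (Suc n))"
    "\<And>t s x. t \<in> Surj n \<Longrightarrow> \<forall>j\<in>verts n t. s j \<in> Surj (inputs n t j) \<Longrightarrow>
      \<forall>j\<in>verts n t. x j \<in> decorations M (inputs n t j) (s j) \<Longrightarrow>
      \<Phi> t (\<lambda>j\<in>verts n t. deco K M (inputs n t j) (s j) (x j)) =
      deco K M n (subst n t s) (subst_deco n t s x)"
    by blast
  obtain h where h: "h \<in> linear_maps K (Pobj K (Pobj K M) (Suc n)) (Pobj K M (Suc n))"
    "\<And>t y. t \<in> Surj n \<Longrightarrow> y \<in> decorations (Pobj K M) n t \<Longrightarrow> h (deco K (Pobj K M) n t y) = \<Phi> t y"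
    using P.Pobj_lift[OF module_Pobj \<Phi>(1)] by blast
  have "is_Gamma K M n (restrict h (carrier (Pobj K (Pobj K M) (Suc n))))"
    unfolding is_Gamma_def
  proof (intro conjI ballI)
    fix t s x assume t: "t \<in> Surj n" and s: "s \<in> (\<Pi>\<^sub>E j\<in>verts n t. Surj (inputs n t j))"
      and x: "x \<in> (\<Pi>\<^sub>E j\<in>verts n t. decorations M (inputs n t j) (s j))"
    have "(\<lambda>j\<in>verts n t. deco K M (inputs n t j) (s j) (x j)) \<in> decorations (Pobj K M) n t"
      using s x deco_closed_arity by (auto simp: decorations_def[of "Pobj K M"] PiE_iff)
    then show "restrict h (carrier (Pobj K (Pobj K M) (Suc n)))
        (deco K (Pobj K M) n t (\<lambda>j\<in>verts n t. deco K M (inputs n t j) (s j) (x j))) =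
        deco K M n (subst n t s) (subst_deco n t s x)"
      using P.deco_closed[OF t] h(2)[OF t] \<Phi>(2)[OF t, of s x] s x by (simp add: PiE_iff)
  qed (use restrict_linear_map[OF P.module_Pobj h(1)] in auto)
  moreover have "h = k" if h: "is_Gamma K M n h" and k: "is_Gamma K M n k" for h k
  proof (rule extensionalityI)
    fix z assume z: "z \<in> carrier (Pobj K (Pobj K M) (Suc n))"
    have lin: "h \<in> linear_maps K (Pobj K (Pobj K M) (Suc n)) (Pobj K M (Suc n))"
      "k \<in> linear_maps K (Pobj K (Pobj K M) (Suc n)) (Pobj K M (Suc n))"
      using h k by (simp_all add: is_Gamma_def)
    show "h z = k z"
      by (rule PPobj_eqI[OF module_Pobj lin _ z])
        (rule trans[OF is_Gamma_deco[OF h] is_Gamma_deco[OF k, symmetric]])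
  qed (use h k in \<open>auto simp: is_Gamma_def\<close>)
  ultimately show ?thesis by blast
qed

lemma is_Gamma_Gamma: "is_Gamma K M n (Gamma K M (Suc n))"
  unfolding Gamma_def using theI'[OF is_Gamma_unique] by simp

lemmas Gamma_deco = is_Gamma_deco[OF is_Gamma_Gamma]

lemma graded_hom_Gamma: "graded_hom K (Pobj K (Pobj K M)) (Pobj K M) (Gamma K M)"
proof -
  have "Gamma K M a \<in> linear_maps K (Pobj K (Pobj K M) a) (Pobj K M a)" if "1 \<le> a" for a
    using is_Gamma_Gamma[of "a - 1"] that by (simp add: is_Gamma_def)
  then show ?thesis by (simp add: graded_hom_def)
qed

end

section \<open>The unit and arity 1\<close>

lemma decorations_0: "decorations M 0 t = {\<lambda>_. undefined}"
  by (simp add: decorations_def)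

context graded
begin

interpretation U: module K "Pobj K M (Suc 0)"
  by (rule module_Pobj)

lemma unit_id_closed: "unit_id K M \<in> carrier (Pobj K M 1)"
  using deco_closed[of "\<lambda>_. undefined" 0] by (simp add: unit_id_def decorations_0)

lemma spans_unit_id: "spans K (Pobj K M 1) {unit_id K M}"
  using spans_Pobj[OF spans_carrier, of 0] by (simp add: unit_id_def)

text \<open>Onto, because the multiples of the spanning element \<open>unit_id K M\<close> form a
  submodule. Injective, because some linear map sends it to a generator of a free module of rank
  one, where the coefficient can be read off.\<close>

lemma bij_unit_id: "bij_betw (\<lambda>r. r \<odot>\<^bsub>Pobj K M 1\<^esub> unit_id K M) (carrier K) (carrier (Pobj K M 1))"
proof -
  have u: "unit_id K M \<in> carrier (Pobj K M 1)" by (rule unit_id_closed)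
  let ?S = "(\<lambda>r. r \<odot>\<^bsub>Pobj K M 1\<^esub> unit_id K M) ` carrier K"
  have sub: "?S \<subseteq> carrier (Pobj K M 1)" using u by auto
  have "submodule ?S K (Pobj K M 1)"
  proof (rule submoduleI'[OF module_Pobj])
    show "?S \<subseteq> carrier (Pobj K M 1)" by (rule sub)
    show "\<zero>\<^bsub>Pobj K M 1\<^esub> \<in> ?S"
      using u by (intro image_eqI[of _ _ "\<zero>\<^bsub>K\<^esub>"]) simp_all
    fix a assume "a \<in> ?S"
    then obtain p where p: "p \<in> carrier K" "a = p \<odot>\<^bsub>Pobj K M 1\<^esub> unit_id K M" by blast
    show "r \<odot>\<^bsub>Pobj K M 1\<^esub> a \<in> ?S" if "r \<in> carrier K" for r
      using that p u by (intro image_eqI[of _ _ "r \<otimes>\<^bsub>K\<^esub> p"]) (simp_all add: U.smult_assoc1)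
    fix b assume "b \<in> ?S"
    then obtain q where q: "q \<in> carrier K" "b = q \<odot>\<^bsub>Pobj K M 1\<^esub> unit_id K M" by blast
    show "a \<oplus>\<^bsub>Pobj K M 1\<^esub> b \<in> ?S"
      using p q u by (intro image_eqI[of _ _ "p \<oplus>\<^bsub>K\<^esub> q"]) (simp_all add: U.smult_l_distr)
  qed
  moreover have "unit_id K M \<in> ?S"
    using u by (intro image_eqI[of _ _ "\<one>\<^bsub>K\<^esub>"]) simp_all
  ultimately have "carrier (Pobj K M 1) \<subseteq> ?S"
    using spans_unit_id unfolding spans_def by blast
  with sub have img: "?S = carrier (Pobj K M 1)" by (rule equalityI)
  \<comment> \<open>The free module on one point stands for \<open>K\<close> as a module over
    itself; the coordinate is evaluation at \<open>()\<close>.\<close>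
  let ?F = "free_module K {()}"
  have F: "module K ?F" by (rule module_free_module[OF K])
  have g: "free_gen K () \<in> carrier ?F" by (rule free_gen_closed[OF K]) simp
  have "\<exists>h\<in>linear_maps K (Pobj K M (Suc 0)) ?F. \<forall>t\<in>Surj 0. \<forall>x\<in>decorations M 0 t.
      h (deco K M 0 t x) = (\<lambda>_ _. free_gen K ()) t x"
    by (rule Pobj_lift[OF F]) (rule multilinear_mapsI, use g in simp_all)
  then obtain h where h: "h \<in> linear_maps K (Pobj K M 1) ?F" "h (unit_id K M) = free_gen K ()"
    by (auto simp: unit_id_def decorations_0)
  have "h (r \<odot>\<^bsub>Pobj K M 1\<^esub> unit_id K M) () = r" if "r \<in> carrier K" for r
    using linear_mapsD(3)[OF h(1) that u] that by (simp add: h(2) free_module_simps free_gen_def)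
  then have "inj_on (\<lambda>r. r \<odot>\<^bsub>Pobj K M 1\<^esub> unit_id K M) (carrier K)"
    by (rule inj_on_inverseI[where g = "\<lambda>z. h z ()"])
  then show ?thesis using img by (simp add: bij_betw_def)
qed

lemma id_coeff_smult_unit_id:
  "r \<in> carrier K \<Longrightarrow> id_coeff K M (r \<odot>\<^bsub>Pobj K M 1\<^esub> unit_id K M) = r"
  unfolding id_coeff_def by (rule the_inv_into_f_f[OF bij_betw_imp_inj_on[OF bij_unit_id]])

lemma Pobj_1E:
  assumes "z \<in> carrier (Pobj K M 1)"
  obtains r where "r \<in> carrier K" "z = r \<odot>\<^bsub>Pobj K M 1\<^esub> unit_id K M"
  using assms bij_betw_imp_surj_on[OF bij_unit_id] by blast

lemma linear_form_id_coeff: "linear_form K (Pobj K M 1) (id_coeff K M)"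
  unfolding linear_form_def
proof (intro conjI ballI funcsetI)
  fix x assume x: "x \<in> carrier (Pobj K M 1)"
  then obtain p where p: "p \<in> carrier K" "x = p \<odot>\<^bsub>Pobj K M 1\<^esub> unit_id K M" by (rule Pobj_1E)
  show "id_coeff K M x \<in> carrier K" using p by (simp only: id_coeff_smult_unit_id)
  show "id_coeff K M (r \<odot>\<^bsub>Pobj K M 1\<^esub> x) = r \<otimes>\<^bsub>K\<^esub> id_coeff K M x" if r: "r \<in> carrier K" for r
  proof -
    have "r \<odot>\<^bsub>Pobj K M 1\<^esub> x = (r \<otimes>\<^bsub>K\<^esub> p) \<odot>\<^bsub>Pobj K M 1\<^esub> unit_id K M"
      unfolding p(2) using U.smult_assoc1[OF r p(1) unit_id_closed[unfolded One_nat_def]] by simp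
    then show ?thesis using r p by (simp only: id_coeff_smult_unit_id U.R.m_closed)
  qed
  fix y assume "y \<in> carrier (Pobj K M 1)"
  then obtain q where q: "q \<in> carrier K" "y = q \<odot>\<^bsub>Pobj K M 1\<^esub> unit_id K M" by (rule Pobj_1E)
  have "x \<oplus>\<^bsub>Pobj K M 1\<^esub> y = (p \<oplus>\<^bsub>K\<^esub> q) \<odot>\<^bsub>Pobj K M 1\<^esub> unit_id K M"
    unfolding p(2) q(2) using U.smult_l_distr[OF p(1) q(1) unit_id_closed[unfolded One_nat_def]] by simp
  then show "id_coeff K M (x \<oplus>\<^bsub>Pobj K M 1\<^esub> y) = id_coeff K M x \<oplus>\<^bsub>K\<^esub> id_coeff K M y"
    using p q by (simp only: id_coeff_smult_unit_id U.R.a_closed)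
qed

text \<open>\<open>unit_id K M\<close> spans arity 1, so compatibility with the forms need only be
  tested on its multiples. This serves both \<open>Pmap\<close> and \<open>Gamma\<close>, which send
  the identity to the identity.\<close>

lemma preserves_form_id_coeff:
  assumes h: "h 1 \<in> linear_maps K (Pobj K M 1) A"
    and unit: "\<And>r. r \<in> carrier K \<Longrightarrow> \<eta> (r \<odot>\<^bsub>A\<^esub> h 1 (unit_id K M)) = r"
  shows "preserves_form (Pobj K M) (id_coeff K M) \<eta> h"
  unfolding preserves_form_def
proof
  fix x assume "x \<in> carrier (Pobj K M 1)"
  then obtain r where r: "r \<in> carrier K" "x = r \<odot>\<^bsub>Pobj K M 1\<^esub> unit_id K M" by (rule Pobj_1E)
  then show "\<eta> (h 1 x) = id_coeff K M x"
    using linear_mapsD(3)[OF h r(1) unit_id_closed] unit[OF r(1)]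
    by (simp only: id_coeff_smult_unit_id)
qed

text \<open>The case \<open>n = 0\<close> of substitution: no inputs, no vertices, and all families
  are \<open>\<lambda>_. undefined\<close>.\<close>

lemma Gamma_unit_id: "Gamma K M 1 (unit_id K (Pobj K M)) = unit_id K M"
  using Gamma_deco[of "\<lambda>_. undefined" 0 "\<lambda>_. undefined" "\<lambda>_. undefined"]
  by (simp add: unit_id_def subst_def subst_deco_def restrict_def)

lemma Iota_linear:
  assumes \<epsilon>: "linear_form K (M 1) \<epsilon>"
  shows "graded_hom K M (Pobj K M) (Iota K M \<epsilon>)"
  unfolding graded_hom_def
proof (intro allI impI)
  fix a :: nat assume a: "1 \<le> a"
  show "Iota K M \<epsilon> a \<in> linear_maps K (M a) (Pobj K M a)"
  proof (cases "a = 1")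
    case True
    have "(\<lambda>\<mu>. \<epsilon> \<mu> \<odot>\<^bsub>Pobj K M 1\<^esub> unit_id K M) \<in> linear_maps K (M 1) (Pobj K M 1)"
      using \<epsilon> unit_id_closed unfolding linear_form_def
      by (intro linear_mapsI) (auto simp: Pi_iff U.smult_l_distr U.smult_assoc1)
    then show ?thesis using True by (simp add: Iota_def[abs_def])
  next
    case False
    define n where "n = a - 1"
    have n: "a = Suc n" "1 \<le> n" using False a by (auto simp: n_def)
    interpret A: module K "M a" by (rule graded_moduleD[OF M a])
    note ml = deco_multilinear[OF corolla_simps(1)[OF n(2)]]
    have ar: "arity n (corolla n) 1 = a" using n by (simp add: arity_def)
    \<comment> \<open>A base point for linearity in the only slot: the zero is overwritten by
      \<mu>.\<close>
    have "(\<lambda>v\<in>{1}. \<zero>\<^bsub>M a\<^esub>) \<in> (\<Pi>\<^sub>E v\<in>verts n (corolla n). carrier (M (arity n (corolla n) v)))"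
      using n ar A.M.zero_closed by auto
    from multilinear_mapsD(2)[OF ml this, of 1]
    have "(\<lambda>\<mu>. deco K M n (corolla n) ((\<lambda>v\<in>{1}. \<zero>\<^bsub>M a\<^esub>)(1 := \<mu>))) \<in> linear_maps K (M a) (Pobj K M a)"
      using n ar by simp
    moreover have "(\<lambda>v\<in>{Suc 0}. \<zero>\<^bsub>M a\<^esub>)(Suc 0 := \<mu>) = (\<lambda>v\<in>{Suc 0}. \<mu>)" for \<mu> :: 'm
      by (auto simp: fun_eq_iff)
    ultimately show ?thesis using n by (simp add: Iota_def[abs_def])
  qed
qed

lemma Iota_Suc: "1 \<le> n \<Longrightarrow> Iota K M \<epsilon> (Suc n) \<mu> = deco K M n (corolla n) (\<lambda>v\<in>{1}. \<mu>)"
  by (simp add: Iota_def)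

lemma corolla_decorations:
  "1 \<le> n \<Longrightarrow> \<mu> \<in> carrier (M (Suc n)) \<Longrightarrow> (\<lambda>v\<in>{1}. \<mu>) \<in> decorations M n (corolla n)"
  by (auto simp: decorations_def arity_def)

end

section \<open>Unit laws and associativity\<close>

context graded
begin

interpretation P: graded K "Pobj K M"
  by (rule graded.intro[OF K graded_Pobj])

text \<open>In arity 1 the form on \<bbbP>(M) has to return the coefficient of the identity, which
  \<open>id_coeff\<close> does. In higher arities the outer surjective map is a corolla and
  \<open>subst_corolla_left\<close> applies.\<close>

lemma Gamma_Iota_left:
  "graded_eq (Pobj K M) (Gamma K M \<circ>\<^sub>g Iota K (Pobj K M) (id_coeff K M)) graded_id"
  unfolding graded_eq_def
proof (intro allI impI ballI)
  fix a \<mu> assume a: "1 \<le> a" and \<mu>: "\<mu> \<in> carrier (Pobj K M a)"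
  note lin = linear_maps_comp[OF graded_homD[OF P.Iota_linear[OF linear_form_id_coeff] a]
      graded_homD[OF graded_hom_Gamma a]]
  have "Gamma K M a (Iota K (Pobj K M) (id_coeff K M) a \<mu>) = \<mu>"
  proof (cases "a = 1")
    case True
    obtain r where r: "r \<in> carrier K" "\<mu> = r \<odot>\<^bsub>Pobj K M 1\<^esub> unit_id K M"
      using \<mu> unfolding True by (rule Pobj_1E)
    have "Iota K (Pobj K M) (id_coeff K M) a \<mu> = r \<odot>\<^bsub>Pobj K (Pobj K M) 1\<^esub> unit_id K (Pobj K M)"
      using True r(1) by (simp only: Iota_def r(2) id_coeff_smult_unit_id refl if_True)
    then show ?thesis
      using linear_mapsD(3)[OF graded_homD[OF graded_hom_Gamma a] r(1)] P.unit_id_closed True r(2)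
        Gamma_unit_id by simp
  next
    case False
    define n where "n = a - 1"
    have n: "a = Suc n" "1 \<le> n" using False a by (auto simp: n_def)
    have id: "(\<lambda>\<mu>. \<mu>) \<in> linear_maps K (Pobj K M (Suc n)) (Pobj K M (Suc n))"
      by (rule linear_maps_id)
    show ?thesis
    proof (rule Pobj_eqI[OF module_Pobj lin[unfolded n(1)] id _ \<mu>[unfolded n(1)], folded n(1)])
      fix s x assume s: "s \<in> Surj n" and x: "x \<in> decorations M n s"
      have "(\<lambda>v\<in>{1}. deco K M n s x) =
          (\<lambda>v\<in>verts n (corolla n). deco K M (inputs n (corolla n) v) s x)"
        using n(2) by (auto simp: fun_eq_iff)
      then have "Gamma K M a (Iota K (Pobj K M) (id_coeff K M) a (deco K M n s x)) =
          Gamma K M (Suc n) (deco K (Pobj K M) n (corolla n)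
            (\<lambda>v\<in>verts n (corolla n). deco K M (inputs n (corolla n) v) s x))"
        using P.Iota_Suc[OF n(2)] n(1) by simp
      also have "\<dots> = deco K M n (subst n (corolla n) (\<lambda>_. s)) (subst_deco n (corolla n) (\<lambda>_. s) (\<lambda>_. x))"
        by (rule Gamma_deco) (use n s x in auto)
      also have "\<dots> = deco K M n s x"
        using subst_corolla_left(1)[OF n(2), of "\<lambda>_. s"]
          subst_corolla_left(2)[OF n(2), of "\<lambda>_. s" "\<lambda>_. x"] s decorations_ext[OF x] by simp
      finally show "Gamma K M a (Iota K (Pobj K M) (id_coeff K M) a (deco K M n s x)) = deco K M n s x" .
    qed
  qed
  then show "(Gamma K M \<circ>\<^sub>g Iota K (Pobj K M) (id_coeff K M)) a \<mu> = graded_id a \<mu>"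
    by (simp add: graded_comp_def graded_id_def)
qed

text \<open>The form \<epsilon> is arbitrary because \<bbbP>(\<iota>) applies \<open>Iota\<close>
  only at vertices, where the arity is at least 2. In arity 1 there are no vertices, and the
  identity goes to the identity.\<close>

lemma Gamma_Iota_right:
  assumes \<epsilon>: "linear_form K (M 1) \<epsilon>"
  shows "graded_eq (Pobj K M) (Gamma K M \<circ>\<^sub>g Pmap K M (Pobj K M) (Iota K M \<epsilon>)) graded_id"
  unfolding graded_eq_def
proof (intro allI impI ballI)
  fix a \<mu> assume a: "1 \<le> a" and \<mu>: "\<mu> \<in> carrier (Pobj K M a)"
  define n where "n = a - 1"
  have n: "a = Suc n" using a by (auto simp: n_def)
  note P\<iota> = Pmap_props[OF K M graded_Pobj Iota_linear[OF \<epsilon>]]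
  note lin = linear_maps_comp[OF graded_homD[OF P\<iota>(1) a] graded_homD[OF graded_hom_Gamma a]]
  have id: "(\<lambda>\<mu>. \<mu>) \<in> linear_maps K (Pobj K M (Suc n)) (Pobj K M (Suc n))"
    by (rule linear_maps_id)
  have "Gamma K M (Suc n) (Pmap K M (Pobj K M) (Iota K M \<epsilon>) (Suc n) \<mu>) = \<mu>"
  proof (rule Pobj_eqI[OF module_Pobj lin[unfolded n(1)] id _ \<mu>[unfolded n(1)]])
    fix t x assume t: "t \<in> Surj n" and x: "x \<in> decorations M n t"
    have pos: "1 \<le> inputs n t j" if "j \<in> verts n t" for j using inputs_pos[OF that] .
    have "Pmap K M (Pobj K M) (Iota K M \<epsilon>) (Suc n) (deco K M n t x) =
        deco K (Pobj K M) n t (\<lambda>j\<in>verts n t. Iota K M \<epsilon> (arity n t j) (x j))"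
      by (rule P\<iota>(2)[OF t x])
    also have "(\<lambda>j\<in>verts n t. Iota K M \<epsilon> (arity n t j) (x j)) =
        (\<lambda>j\<in>verts n t. deco K M (inputs n t j) (corolla (inputs n t j)) (\<lambda>v\<in>{1}. x j))"
      by (rule restrict_ext) (simp only: arity_def Suc_eq_plus1[symmetric] Iota_Suc[OF pos])
    finally have "Gamma K M (Suc n) (Pmap K M (Pobj K M) (Iota K M \<epsilon>) (Suc n) (deco K M n t x)) =
        Gamma K M (Suc n) (deco K (Pobj K M) n t
          (\<lambda>j\<in>verts n t. deco K M (inputs n t j) (corolla (inputs n t j)) (\<lambda>v\<in>{1}. x j)))"
      by (simp only:)
    also have "\<dots> = deco K M n (subst n t (\<lambda>j. corolla (inputs n t j)))
        (subst_deco n t (\<lambda>j. corolla (inputs n t j)) (\<lambda>j. \<lambda>v\<in>{1}. x j))"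
    proof (rule Gamma_deco[OF t])
      fix j assume j: "j \<in> verts n t"
      show "corolla (inputs n t j) \<in> Surj (inputs n t j)" using pos[OF j] by (rule corolla_simps)
      show "(\<lambda>v\<in>{1}. x j) \<in> decorations M (inputs n t j) (corolla (inputs n t j))"
        using decorationsD[OF x j] by (intro corolla_decorations pos[OF j]) (simp add: arity_def)
    qed
    also have "\<dots> = deco K M n t x"
      by (simp only: subst_corolla_right(1)[OF t] subst_corolla_right(2)[OF t decorations_ext[OF x]])
    finally show "Gamma K M (Suc n) (Pmap K M (Pobj K M) (Iota K M \<epsilon>) (Suc n) (deco K M n t x)) =
        deco K M n t x" .
  qed
  then show "(Gamma K M \<circ>\<^sub>g Pmap K M (Pobj K M) (Iota K M \<epsilon>)) a \<mu> = graded_id a \<mu>"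
    by (simp add: graded_comp_def graded_id_def n)
qed

lemma Gamma_assoc:
  "graded_eq (Pobj K (Pobj K (Pobj K M)))
    (Gamma K M \<circ>\<^sub>g Pmap K (Pobj K (Pobj K M)) (Pobj K M) (Gamma K M))
    (Gamma K M \<circ>\<^sub>g Gamma K (Pobj K M))"
  unfolding graded_eq_def
proof (intro allI impI ballI)
  fix a z assume a: "1 \<le> a" and z: "z \<in> carrier (Pobj K (Pobj K (Pobj K M)) a)"
  define n where "n = a - 1"
  have n: "a = Suc n" using a by (auto simp: n_def)
  note P\<Gamma> = Pmap_props[OF K P.graded_Pobj graded_Pobj graded_hom_Gamma]
  note \<Gamma> = graded_homD[OF graded_hom_Gamma a] and P\<Gamma>' = graded_homD[OF P\<Gamma>(1) a]
    and \<Gamma>P = graded_homD[OF P.graded_hom_Gamma a]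
  note lin1 = linear_maps_comp[OF P\<Gamma>' \<Gamma>] and lin2 = linear_maps_comp[OF \<Gamma>P \<Gamma>]
  have "Gamma K M (Suc n) (Pmap K (Pobj K (Pobj K M)) (Pobj K M) (Gamma K M) (Suc n) z) =
      Gamma K M (Suc n) (Gamma K (Pobj K M) (Suc n) z)"
  proof (rule PPPobj_eqI[OF module_Pobj lin1[unfolded n] lin2[unfolded n] _ z[unfolded n]])
    fix t s r x assume "double_substitution n t s r"
      and x: "\<And>j i. j \<in> verts n t \<Longrightarrow> i \<in> verts (inputs n t j) (s j) \<Longrightarrow>
        x j i \<in> decorations M (inputs (inputs n t j) (s j) i) (r j i)"
    then interpret double_substitution n t s r by simp
    let ?y = "\<lambda>j. \<lambda>i\<in>verts (inputs n t j) (s j). deco K M (inputs (inputs n t j) (s j) i) (r j i) (x j i)"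
    have y: "?y j \<in> decorations (Pobj K M) (inputs n t j) (s j)" if "j \<in> verts n t" for j
      using r[OF that] x[OF that] deco_closed_arity by (simp add: decorations_def[of "Pobj K M"])
    \<comment> \<open>The common value of both composites on \<open>?z\<close>. One composite
      carries out the inner substitutions first, the other the outer one.\<close>
    let ?d = "deco K M n (subst n t (\<lambda>j. subst (inputs n t j) (s j) (r j)))
        (subst_deco n t (\<lambda>j. subst (inputs n t j) (s j) (r j))
          (\<lambda>j. subst_deco (inputs n t j) (s j) (r j) (x j)))"
    let ?z = "deco K (Pobj K (Pobj K M)) n t (\<lambda>j\<in>verts n t. deco K (Pobj K M) (inputs n t j) (s j) (?y j))"
    have "Pmap K (Pobj K (Pobj K M)) (Pobj K M) (Gamma K M) (Suc n)
          ?z =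
        deco K (Pobj K M) n t
          (\<lambda>j\<in>verts n t. Gamma K M (arity n t j) (deco K (Pobj K M) (inputs n t j) (s j) (?y j)))"
      by (rule Pmap_PPobj_deco[OF K P.M graded_Pobj graded_hom_Gamma t s y])
    also have "(\<lambda>j\<in>verts n t. Gamma K M (arity n t j) (deco K (Pobj K M) (inputs n t j) (s j) (?y j))) =
        (\<lambda>j\<in>verts n t. deco K M (inputs n t j) (subst (inputs n t j) (s j) (r j))
          (subst_deco (inputs n t j) (s j) (r j) (x j)))"
    proof (rule restrict_ext)
      fix j assume j: "j \<in> verts n t"
      have "Gamma K M (Suc (inputs n t j)) (deco K (Pobj K M) (inputs n t j) (s j) (?y j)) =
          deco K M (inputs n t j) (subst (inputs n t j) (s j) (r j))
            (subst_deco (inputs n t j) (s j) (r j) (x j))"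
        by (rule Gamma_deco[OF s[OF j] r[OF j] x[OF j]])
      then show "Gamma K M (arity n t j) (deco K (Pobj K M) (inputs n t j) (s j) (?y j)) =
          deco K M (inputs n t j) (subst (inputs n t j) (s j) (r j))
            (subst_deco (inputs n t j) (s j) (r j) (x j))" by (simp add: arity_def)
    qed
    finally have L: "Gamma K M (Suc n) (Pmap K (Pobj K (Pobj K M)) (Pobj K M) (Gamma K M) (Suc n) ?z) = ?d"
      by (simp only:) (rule Gamma_deco[OF t substitution.subst_Surj[OF inner]
            substitution.subst_deco_decorations[OF inner x]])
    let ?r = "subst_deco n t s r" and ?x = "subst_deco n t s x"
    have "Gamma K (Pobj K M) (Suc n)
        ?z =
        deco K (Pobj K M) n u (subst_deco n t s ?y)"
      by (rule P.Gamma_deco[OF t s y])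
    \<comment> \<open>After the outer substitution the decorations are still decorated surjective
      maps; their underlying maps and their own decorations are renumbered separately, by the same
      operation.\<close>
    also have "subst_deco n t s ?y = (\<lambda>p\<in>verts n u. deco K M (inputs n u p) (?r p) (?x p))"
      by (rule subst_deco_eqI) (simp_all add: vertexI inputs_subst subst_deco_vertex)
    finally have R: "Gamma K (Pobj K M) (Suc n) ?z =
        deco K (Pobj K M) n u (\<lambda>p\<in>verts n u. deco K M (inputs n u p) (?r p) (?x p))" .
    have "Gamma K M (Suc n) (deco K (Pobj K M) n u
        (\<lambda>p\<in>verts n u. deco K M (inputs n u p) (?r p) (?x p))) =
        deco K M n (subst n u ?r) (subst_deco n u ?r ?x)"
    proof (rule Gamma_deco[OF subst_Surj])
      fix p assume p: "p \<in> verts n u"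
      show "?r p \<in> Surj (inputs n u p)" by (rule substitution.s[OF outer p])
      from p show "?x p \<in> decorations M (inputs n u p) (?r p)"
        by (rule vertexE) (simp add: inputs_subst subst_deco_vertex x)
    qed
    also have "\<dots> = ?d" by (simp only: subst_assoc subst_deco_assoc)
    finally show "Gamma K M (Suc n) (Pmap K (Pobj K (Pobj K M)) (Pobj K M) (Gamma K M) (Suc n) ?z) =
        Gamma K M (Suc n) (Gamma K (Pobj K M) (Suc n) ?z)"
      by (simp only: L R)
  qed
  then show "(Gamma K M \<circ>\<^sub>g Pmap K (Pobj K (Pobj K M)) (Pobj K M) (Gamma K M)) a z =
      (Gamma K M \<circ>\<^sub>g Gamma K (Pobj K M)) a z"
    by (simp add: graded_comp_def n)
qed

end

section \<open>Naturality\<close>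

locale graded_morphism = M: graded K M + N: graded K N
  for K :: "('r, 'k) ring_scheme" and M :: "nat \<Rightarrow> ('r, 'm) module" and N :: "nat \<Rightarrow> ('r, 'n) module" +
  fixes g :: "nat \<Rightarrow> 'm \<Rightarrow> 'n"
  assumes g: "graded_hom K M N g"
begin

interpretation PM: graded K "Pobj K M"
  by (rule graded.intro[OF M.K M.graded_Pobj])

interpretation PN: graded K "Pobj K N"
  by (rule graded.intro[OF M.K N.graded_Pobj])

lemmas hom_Pmap = Pmap_props(1)[OF M.K M.M N.M g]
lemmas Pmap_deco = Pmap_props(2)[OF M.K M.M N.M g]

lemma Pmap_unit_id: "Pmap K M N g 1 (unit_id K M) = unit_id K N"
  using Pmap_deco[of "\<lambda>_. undefined" 0 "\<lambda>_. undefined"]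
  by (simp add: unit_id_def decorations_0 restrict_def)

text \<open>\<bbbP>(g) leaves surjective maps alone and acts on each decoration. Inner vertices keep
  their arity under substitution, so the same component of \<open>g\<close> acts before and after
  it.\<close>

lemma Gamma_natural:
  "graded_eq (Pobj K (Pobj K M)) (Pmap K M N g \<circ>\<^sub>g Gamma K M)
    (Gamma K N \<circ>\<^sub>g Pmap K (Pobj K M) (Pobj K N) (Pmap K M N g))"
  unfolding graded_eq_def
proof (intro allI impI ballI)
  fix a z assume a: "1 \<le> a" and z: "z \<in> carrier (Pobj K (Pobj K M) a)"
  define n where "n = a - 1"
  have n: "a = Suc n" using a by (auto simp: n_def)
  note PP = Pmap_props[OF M.K M.graded_Pobj N.graded_Pobj hom_Pmap]
  note lin1 = linear_maps_comp[OF graded_homD[OF M.graded_hom_Gamma a] graded_homD[OF hom_Pmap a]]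
  note lin2 = linear_maps_comp[OF graded_homD[OF PP(1) a] graded_homD[OF N.graded_hom_Gamma a]]
  have "Pmap K M N g (Suc n) (Gamma K M (Suc n) z) =
      Gamma K N (Suc n) (Pmap K (Pobj K M) (Pobj K N) (Pmap K M N g) (Suc n) z)"
  proof (rule M.PPobj_eqI[OF N.module_Pobj lin1[unfolded n] lin2[unfolded n] _ z[unfolded n]])
    fix t s x assume t: "t \<in> Surj n" and s: "\<And>j. j \<in> verts n t \<Longrightarrow> s j \<in> Surj (inputs n t j)"
      and x: "\<And>j. j \<in> verts n t \<Longrightarrow> x j \<in> decorations M (inputs n t j) (s j)"
    interpret substitution n t s using t s by unfold_locales
    let ?d = "deco K (Pobj K M) n t (\<lambda>j\<in>verts n t. deco K M (inputs n t j) (s j) (x j))"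
    let ?gx = "\<lambda>j. \<lambda>v\<in>verts (inputs n t j) (s j). g (arity (inputs n t j) (s j) v) (x j v)"
    have gx: "?gx j \<in> decorations N (inputs n t j) (s j)" if "j \<in> verts n t" for j
    proof -
      have "g (arity (inputs n t j) (s j) v) (x j v) \<in> carrier (N (arity (inputs n t j) (s j) v))"
        if "v \<in> verts (inputs n t j) (s j)" for v
        by (rule linear_mapsD(1)[OF graded_homD[OF g] decorationsD[OF x[OF \<open>j \<in> verts n t\<close>] that]])
          (simp add: arity_def)
      then show ?thesis by (simp add: decorations_def)
    qed
    have "Pmap K (Pobj K M) (Pobj K N) (Pmap K M N g) (Suc n) ?d = deco K (Pobj K N) n t
        (\<lambda>j\<in>verts n t. Pmap K M N g (arity n t j) (deco K M (inputs n t j) (s j) (x j)))"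
      by (rule Pmap_PPobj_deco[OF M.K M.M N.graded_Pobj hom_Pmap t s x])
    also have "(\<lambda>j\<in>verts n t. Pmap K M N g (arity n t j) (deco K M (inputs n t j) (s j) (x j))) =
        (\<lambda>j\<in>verts n t. deco K N (inputs n t j) (s j) (?gx j))"
      by (rule restrict_ext) (simp add: arity_def[of n] Pmap_deco s x)
    finally have "Gamma K N (Suc n) (Pmap K (Pobj K M) (Pobj K N) (Pmap K M N g) (Suc n) ?d) =
        deco K N n u (subst_deco n t s ?gx)"
      by (simp only:) (rule N.Gamma_deco[OF t s gx])
    also have "subst_deco n t s ?gx = (\<lambda>p\<in>verts n u. g (arity n u p) (subst_deco n t s x p))"
      by (rule subst_deco_eqI) (simp_all add: vertexI inputs_subst subst_deco_vertex arity_def)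
    also have "deco K N n u \<dots> = Pmap K M N g (Suc n) (deco K M n u (subst_deco n t s x))"
      by (rule Pmap_deco[OF subst_Surj subst_deco_decorations[OF x], symmetric])
    also have "deco K M n u (subst_deco n t s x) = Gamma K M (Suc n) ?d"
      by (rule M.Gamma_deco[OF t s x, symmetric])
    finally show "Pmap K M N g (Suc n) (Gamma K M (Suc n) ?d) =
        Gamma K N (Suc n) (Pmap K (Pobj K M) (Pobj K N) (Pmap K M N g) (Suc n) ?d)" ..
  qed
  then show "(Pmap K M N g \<circ>\<^sub>g Gamma K M) a z =
      (Gamma K N \<circ>\<^sub>g Pmap K (Pobj K M) (Pobj K N) (Pmap K M N g)) a z"
    by (simp add: graded_comp_def n)
qed

lemma Iota_natural:
  assumes "2 \<le> a" and \<mu>: "\<mu> \<in> carrier (M a)"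
  shows "Pmap K M N g a (Iota K M \<epsilon> a \<mu>) = Iota K N \<eta> a (g a \<mu>)"
proof -
  define n where "n = a - 1"
  have n: "a = Suc n" "1 \<le> n" using assms(1) by (auto simp: n_def)
  have "Pmap K M N g a (Iota K M \<epsilon> a \<mu>) = deco K N n (corolla n)
      (\<lambda>v\<in>verts n (corolla n). g (arity n (corolla n) v) ((\<lambda>v\<in>{1}. \<mu>) v))"
    using \<mu> unfolding n(1) M.Iota_Suc[OF n(2)]
    by (intro Pmap_deco corolla_simps n M.corolla_decorations)
  also have "(\<lambda>v\<in>verts n (corolla n). g (arity n (corolla n) v) ((\<lambda>v\<in>{1}. \<mu>) v)) = (\<lambda>v\<in>{1}. g a \<mu>)"
    using n by (auto simp: fun_eq_iff arity_def)
  finally show ?thesis using N.Iota_Suc[OF n(2)] by (simp only: n(1))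
qed

text \<open>In arity 1 both sides are multiples of the identity, by \<open>\<epsilon> \<mu>\<close>
  and by \<open>\<eta> (g 1 \<mu>)\<close>, which \<open>preserves_form\<close> makes equal; in
  higher arities the forms do not enter.\<close>

lemma Iota_natural_form:
  assumes "preserves_form M \<epsilon> \<eta> g" "linear_form K (M 1) \<epsilon>"
  shows "graded_eq M (Pmap K M N g \<circ>\<^sub>g Iota K M \<epsilon>) (Iota K N \<eta> \<circ>\<^sub>g g)"
  unfolding graded_eq_def
proof (intro allI impI ballI)
  fix a \<mu> assume a: "1 \<le> a" and \<mu>: "\<mu> \<in> carrier (M a)"
  have "Pmap K M N g a (Iota K M \<epsilon> a \<mu>) = Iota K N \<eta> a (g a \<mu>)"
  proof (cases "a = 1")
    case True
    have "\<epsilon> \<mu> \<in> carrier K" "\<eta> (g 1 \<mu>) = \<epsilon> \<mu>"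
      using assms \<mu> True by (auto simp: preserves_form_def linear_form_def)
    then show ?thesis
      using True linear_mapsD(3)[OF graded_homD[OF hom_Pmap] _ M.unit_id_closed] Pmap_unit_id
      by (simp add: Iota_def)
  next
    case False
    then show ?thesis using a \<mu> by (intro Iota_natural) auto
  qed
  then show "(Pmap K M N g \<circ>\<^sub>g Iota K M \<epsilon>) a \<mu> = (Iota K N \<eta> \<circ>\<^sub>g g) a \<mu>"
    by (simp add: graded_comp_def)
qed

end

section \<open>Functoriality of \<bbbP>\<close>

lemma graded_hom_id: "graded_hom K M M graded_id"
  by (auto simp: graded_hom_def graded_id_def linear_maps_def)

lemma Pmap_id:
  assumes "cring K" "graded_module K M"
  shows "graded_eq (Pobj K M) (Pmap K M M graded_id) graded_id"
  unfolding graded_eq_def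
proof (intro allI impI ballI)
  interpret graded K M using assms by (rule graded.intro)
  note P = Pmap_props[OF K M M graded_hom_id]
  fix a z assume a: "1 \<le> a" and z: "z \<in> carrier (Pobj K M a)"
  define n where "n = a - 1"
  have n: "a = Suc n" using a by (auto simp: n_def)
  have id: "(\<lambda>\<mu>. \<mu>) \<in> linear_maps K (Pobj K M (Suc n)) (Pobj K M (Suc n))"
    by (rule linear_maps_id)
  have "Pmap K M M graded_id (Suc n) z = z"
  proof (rule Pobj_eqI[OF module_Pobj graded_homD[OF P(1) a, unfolded n] id _ z[unfolded n]])
    fix t x assume t: "t \<in> Surj n" and x: "x \<in> decorations M n t"
    show "Pmap K M M graded_id (Suc n) (deco K M n t x) = deco K M n t x"
      unfolding P(2)[OF t x] by (simp only: graded_id_def deco_restrict[OF x])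
  qed
  then show "Pmap K M M graded_id a z = graded_id a z" by (simp add: n graded_id_def)
qed

lemma Pmap_comp:
  assumes "cring K" "graded_module K L" "graded_module K M" "graded_module K N"
    and f: "graded_hom K L M f" and g: "graded_hom K M N g"
  shows "graded_eq (Pobj K L) (Pmap K L N (g \<circ>\<^sub>g f)) (Pmap K M N g \<circ>\<^sub>g Pmap K L M f)"
  unfolding graded_eq_def
proof (intro allI impI ballI)
  interpret L: graded K L using assms(1,2) by (rule graded.intro)
  interpret N: graded K N using assms(1,4) by (rule graded.intro)
  note Pf = Pmap_props[OF assms(1-3) f] and Pg = Pmap_props[OF assms(1,3,4) g]
    and Pgf = Pmap_props[OF assms(1,2,4) graded_hom_comp[OF f g]]
  fix a z assume a: "1 \<le> a" and z: "z \<in> carrier (Pobj K L a)"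
  define n where "n = a - 1"
  have n: "a = Suc n" using a by (auto simp: n_def)
  note lin1 = graded_homD[OF Pgf(1) a]
    and lin2 = linear_maps_comp[OF graded_homD[OF Pf(1) a] graded_homD[OF Pg(1) a]]
  have "Pmap K L N (g \<circ>\<^sub>g f) (Suc n) z = Pmap K M N g (Suc n) (Pmap K L M f (Suc n) z)"
  proof (rule L.Pobj_eqI[OF N.module_Pobj lin1[unfolded n] lin2[unfolded n] _ z[unfolded n]])
    fix t x assume t: "t \<in> Surj n" and x: "x \<in> decorations L n t"
    have fx: "(\<lambda>v\<in>verts n t. f (arity n t v) (x v)) \<in> decorations M n t"
    proof -
      have "f (arity n t v) (x v) \<in> carrier (M (arity n t v))" if "v \<in> verts n t" for v
        by (rule linear_mapsD(1)[OF graded_homD[OF f] decorationsD[OF x that]]) (simp add: arity_def)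
      then show ?thesis by (simp add: decorations_def)
    qed
    show "Pmap K L N (g \<circ>\<^sub>g f) (Suc n) (deco K L n t x) =
        Pmap K M N g (Suc n) (Pmap K L M f (Suc n) (deco K L n t x))"
      by (simp only: Pgf(2)[OF t x] Pf(2)[OF t x] Pg(2)[OF t fx])
        (simp add: graded_comp_def cong: restrict_cong)
  qed
  then show "Pmap K L N (g \<circ>\<^sub>g f) a z = (Pmap K M N g \<circ>\<^sub>g Pmap K L M f) a z"
    by (simp add: graded_comp_def n)
qed

text \<open>\<open>id_coeff\<close> undoes the scaling of \<open>unit_id\<close> by which
  \<open>Iota\<close> is defined in arity 1.\<close>

lemma (in graded) preserves_form_Iota:
  assumes "linear_form K (M 1) \<epsilon>"
  shows "preserves_form M \<epsilon> (id_coeff K M) (Iota K M \<epsilon>)"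
proof -
  have "\<epsilon> x \<in> carrier K" if "x \<in> carrier (M 1)" for x
    using assms that by (auto simp: linear_form_def)
  then show ?thesis
    using id_coeff_smult_unit_id by (simp add: preserves_form_def Iota_def)
qed

text \<open>The clauses on linear forms settle arity 1: among arity-graded modules with a linear
  form on their component of arity 1, \<bbbP>(M) with \<open>id_coeff\<close> is again such an
  object, and \<bbbP>(g), \<Gamma> and \<iota> respect the forms. There \<iota> is natural in every
  arity, and the unit laws hold with \<open>id_coeff\<close> on \<bbbP>(M) and \<epsilon> on
  \<open>M\<close>.\<close>

theorem proposition1p4:
  fixes K :: "('r, 'k) ring_scheme"
    and L :: "nat \<Rightarrow> ('r, 'l) module"
    and M :: "nat \<Rightarrow> ('r, 'm) module"
    and N :: "nat \<Rightarrow> ('r, 'n) module"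
    and f :: "nat \<Rightarrow> 'l \<Rightarrow> 'm"
    and g :: "nat \<Rightarrow> 'm \<Rightarrow> 'n"
    and \<epsilon> :: "'m \<Rightarrow> 'r"
    and \<eta> :: "'n \<Rightarrow> 'r"
  assumes "cring K"
    and "graded_module K L" and "graded_module K M" and "graded_module K N"
    and "graded_hom K L M f" and "graded_hom K M N g"
    and "linear_form K (M 1) \<epsilon>" and "linear_form K (N 1) \<eta>"
  shows
    \<comment> \<open>the endofunctor \<open>\<bbbP>\<close>, with \<open>\<bbbP>(M)\<^sub>1 = K id\<close>\<close>
    "graded_module K (Pobj K M) \<and>
     unit_id K M \<in> carrier (Pobj K M 1) \<and>
     bij_betw (\<lambda>r. r \<odot>\<^bsub>Pobj K M 1\<^esub> unit_id K M) (carrier K) (carrier (Pobj K M 1)) \<and>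
     (\<forall>n. \<exists>!h. is_Pmap K M N g n h) \<and>
     graded_hom K (Pobj K M) (Pobj K N) (Pmap K M N g) \<and>
     graded_eq (Pobj K M) (Pmap K M M graded_id) graded_id \<and>
     graded_eq (Pobj K L) (Pmap K L N (g \<circ>\<^sub>g f)) (Pmap K M N g \<circ>\<^sub>g Pmap K L M f) \<and>
    \<comment> \<open>substitution defines a natural transformation \<open>\<Gamma>\<close> from \<open>\<bbbP> \<circ> \<bbbP>\<close> to \<open>\<bbbP>\<close>\<close>
     (\<forall>n. \<exists>!h. is_Gamma K M n h) \<and>
     graded_hom K (Pobj K (Pobj K M)) (Pobj K M) (Gamma K M) \<and>
     graded_eq (Pobj K (Pobj K M))
       (Pmap K M N g \<circ>\<^sub>g Gamma K M)
       (Gamma K N \<circ>\<^sub>g Pmap K (Pobj K M) (Pobj K N) (Pmap K M N g)) \<and>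
    \<comment> \<open>\<open>\<Gamma>\<close> is associative\<close>
     graded_eq (Pobj K (Pobj K (Pobj K M)))
       (Gamma K M \<circ>\<^sub>g Pmap K (Pobj K (Pobj K M)) (Pobj K M) (Gamma K M))
       (Gamma K M \<circ>\<^sub>g Gamma K (Pobj K M)) \<and>
    \<comment> \<open>\<open>\<iota>\<close> is a natural transformation from the identity to \<open>\<bbbP>\<close>\<close>
     graded_hom K M (Pobj K M) (Iota K M \<epsilon>) \<and>
     (\<forall>n\<ge>2. \<forall>\<mu>\<in>carrier (M n). Pmap K M N g n (Iota K M \<epsilon> n \<mu>) = Iota K N \<eta> n (g n \<mu>)) \<and>
     (preserves_form M \<epsilon> \<eta> g \<longrightarrow>
        graded_eq M (Pmap K M N g \<circ>\<^sub>g Iota K M \<epsilon>) (Iota K N \<eta> \<circ>\<^sub>g g)) \<and>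
    \<comment> \<open>\<open>\<Gamma>\<close> is unital with respect to \<open>\<iota>\<close>\<close>
     graded_eq (Pobj K M)
       (Gamma K M \<circ>\<^sub>g Iota K (Pobj K M) (id_coeff K M)) graded_id \<and>
     graded_eq (Pobj K M)
       (Gamma K M \<circ>\<^sub>g Pmap K M (Pobj K M) (Iota K M \<epsilon>)) graded_id \<and>
    \<comment> \<open>compatibility of \<open>\<bbbP>\<close>, \<open>\<Gamma>\<close> and \<open>\<iota>\<close> with the linear forms in arity 1\<close>
     linear_form K (Pobj K M 1) (id_coeff K M) \<and>
     preserves_form (Pobj K M) (id_coeff K M) (id_coeff K N) (Pmap K M N g) \<and>
     preserves_form (Pobj K (Pobj K M)) (id_coeff K (Pobj K M)) (id_coeff K M) (Gamma K M) \<and>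
     preserves_form M \<epsilon> (id_coeff K M) (Iota K M \<epsilon>)"
proof (intro conjI allI impI)
  interpret M: graded K M using assms(1,3) by (rule graded.intro)
  interpret N: graded K N using assms(1,4) by (rule graded.intro)
  interpret PM: graded K "Pobj K M" using assms(1) M.graded_Pobj by (rule graded.intro)
  interpret g: graded_morphism K M N g using assms(6) by unfold_locales
  show "graded_module K (Pobj K M)" by (rule M.graded_Pobj)
  show "unit_id K M \<in> carrier (Pobj K M 1)" by (rule M.unit_id_closed)
  show "bij_betw (\<lambda>r. r \<odot>\<^bsub>Pobj K M 1\<^esub> unit_id K M) (carrier K) (carrier (Pobj K M 1))"
    by (rule M.bij_unit_id)
  show "\<exists>!h. is_Pmap K M N g n h" for n by (rule is_Pmap_unique[OF assms(1,3,4,6)])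
  show "graded_hom K (Pobj K M) (Pobj K N) (Pmap K M N g)" by (rule g.hom_Pmap)
  show "graded_eq (Pobj K M) (Pmap K M M graded_id) graded_id" by (rule Pmap_id[OF assms(1,3)])
  show "graded_eq (Pobj K L) (Pmap K L N (g \<circ>\<^sub>g f)) (Pmap K M N g \<circ>\<^sub>g Pmap K L M f)"
    by (rule Pmap_comp[OF assms(1-6)])
  show "\<exists>!h. is_Gamma K M n h" for n by (rule M.is_Gamma_unique)
  show "graded_hom K (Pobj K (Pobj K M)) (Pobj K M) (Gamma K M)" by (rule M.graded_hom_Gamma)
  show "graded_eq (Pobj K (Pobj K M)) (Pmap K M N g \<circ>\<^sub>g Gamma K M)
      (Gamma K N \<circ>\<^sub>g Pmap K (Pobj K M) (Pobj K N) (Pmap K M N g))"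
    by (rule g.Gamma_natural)
  show "graded_eq (Pobj K (Pobj K (Pobj K M)))
      (Gamma K M \<circ>\<^sub>g Pmap K (Pobj K (Pobj K M)) (Pobj K M) (Gamma K M))
      (Gamma K M \<circ>\<^sub>g Gamma K (Pobj K M))"
    by (rule M.Gamma_assoc)
  show "graded_hom K M (Pobj K M) (Iota K M \<epsilon>)" by (rule M.Iota_linear[OF assms(7)])
  show "\<forall>\<mu>\<in>carrier (M n). Pmap K M N g n (Iota K M \<epsilon> n \<mu>) = Iota K N \<eta> n (g n \<mu>)" if "2 \<le> n" for n
    using g.Iota_natural[OF that] by blast
  show "graded_eq M (Pmap K M N g \<circ>\<^sub>g Iota K M \<epsilon>) (Iota K N \<eta> \<circ>\<^sub>g g)" if "preserves_form M \<epsilon> \<eta> g"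
    by (rule g.Iota_natural_form[OF that assms(7)])
  show "graded_eq (Pobj K M) (Gamma K M \<circ>\<^sub>g Iota K (Pobj K M) (id_coeff K M)) graded_id"
    by (rule M.Gamma_Iota_left)
  show "graded_eq (Pobj K M) (Gamma K M \<circ>\<^sub>g Pmap K M (Pobj K M) (Iota K M \<epsilon>)) graded_id"
    by (rule M.Gamma_Iota_right[OF assms(7)])
  show "linear_form K (Pobj K M 1) (id_coeff K M)" by (rule M.linear_form_id_coeff)
  show "preserves_form (Pobj K M) (id_coeff K M) (id_coeff K N) (Pmap K M N g)"
    by (rule M.preserves_form_id_coeff[where h = "Pmap K M N g", OF graded_homD[OF g.hom_Pmap]])
      (simp_all only: g.Pmap_unit_id N.id_coeff_smult_unit_id order_refl)
  show "preserves_form (Pobj K (Pobj K M)) (id_coeff K (Pobj K M)) (id_coeff K M) (Gamma K M)"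
    by (rule PM.preserves_form_id_coeff[where h = "Gamma K M", OF graded_homD[OF M.graded_hom_Gamma]])
      (simp_all only: M.Gamma_unit_id M.id_coeff_smult_unit_id order_refl)
  show "preserves_form M \<epsilon> (id_coeff K M) (Iota K M \<epsilon>)" by (rule M.preserves_form_Iota[OF assms(7)])
qed

end
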